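(* Let $G$ be a planar graph with girth $g(G)\geq 10$ and maximum degree $\Delta(G)=4$. Then $\chi^2(G)\leq 6$.
   Context: All graphs are finite and simple. The girth $g(G)$ is the length of a shortest cycle of $G$. A $2$-distance $k$-coloring of $G$ is a map $V(G)\to\{1,\dots,k\}$ such that any two distinct vertices at distance at most $2$ in $G$ receive different colors; $\chi^2(G)$ is the smallest $k$ for which such a coloring exists. *)

theory Defs
  imports
    "HOL-Analysis.Analysis"
    "HOL-Library.Extended_Nat"
    "Graph_Theory.Pair_Digraph"
    "Graph_Theory.Shortest_Path"
begin

text \<open>
  A finite simple graph is a \<open>pair_graph\<close>: a finite, loop-free digraph with symmetric arc relation,
  in which the undirected edge \<open>uv\<close> is represented by the two arcs \<open>(u, v)\<close> and \<open>(v, u)\<close>. The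
  degree of a vertex is thus its out-degree, and the coercion \<open>with_proj\<close> is implicit below.
\<close>

definition max_degree :: "'a pair_pre_digraph \<Rightarrow> nat" where
  "max_degree G = (SUP v\<in>pverts G. out_degree G v)"

text \<open>
  The directed notion \<open>cycle\<close> also admits traversing an edge back and forth, i.e. \<open>[(u, v), (v, u)]\<close>;
  this is the only closed walk it admits in a \<open>pair_graph\<close> that is not a cycle of the undirected
  graph, and it is excluded by requiring length at least 3. The girth of a forest is \<open>\<infinity>\<close>.
\<close>

definition girth :: "'a pair_pre_digraph \<Rightarrow> enat" where
  "girth G = (INF p\<in>{p. pre_digraph.cycle G p \<and> 3 \<le> length p}. enat (length p))"

text \<open>The value is \<open>\<infinity>\<close> for vertices in different components.\<close>

definition graph_dist :: "'a pair_pre_digraph \<Rightarrow> 'a \<Rightarrow> 'a \<Rightarrow> ereal" where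
  "graph_dist G u v = wf_digraph.\<mu> G (\<lambda>_. 1) u v"

definition two_distance_coloring :: "'a pair_pre_digraph \<Rightarrow> nat \<Rightarrow> ('a \<Rightarrow> nat) \<Rightarrow> bool" where
  "two_distance_coloring G k c \<longleftrightarrow>
     c \<in> pverts G \<rightarrow> {1..k} \<and>
     (\<forall>u\<in>pverts G. \<forall>v\<in>pverts G. u \<noteq> v \<and> graph_dist G u v \<le> 2 \<longrightarrow> c u \<noteq> c v)"

definition two_distance_chromatic_number :: "'a pair_pre_digraph \<Rightarrow> nat" where
  "two_distance_chromatic_number G = (LEAST k. \<exists>c. two_distance_coloring G k c)"

text \<open>
  A plane drawing places the vertices at distinct points \<open>pos v\<close> of the plane, and draws each edge as
  a simple arc between its ends that meets the vertex points and the other edges only at common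
  ends. The two opposite arcs of an edge are drawn as the same curve, traversed in opposite
  directions.
\<close>

definition plane_drawing ::
  "'a pair_pre_digraph \<Rightarrow> ('a \<Rightarrow> complex) \<Rightarrow> ('a \<times> 'a \<Rightarrow> real \<Rightarrow> complex) \<Rightarrow> bool" where
  "plane_drawing G pos \<gamma> \<longleftrightarrow>
     inj_on pos (pverts G) \<and>
     (\<forall>(u, v)\<in>parcs G.
        arc (\<gamma> (u, v)) \<and> pathstart (\<gamma> (u, v)) = pos u \<and> pathfinish (\<gamma> (u, v)) = pos v \<and>
        \<gamma> (v, u) = reversepath (\<gamma> (u, v)) \<and>
        path_image (\<gamma> (u, v)) \<inter> pos ` pverts G = {pos u, pos v}) \<and>
     (\<forall>(u, v)\<in>parcs G. \<forall>(x, y)\<in>parcs G. {u, v} \<noteq> {x, y} \<longrightarrow>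
        path_image (\<gamma> (u, v)) \<inter> path_image (\<gamma> (x, y)) = pos ` ({u, v} \<inter> {x, y}))"

definition planar :: "'a pair_pre_digraph \<Rightarrow> bool" where
  "planar G \<longleftrightarrow> (\<exists>pos \<gamma>. plane_drawing G pos \<gamma>)"

end

theory Submission
  imports Defs
begin

text \<open>
  Euler's formula, in the form \<open>8 |E| + 10 \<le> 10 |V|\<close> for plane graphs of girth at least 10, makes the average
  degree of every subgraph smaller than \<open>5/2\<close>. A smallest graph of maximum degree at most 4 without the
  required colouring avoids some small trees \<open>S\<close>: delete a vertex of \<open>S\<close>, colour the rest by minimality and
  recolour \<open>S\<close> from the colours that are still available. If the vertices carry the charge \<open>24 deg v - 60\<close>,
  then the absence of these trees allows the vertices of degree 3 and 4 to pay for those of degree 2, so that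
  no charge stays negative, contrary to the bound on the average degree.

  Euler's inequality is proved without faces. A smallest counterexample is nonseparable. A path drawn inside a
  cycle \<open>C\<close> between two of its vertices splits the inside of \<open>C\<close> by the theta-curve theorem, and induction gives
  \<open>8 e + 10 \<le> 10 n + |C|\<close> for the numbers \<open>e\<close>, \<open>n\<close> of edges and vertices inside \<open>C\<close>. An inversion turns the
  outside of \<open>C\<close> into the inside; adding the two estimates gives the claim.
\<close>

section \<open>Euler's inequality for plane graphs of girth at least 10\<close>

text \<open>The disc estimate is Euler's formula with the faces eliminated: if the inside of
  \<open>C\<close> has \<open>f\<close> faces, each bounded by at least 10 edges, then
  \<open>10 f <= 2 e + |C|\<close>, while \<open>f = e - n + 1\<close>. The girth is used a second
  time for the small trees. Two walks of length at most 4 without immediate reversals and with a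
  common start have at most 9 vertices between them, too few to close a cycle. So all vertices named
  around a tree are distinct, and a vertex outside the tree sees at most one vertex of it. A
  2-distance colouring is treated as a map that is injective on every closed neighbourhood. An outer
  neighbour \<open>m\<close> then leaves at least \<open>6 - deg m\<close> colours to the vertex of
  the tree adjacent to it: 2 in general, 3 if \<open>deg m <= 3\<close>. This one extra colour is
  why the degrees of the far ends decide about reducibility. The obstacle in the discharging is a
  vertex of degree 3 with three neighbours of degree 2: its surplus is too small to pay its half to
  each of them. The factor 24 makes all the unequal shares used instead integral.\<close>

fun path_edges :: "'a list \<Rightarrow> 'a set set" where
  "path_edges (x # y # xs) = insert {x, y} (path_edges (y # xs))"
| "path_edges _ = {}"

lemma path_edges_Union: "\<Union>(path_edges p) \<subseteq> set p"
  by (induction p rule: path_edges.induct) auto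

lemma path_edges_Union_eq: "2 \<le> length p \<Longrightarrow> \<Union>(path_edges p) = set p"
proof (induction p rule: path_edges.induct)
  case (1 x y xs)
  then show ?case by (cases xs) auto
qed auto

lemma finite_path_edges [simp]: "finite (path_edges p)"
  by (induction p rule: path_edges.induct) auto

lemma path_edges_append: "p \<noteq> [] \<Longrightarrow> q \<noteq> [] \<Longrightarrow> path_edges (p @ q) =
  path_edges p \<union> {{last p, hd q}} \<union> path_edges q"
  by (induction p rule: path_edges.induct) (auto simp: neq_Nil_conv)

lemma path_edges_rev: "path_edges (rev p) = path_edges p"
proof (induction p rule: path_edges.induct)
  case (1 x y xs)
  have "path_edges (rev (x # y # xs)) = path_edges (rev (y # xs) @ [x])" by simp
  also have "\<dots> = insert {x, y} (path_edges (y # xs))"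
    by (subst path_edges_append) (use 1 in \<open>auto simp: insert_commute\<close>)
  finally show ?case by simp
qed auto

lemma card_path_edges: "distinct p \<Longrightarrow> card (path_edges p) = length p - 1"
proof (induction p rule: path_edges.induct)
  case (1 x y xs)
  have "{x, y} \<notin> path_edges (y # xs)"
    using 1(2) path_edges_Union[of "y # xs"] by auto
  then show ?case using 1 by auto
qed auto

lemma path_edges_decomp: "path_edges (xs @ a # ys) = path_edges (xs @ [a]) \<union> path_edges (a # ys)"
  by (cases "xs = []") (auto simp: path_edges_append)

definition cycle_edges :: "'a list \<Rightarrow> 'a set set" where
  "cycle_edges cs = path_edges (cs @ [hd cs])"

definition gcycle :: "'a set set \<Rightarrow> 'a list \<Rightarrow> bool" where
  "gcycle E cs \<longleftrightarrow> distinct cs \<and> 3 \<le> length cs \<and> cycle_edges cs \<subseteq> E"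

lemma cycle_edges_rotate1: "cs \<noteq> [] \<Longrightarrow> cycle_edges (rotate1 cs) = cycle_edges cs"
proof -
  assume "cs \<noteq> []"
  then obtain x xs where cs: "cs = x # xs" by (cases cs) auto
  show ?thesis
  proof (cases xs)
    case Nil
    then show ?thesis by (simp add: cs)
  next
    case (Cons y ys)
    have "path_edges (y # ys @ [x, y]) = path_edges ((y # ys) @ x # [y])" by simp
    also have "\<dots> = path_edges (y # ys @ [x]) \<union> {{x, y}}"
      by (subst path_edges_decomp) auto
    finally show ?thesis by (auto simp: cs Cons cycle_edges_def)
  qed
qed

lemma cycle_edges_rotate: "cs \<noteq> [] \<Longrightarrow> cycle_edges (rotate n cs) = cycle_edges cs"
  by (induction n) (auto simp: cycle_edges_rotate1)

lemma gcycle_rotate: "gcycle E cs \<Longrightarrow> gcycle E (rotate n cs)"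
  unfolding gcycle_def by (cases "cs = []") (simp_all add: cycle_edges_rotate)

definition gpath :: "'a set set \<Rightarrow> 'a \<Rightarrow> 'a list \<Rightarrow> 'a \<Rightarrow> bool" where
  "gpath E a p b \<longleftrightarrow> distinct p \<and> 2 \<le> length p \<and> hd p = a \<and> last p = b
    \<and> path_edges p \<subseteq> E"

text \<open>The cycle is rotated to start at \<open>a\<close> and cut at \<open>b\<close>; the
  second path is the reversed remainder. That the two paths share no edge follows by counting: their
  union has \<open>length cs\<close> edges, which is also the sum of their numbers of edges.\<close>

lemma gcycle_split:
  assumes C: "gcycle E cs" and ab: "a \<in> set cs" "b \<in> set cs" "a \<noteq> b"
  obtains p q where "gpath E a p b" "gpath E a q b" "path_edges p \<union> path_edges q = cycle_edges cs"
    "path_edges p \<inter> path_edges q = {}"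
    "set p \<inter> set q = {a, b}" "set p \<union> set q = set cs" "length p + length q = length cs + 2"
proof -
  obtain xs ys where "cs = xs @ a # ys" using ab(1) by (meson split_list)
  then have "rotate (length xs) cs = a # ys @ xs" by (simp add: rotate_append)
  then obtain zs where z: "rotate (length xs) cs = a # zs" by simp
  define ds where "ds = a # zs"
  have D: "gcycle E ds" "cycle_edges ds = cycle_edges cs" "set ds = set cs" "length ds = length cs"
    using gcycle_rotate[OF C, of "length xs"] cycle_edges_rotate[of cs "length xs"] C z set_rotate[of "length xs" cs]
      length_rotate[of "length xs" cs] \<open>a \<in> set cs\<close> unfolding ds_def gcycle_def
    by (simp_all del: set_rotate length_rotate) force
  have "b \<in> set zs" using ab D(3) by (auto simp: ds_def)
  then obtain us ws where zs: "zs = us @ b # ws" by (meson split_list)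
  define p where "p = a # us @ [b]"
  define q where "q = a # rev ws @ [b]"
  have ds: "ds = a # us @ b # ws" by (simp add: ds_def zs)
  have dist: "distinct (a # us @ b # ws)" using D(1) ds by (simp add: gcycle_def)
  have "cycle_edges ds = path_edges ((a # us) @ b # (ws @ [a]))" by (simp add: cycle_edges_def ds)
  also have "\<dots> = path_edges p \<union> path_edges (b # ws @ [a])" by (subst path_edges_decomp) (simp add: p_def)
  also have "path_edges (b # ws @ [a]) = path_edges q" using path_edges_rev[of "b # ws @ [a]"] by (simp add: q_def)
  finally have un: "path_edges p \<union> path_edges q = cycle_edges cs" using D(2) by simp
  have s: "set p \<inter> set q = {a, b}" using dist by (auto simp: p_def q_def)
  \<comment> \<open>The closing edge is new because there are at least three vertices; with only two
    it would be the first edge again.\<close>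
  have cc: "card (cycle_edges cs) = length cs"
  proof -
    have "cycle_edges ds = insert {a, last ds} (path_edges ds)" unfolding cycle_edges_def
      by (subst path_edges_append) (auto simp: ds insert_commute)
    moreover have "{a, last ds} \<notin> path_edges ds"
    proof
      assume *: "{a, last ds} \<in> path_edges ds"
      obtain c cs' where cs': "us @ b # ws = c # cs'" by (cases "us @ b # ws") auto
      have "cs' \<noteq> []" using D(1) by (auto simp: gcycle_def ds cs')
      then have l: "last ds \<noteq> c" "last ds \<in> set cs'" using dist by (auto simp: ds cs')
      have "{a, last ds} \<noteq> {a, c}" using l dist cs' by (auto simp: doubleton_eq_iff)
      then have "{a, last ds} \<in> path_edges (c # cs')" using * by (simp add: ds cs')
      then have "a \<in> set (c # cs')" using path_edges_Union[of "c # cs'"] by auto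
      then show False using dist cs' by auto
    qed
    ultimately have "card (cycle_edges ds) = Suc (card (path_edges ds))" by simp
    then show ?thesis using card_path_edges[of ds] dist D(2,4) by (simp add: ds)
  qed
  have len: "length p + length q = length cs + 2" using D(4) by (simp add: p_def q_def ds)
  have dp: "distinct p" "distinct q" using dist by (auto simp: p_def q_def)
  have "card (path_edges p) + card (path_edges q) = length cs"
    using card_path_edges[OF dp(1)] card_path_edges[OF dp(2)] len by (simp add: p_def q_def)
  moreover have "card (path_edges p \<union> path_edges q) + card (path_edges p \<inter> path_edges q) = card
    (path_edges p) + card (path_edges q)"
    using card_Un_Int[of "path_edges p" "path_edges q"] by simp
  ultimately have "card (path_edges p \<inter> path_edges q) = 0" using cc un by simp
  then have int: "path_edges p \<inter> path_edges q = {}" by simp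
  have sub: "path_edges p \<subseteq> E" "path_edges q \<subseteq> E" using un C unfolding gcycle_def by blast+
  have hl: "hd p = a" "last p = b" "hd q = a" "last q = b" "2 \<le> length p" "2 \<le> length q"
    by (simp_all add: p_def q_def)
  have "gpath E a p b" unfolding gpath_def using dp(1) sub(1) hl by blast
  moreover have "gpath E a q b" unfolding gpath_def using dp(2) sub(2) hl by blast
  moreover have "set p \<union> set q = set ds" by (auto simp: p_def q_def ds)
  ultimately show thesis using that un int s len D(3) by metis
qed

lemma gcycle_card: "gcycle E cs \<Longrightarrow> card (cycle_edges cs) = length cs"
proof -
  assume C: "gcycle E cs"
  then obtain a b zs where cs: "cs = a # b # zs" by (cases cs; cases "tl cs") (auto simp: gcycle_def)
  then have "a \<noteq> b" using C by (auto simp: gcycle_def)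
  then obtain p q where pq: "gpath E a p b" "gpath E a q b"
    "path_edges p \<union> path_edges q = cycle_edges cs" "path_edges p \<inter> path_edges q = {}"
     "length p + length q = length cs + 2"
    using gcycle_split[OF C, of a b] cs by (metis list.set_intros)
  then have "card (cycle_edges cs) = card (path_edges p) + card (path_edges q)"
    by (metis card_Un_disjoint finite_path_edges)
  moreover have "card (path_edges p) = length p - 1" "2 \<le> length p" "card (path_edges q) = length q - 1"
    "2 \<le> length q"
    using pq(1,2) by (simp_all add: gpath_def card_path_edges)
  ultimately show ?thesis using pq(5) by linarith
qed

lemma gcycle_Union: "gcycle E cs \<Longrightarrow> \<Union>(cycle_edges cs) = set cs"
  unfolding cycle_edges_def gcycle_def by (subst path_edges_Union_eq) (auto intro: hd_in_set)

lemma gcycle_merge: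
  assumes p: "gpath E a p b" and q: "gpath E a q b" and ab: "a \<noteq> b"
    and s: "set p \<inter> set q = {a, b}" and e: "path_edges p \<inter> path_edges q = {}"
  obtains cs where "gcycle E cs" "cycle_edges cs = path_edges p \<union> path_edges q" "set cs = set p \<union> set q"
    "length cs + 2 = length p + length q"
proof -
  obtain us where p': "p = a # us @ [b]"
    using p ab unfolding gpath_def
    by (metis append_butlast_last_id last_ConsL last_tl list.collapse list.sel(3) list.size(3) not_numeral_le_zero)
  obtain ws where q': "q = a # ws @ [b]"
    using q ab unfolding gpath_def
    by (metis append_butlast_last_id last_ConsL last_tl list.collapse list.sel(3) list.size(3) not_numeral_le_zero)
  define cs where "cs = a # us @ b # rev ws"
  have "cycle_edges cs = path_edges ((a # us) @ b # (rev ws @ [a]))" by (simp add: cycle_edges_def cs_def)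
  also have "\<dots> = path_edges p \<union> path_edges (b # rev ws @ [a])" by (subst path_edges_decomp) (simp
    add: p')
  also have "path_edges (b # rev ws @ [a]) = path_edges q" using path_edges_rev[of q] by (simp add: q')
  finally have c: "cycle_edges cs = path_edges p \<union> path_edges q" .
  \<comment> \<open>If both paths were the single edge \<open>ab\<close>, they would not be
    edge-disjoint. This provides the third vertex of the cycle.\<close>
  have "us \<noteq> [] \<or> ws \<noteq> []" using e by (auto simp: p' q')
  then have "3 \<le> length cs" by (cases us; cases ws) (auto simp: cs_def)
  moreover have "distinct cs" using p q s by (auto simp: cs_def gpath_def p' q')
  ultimately have "gcycle E cs" using c p q by (auto simp: gcycle_def gpath_def)
  then show thesis by (rule that) (use c in \<open>auto simp: cs_def p' q'\<close>)
qed

section \<open>Drawings of paths and cycles as arcs and closed curves\<close>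

lemma Int_squeeze: "A \<inter> B = C \<Longrightarrow> C \<subseteq> D \<Longrightarrow> D \<subseteq> B
  \<Longrightarrow> A \<inter> D = C"
  by blast

lemma two_elements: "2 \<le> card A \<Longrightarrow> \<exists>a b. a \<in> A \<and> b \<in> A \<and> a \<noteq> b"
proof -
  assume "2 \<le> card A"
  then obtain T where "T \<subseteq> A" "card T = 2" by (rule obtain_subset_with_card_n)
  then show ?thesis unfolding card_2_iff by blast
qed

text \<open>Each edge is a two-element set with a point set attached, so neither orientations nor
  parametrisations have to be carried along. The vertex set is \<open>\<Union>E\<close>, hence a
  graph is determined by its edges and passing to a subgraph is passing to a subset.\<close>

locale plane_graph =
  fixes E :: "'a set set" and pos :: "'a \<Rightarrow> complex" and img :: "'a set \<Rightarrow> complex set"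
  assumes finite_E: "finite E"
    and edge: "e \<in> E \<Longrightarrow> \<exists>u v g. e = {u, v} \<and> u \<noteq> v \<and> arc g \<and>
      pathstart g = pos u \<and> pathfinish g = pos v
          \<and> path_image g = img e"
    and inj_pos: "inj_on pos (\<Union>E)"
    and img_vertex: "e \<in> E \<Longrightarrow> img e \<inter> pos ` \<Union>E = pos ` e"
    and img_edge: "\<lbrakk>e \<in> E; f \<in> E; e \<noteq> f\<rbrakk> \<Longrightarrow> img e \<inter> img f =
      pos ` (e \<inter> f)"
begin

definition drawn :: "'a set set \<Rightarrow> complex set" where
  "drawn F = \<Union>(img ` F)"

lemma drawn_Un: "drawn (F \<union> H) = drawn F \<union> drawn H"
  by (auto simp: drawn_def)

lemma pos_in_img: "e \<in> E \<Longrightarrow> v \<in> e \<Longrightarrow> pos v \<in> img e"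
  using img_vertex by auto

lemma finite_verts: "finite (\<Union>E)"
proof (rule finite_Union[OF finite_E])
  show "finite e" if "e \<in> E" for e using edge[OF that] by auto
qed

lemma drawn_Int:
  assumes "F \<subseteq> E" "H \<subseteq> E" "F \<inter> H = {}"
  shows "drawn F \<inter> drawn H = pos ` (\<Union>F \<inter> \<Union>H)"
proof
  show "drawn F \<inter> drawn H \<subseteq> pos ` (\<Union>F \<inter> \<Union>H)"
  proof
    fix z assume "z \<in> drawn F \<inter> drawn H"
    then obtain e f where ef: "e \<in> F" "f \<in> H" "z \<in> img e" "z \<in> img f" by (auto simp: drawn_def)
    then have "e \<noteq> f" using assms by auto
    then have "z \<in> pos ` (e \<inter> f)" using img_edge[of e f] ef assms by auto
    then show "z \<in> pos ` (\<Union>F \<inter> \<Union>H)" using ef by auto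
  qed
  show "pos ` (\<Union>F \<inter> \<Union>H) \<subseteq> drawn F \<inter> drawn H"
    unfolding drawn_def using assms(1,2) pos_in_img by blast
qed

lemma pos_in_drawn:
  assumes "F \<subseteq> E" "v \<in> \<Union>E"
  shows "pos v \<in> drawn F \<longleftrightarrow> v \<in> \<Union>F"
proof
  assume "pos v \<in> drawn F"
  then obtain e where e: "e \<in> F" "pos v \<in> img e" by (auto simp: drawn_def)
  then have "pos v \<in> pos ` e" using img_vertex[of e] assms by auto
  then obtain w where w: "w \<in> e" "pos v = pos w" by auto
  then have "v = w" using inj_pos assms e by (auto dest!: inj_onD)
  then show "v \<in> \<Union>F" using w e by auto
next
  assume "v \<in> \<Union>F" then show "pos v \<in> drawn F"
    unfolding drawn_def using assms(1) pos_in_img by blast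
qed

text \<open>The edge arcs are joined one by one; by distinctness of the vertices a new edge meets
  the rest of the path only in \<open>pos y\<close>.\<close>

lemma path_arc:
  "distinct p \<Longrightarrow> 2 \<le> length p \<Longrightarrow> path_edges p \<subseteq> E \<Longrightarrow>
   \<exists>g. arc g \<and> pathstart g = pos (hd p) \<and> pathfinish g = pos (last p) \<and> path_image g =
     drawn (path_edges p)"
proof (induction p rule: path_edges.induct)
  case (1 x y xs)
  have xy: "{x, y} \<in> E" "x \<noteq> y" using 1 by auto
  have "\<exists>g. arc g \<and> pathstart g = pos x \<and> pathfinish g = pos y \<and> path_image g = img {x, y}"
  proof -
    obtain u v g where g: "{x, y} = {u, v}" "arc g" "pathstart g = pos u" "pathfinish g = pos v"
      "path_image g = img {x, y}" using edge[OF xy(1)] by blast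
    show ?thesis
    proof (cases "x = u")
      case True
      then show ?thesis using g xy by (auto simp: doubleton_eq_iff)
    next
      case False
      then have "x = v" "y = u" using g xy by (auto simp: doubleton_eq_iff)
      then show ?thesis using g by (intro exI[of _ "reversepath g"]) (auto simp: arc_reversepath)
    qed
  qed
  then obtain g where g: "arc g" "pathstart g = pos x" "pathfinish g = pos y" "path_image g = img {x, y}"
    by blast
  show ?case
  proof (cases xs)
    case Nil
    then show ?thesis using g by (auto simp: drawn_def)
  next
    case (Cons z zs)
    then obtain h where h: "arc h" "pathstart h = pos y" "pathfinish h = pos (last (y # xs))"
        "path_image h = drawn (path_edges (y # xs))" using 1 by auto
    have nin: "{x, y} \<notin> path_edges (y # xs)" using path_edges_Union[of "y # xs"] 1(2) by auto
    have "drawn {{x, y}} \<inter> drawn (path_edges (y # xs)) = pos ` (\<Union>{{x, y}} \<inter>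
      \<Union>(path_edges (y # xs)))"
      using 1 nin by (intro drawn_Int) auto
    also have "\<dots> \<subseteq> {pos y}" using path_edges_Union[of "y # xs"] 1(2) by auto
    finally have "path_image g \<inter> path_image h \<subseteq> {pathfinish g}" using g h by (auto simp: drawn_def)
    then have "arc (g +++ h)" using g h by (intro arc_join) auto
    then show ?thesis using g h Cons
      by (intro exI[of _ "g +++ h"]) (auto simp: path_image_join drawn_def)
  qed
qed auto

lemma gpath_arc:
  assumes "gpath E a p b"
  obtains g where "arc g" "pathstart g = pos a" "pathfinish g = pos b" "path_image g = drawn (path_edges p)"
proof -
  have "\<exists>g. arc g \<and> pathstart g = pos a \<and> pathfinish g = pos b \<and> path_image g = drawn
    (path_edges p)"
    using path_arc[of p] assms by (simp add: gpath_def)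
  then show thesis using that by blast
qed

lemma gpath_drawn_Int:
  assumes "gpath E a p b" "gpath E a' q b'" "path_edges p \<inter> path_edges q = {}"
  shows "drawn (path_edges p) \<inter> drawn (path_edges q) = pos ` (set p \<inter> set q)"
  using drawn_Int[of "path_edges p" "path_edges q"] assms by (simp add: gpath_def path_edges_Union_eq)

lemma gcycle_curve:
  assumes C: "gcycle E cs"
  obtains g where "simple_path g" "pathfinish g = pathstart g" "path_image g = drawn (cycle_edges cs)"
proof -
  obtain a b zs where cs: "cs = a # b # zs" using C by (cases cs; cases "tl cs") (auto simp: gcycle_def)
  then have "a \<noteq> b" using C by (auto simp: gcycle_def)
  then obtain p q where pq: "gpath E a p b" "gpath E a q b"
    "path_edges p \<union> path_edges q = cycle_edges cs" "path_edges p \<inter> path_edges q = {}"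
     "set p \<inter> set q = {a, b}"
    using gcycle_split[OF C, of a b] cs by (metis list.set_intros)
  obtain g where g: "arc g" "pathstart g = pos a" "pathfinish g = pos b" "path_image g = drawn (path_edges p)"
    using gpath_arc[OF pq(1)] .
  obtain h where h: "arc h" "pathstart h = pos a" "pathfinish h = pos b" "path_image h = drawn (path_edges q)"
    using gpath_arc[OF pq(2)] .
  have "path_image g \<inter> path_image h = pos ` {a, b}"
    unfolding g(4) h(4) gpath_drawn_Int[OF pq(1,2,4)] pq(5) ..
  then have "simple_path (g +++ reversepath h)"
    using g(1-3) h(1-3) by (intro simple_path_join_loop) (simp_all add: arc_reversepath)
  moreover have "path_image (g +++ reversepath h) = drawn (cycle_edges cs)"
    using g(2-4) h(2-4) by (simp add: path_image_join pq(3)[symmetric] drawn_Un)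
  moreover have "pathfinish (g +++ reversepath h) = pathstart (g +++ reversepath h)"
    using g(2) h(2) by simp
  ultimately show thesis using that by blast
qed

lemma gcycle_Jordan:
  assumes "gcycle E cs"
  shows "open (inside (drawn (cycle_edges cs)))" "open (outside (drawn (cycle_edges cs)))"
    "connected (inside (drawn (cycle_edges cs)))" "connected (outside (drawn (cycle_edges cs)))"
      "inside (drawn (cycle_edges cs)) \<noteq> {}"
    "inside (drawn (cycle_edges cs)) \<inter> outside (drawn (cycle_edges cs)) = {}"
    "inside (drawn (cycle_edges cs)) \<union> outside (drawn (cycle_edges cs)) = - drawn (cycle_edges cs)"
    "compact (drawn (cycle_edges cs))" "bounded (inside (drawn (cycle_edges cs)))"
proof -
  obtain g where g: "simple_path g" "pathfinish g = pathstart g" "path_image g = drawn (cycle_edges cs)"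
    using gcycle_curve[OF assms] .
  have "compact (path_image g)" using g(1) by (simp add: compact_simple_path_image)
  then show "open (inside (drawn (cycle_edges cs)))" "open (outside (drawn (cycle_edges cs)))"
    "connected (inside (drawn (cycle_edges cs)))" "connected (outside (drawn (cycle_edges cs)))"
      "inside (drawn (cycle_edges cs)) \<noteq> {}"
    "inside (drawn (cycle_edges cs)) \<inter> outside (drawn (cycle_edges cs)) = {}"
    "inside (drawn (cycle_edges cs)) \<union> outside (drawn (cycle_edges cs)) = - drawn (cycle_edges cs)"
    "compact (drawn (cycle_edges cs))" "bounded (inside (drawn (cycle_edges cs)))"
    using Jordan_inside_outside[OF g(1,2)] unfolding g(3) by blast+
qed

text \<open>\<open>W\<close> will contain the ends of \<open>e\<close> that lie on a cycle. What
  remains corresponds to an interval without some of its ends, so it is connected and cannot cross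
  the cycle. A free end stays in this set and therefore lies on the same side as the edge.\<close>

lemma connected_img_minus:
  assumes e: "e \<in> E" and W: "W \<subseteq> e"
  shows "connected (img e - pos ` W)" "img e - pos ` e \<noteq> {}"
proof -
  obtain u v g where g: "e = {u, v}" "u \<noteq> v" "arc g" "pathstart g = pos u" "pathfinish g = pos v"
    "path_image g = img e" using edge[OF e] by blast
  define A where "A = {0..1::real} - ((if u \<in> W then {0} else {}) \<union> (if v \<in> W then {1} else {}))"
  have A: "A = {0..1} \<or> A = {0<..1} \<or> A = {0..<1} \<or> A = {0<..<1}"
    unfolding A_def by auto
  have inj: "inj_on g {0..1}" using g(3) by (simp add: arc_def)
  have g01: "g 0 = pos u" "g 1 = pos v" using g by (auto simp: pathstart_def pathfinish_def)
  have "img e - pos ` W = g ` A"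
  proof -
    have "img e = g ` {0..1}" using g(6) by (simp add: path_image_def)
    moreover have "pos ` W = g ` ((if u \<in> W then {0} else {}) \<union> (if v \<in> W then {1} else {}))"
      using W g(1) g01 by auto
    ultimately have "img e - pos ` W = g ` ({0..1} - ((if u \<in> W then {0} else {}) \<union> (if v \<in> W
      then {1} else {})))"
      by (subst inj_on_image_set_diff[OF inj]) auto
    then show ?thesis unfolding A_def .
  qed
  moreover have "continuous_on A g"
    by (rule continuous_on_subset[of "{0..1}"]) (use g(3) A_def in \<open>auto simp: arc_def path_def\<close>)
  moreover have "connected A" using A by auto
  ultimately show "connected (img e - pos ` W)" by (simp add: connected_continuous_image)
  have "g (1/2) \<in> img e" using g(6) by (auto simp: path_image_def)
  moreover have "g (1/2) \<noteq> g 0" "g (1/2) \<noteq> g 1" 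
    using inj_onD[OF inj, of "1/2" 0] inj_onD[OF inj, of "1/2" 1] by auto
  ultimately show "img e - pos ` e \<noteq> {}" using g(1) g01 by auto
qed

end

text \<open>Consecutive edges of the chain share a vertex of \<open>W\<close>, so a path can be
  followed along the chain. The induction covers every end \<open>w\<close> of the current edge
  other than \<open>a\<close>, because the next edge may leave from either end.\<close>

lemma gpath_chain:
  assumes "(e1, e) \<in> {(e, f). e \<in> F \<and> f \<in> F \<and> e \<inter> f \<inter> W \<noteq>
    {}}\<^sup>*" "e1 \<in> F" "a \<in> e1" "a \<notin> W"
    and F: "\<And>e. e \<in> F \<Longrightarrow> \<exists>u v. e = {u, v} \<and> u \<noteq> v"
    and "w \<in> e" "w \<noteq> a"
  shows "\<exists>p. gpath F a p w \<and> set p - {a, w} \<subseteq> W"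
  using assms(1,6,7)
proof (induction arbitrary: w rule: rtrancl_induct)
  case base
  obtain u v where "e1 = {u, v}" "u \<noteq> v" using F[OF assms(2)] by blast
  then have "e1 = {a, w}" using base assms(3) by blast
  then have "gpath F a [a, w] w" using base assms(2) by (simp add: gpath_def)
  then show ?case by (intro exI[of _ "[a, w]"]) auto
next
  case (step e f)
  then obtain x where x: "x \<in> e" "x \<in> f" "x \<in> W" and f: "f \<in> F" by auto
  have "x \<noteq> a" using x assms(4) by auto
  then obtain p where p: "gpath F a p x" "set p - {a, x} \<subseteq> W" using step.IH x by blast
  show ?case
  \<comment> \<open>If \<open>w\<close> already lies on the path, the path is cut there; otherwise
    the new edge is appended.\<close>
  proof (cases "w \<in> set p")
    case True
    then obtain us vs where pw: "p = us @ w # vs" by (meson split_list)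
    have "us \<noteq> []" using pw p(1) step.prems by (auto simp: gpath_def)
    then have "hd (us @ [w]) = a" "2 \<le> length (us @ [w])" using p(1) pw by (auto simp: gpath_def Suc_le_eq)
    moreover have "distinct (us @ [w])" using p(1) pw by (auto simp: gpath_def)
    moreover have "path_edges (us @ [w]) \<subseteq> F" using p(1) path_edges_decomp[of us w vs] unfolding pw
      gpath_def by blast
    ultimately have "gpath F a (us @ [w]) w" by (simp add: gpath_def)
    moreover have "set (us @ [w]) - {a, w} \<subseteq> W" using p(2) x(3) pw by auto
    ultimately show ?thesis by blast
  next
    case False
    obtain u v where "f = {u, v}" "u \<noteq> v" using F[OF f] by blast
    moreover have "w \<noteq> x" using False p(1) by (auto simp: gpath_def intro: last_in_set)
    ultimately have fe: "f = {x, w}" using x(2) step.prems by blast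
    have "p \<noteq> []" using p(1) by (auto simp: gpath_def)
    then have "gpath F a (p @ [w]) w" using p(1) False f fe
      by (auto simp: gpath_def path_edges_append)
    moreover have "set (p @ [w]) - {a, w} \<subseteq> W" using p(2) x(3) by auto
    ultimately show ?thesis by blast
  qed
qed

text \<open>The image of the outside together with 0 is connected, the image of the punctured inside
  is connected and unbounded, and together they cover the complement of the image curve. The inside
  of the image curve thus misses the second set; being nonempty by \<open>ne\<close>, it contains
  the whole first set.\<close>

lemma inside_inversion:
  fixes J :: "complex set"
  assumes J: "compact J" "connected (inside J)" "open (inside J)" "connected (outside J)" "bounded (inside J)"
    and un: "inside J \<union> outside J = - J"
    and z0: "z0 \<in> inside J" and ne: "inside ((\<lambda>z. inverse (z - z0)) ` J) \<noteq> {}"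
  shows "inside ((\<lambda>z. inverse (z - z0)) ` J) = insert 0 ((\<lambda>z. inverse (z - z0)) ` outside J)"
proof -
  define h where "h = (\<lambda>z::complex. inverse (z - z0))"
  have inj: "x = y" if "h x = h y" for x y
    using that by (simp add: h_def)
  have h0: "h z = 0 \<longleftrightarrow> z = z0" for z by (simp add: h_def)
  have cont: "continuous_on S h" if "z0 \<notin> S" for S
    unfolding h_def using that by (intro continuous_intros) auto
  have disj: "inside J \<inter> outside J = {}" by (rule inside_Int_outside)
  \<comment> \<open>Since \<open>inverse 0 = 0\<close>, the map \<open>h\<close> is injective on the
    whole plane with \<open>h z0 = 0\<close>. As a limit, however, 0 is the image of infinity and
    belongs to the outside.\<close>
  define O' where "O' = insert 0 (h ` outside J)"
  define I' where "I' = h ` (inside J - {z0})"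
  have z0J: "z0 \<notin> J" "z0 \<notin> outside J" using z0 un disj by blast+
  obtain B where B: "\<And>z. z \<in> inside J \<union> J \<Longrightarrow> norm z \<le> B"
    using J(1,5) by (meson bounded_Un bounded_iff compact_imp_bounded)
  have outs: "z \<in> outside J" if "norm z > B" for z
  proof -
    have "z \<notin> inside J \<union> J" using B[of z] that by linarith
    then show ?thesis using un by blast
  qed
  have cover: "- h ` J \<subseteq> O' \<union> I'"
  proof
    fix w assume w: "w \<in> - h ` J"
    show "w \<in> O' \<union> I'"
    proof (cases "w = 0")
      case False
      define z where "z = z0 + inverse w"
      have "h z = w" "z \<noteq> z0" using False by (simp_all add: h_def z_def)
      then show ?thesis using w un unfolding O'_def I'_def by blast
    qed (simp add: O'_def)
  qed
  have hJ: "h z \<notin> h ` J" if "z \<notin> J" for z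
  proof
    assume "h z \<in> h ` J"
    then obtain y where y: "y \<in> J" "h z = h y" by blast
    from inj[OF y(2)] y(1) that show False by simp
  qed
  have "0 \<notin> h ` J" using h0 z0J(1) by auto
  moreover have "outside J \<subseteq> - J" "inside J \<subseteq> - J" using un by blast+
  ultimately have O'J: "O' \<subseteq> - h ` J" and I'J: "I' \<subseteq> - h ` J"
    using hJ unfolding O'_def I'_def image_subset_iff insert_subset by blast+
  have conO: "connected O'"
  proof (rule connected_intermediate_closure)
    show "connected (h ` outside J)"
      by (rule connected_continuous_image[OF cont[OF z0J(2)] J(4)])
    show "h ` outside J \<subseteq> O'" by (auto simp: O'_def)
    have "0 \<in> closure (h ` outside J)"
      unfolding closure_approachable
    proof (intro allI impI)
      fix e :: real assume e: "e > 0"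
      \<comment> \<open>So large that \<open>z0 + t\<close> lies beyond the bound \<open>B\<close>,
        hence outside, and that its image \<open>1 / t\<close> is within \<open>e\<close> of
        0.\<close>
      define t where "t = max (2 / e) (\<bar>B\<bar> + norm z0 + 1)"
      have t: "t > 0" "t \<ge> 2 / e" "t \<ge> \<bar>B\<bar> + norm z0 + 1" using e by (auto simp: t_def
        less_max_iff_disj)
      have "norm (z0 + of_real t) \<ge> norm (of_real t :: complex) - norm z0"
        by (metis add.commute norm_diff_ineq)
      then have "norm (z0 + of_real t) > B" using t by simp
      then have "h (z0 + of_real t) \<in> h ` outside J" using outs by auto
      moreover have "dist (h (z0 + of_real t)) 0 < e"
      proof -
        have "dist (h (z0 + of_real t)) 0 = 1 / t" using t by (simp add: h_def norm_inverse inverse_eq_divide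
          norm_divide)
        also have "\<dots> \<le> e / 2" using t e by (simp add: field_simps)
        finally show ?thesis using e by simp
      qed
      ultimately show "\<exists>y\<in>h ` outside J. dist y 0 < e" by blast
    qed
    then show "O' \<subseteq> closure (h ` outside J)"
      unfolding O'_def using closure_subset[of "h ` outside J"] by blast
  qed
  obtain r where r: "r > 0" "cball z0 r \<subseteq> inside J"
    using z0 J(3) open_contains_cball by blast
  have conI: "connected I'"
    unfolding I'_def
    by (rule connected_continuous_image[OF cont connected_open_delete[OF J(3,2)]]) simp_all
  have unbI: "\<not> bounded I'"
  proof
    assume "bounded I'"
    then obtain M where M: "\<And>w. w \<in> I' \<Longrightarrow> norm w \<le> M" by (auto simp: bounded_iff)
    define s where "s = min r (1 / (\<bar>M\<bar> + 1))"
    have s: "s > 0" "s \<le> r" "s \<le> 1 / (\<bar>M\<bar> + 1)" using r by (auto simp: s_def)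
    have "z0 + of_real s \<in> cball z0 r" using s by (simp add: dist_norm)
    then have "h (z0 + of_real s) \<in> I'" using r s unfolding I'_def by auto
    then have "1 / s \<le> M" using M[of "h (z0 + of_real s)"] s by (simp add: h_def norm_inverse
      inverse_eq_divide norm_divide)
    moreover have "\<bar>M\<bar> + 1 \<le> 1 / s" using s by (simp add: field_simps)
    ultimately show False by linarith
  qed
  have "inside (h ` J) \<subseteq> O'"
  proof
    fix x assume x: "x \<in> inside (h ` J)"
    then have nx: "x \<notin> h ` J" and bx: "bounded (connected_component_set (- h ` J) x)"
      by (auto simp: inside_def)
    show "x \<in> O'"
    proof (rule ccontr)
      assume "x \<notin> O'"
      then have "x \<in> I'" using cover nx by auto
      then have "I' \<subseteq> connected_component_set (- h ` J) x"
        using conI I'J by (intro connected_component_maximal)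
      then show False using bx unbI bounded_subset by blast
    qed
  qed
  moreover have "O' \<subseteq> inside (h ` J)"
  proof -
    obtain x where x: "x \<in> inside (h ` J)" using ne unfolding h_def by blast
    then have "x \<in> O'" using \<open>inside (h ` J) \<subseteq> O'\<close> by blast
    then have O: "O' \<subseteq> connected_component_set (- h ` J) x"
      using conO O'J by (intro connected_component_maximal)
    show ?thesis
    proof
      fix y assume "y \<in> O'"
      then have "connected_component (- h ` J) x y" using O by auto
      then show "y \<in> inside (h ` J)" using x inside_same_component by blast
    qed
  qed
  ultimately show ?thesis unfolding O'_def h_def by blast
qed

section \<open>The two sides of a cycle\<close>

context plane_graph
begin

text \<open>\<open>S\<close> stands for \<open>inside\<close> or \<open>outside\<close>, so that
  both sides share their proofs. The ends of an edge are left out because they may lie on the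
  curve.\<close>

definition edges_of ::
  "(complex set \<Rightarrow> complex set) \<Rightarrow> 'a set set \<Rightarrow> 'a set set" where
  "edges_of S F = {e \<in> E - F. img e - pos ` e \<subseteq> S (drawn F)}"

definition verts_of :: "(complex set \<Rightarrow> complex set) \<Rightarrow> 'a set set \<Rightarrow> 'a set" where
  "verts_of S F = {v \<in> \<Union>E. pos v \<in> S (drawn F)}"

lemma finite_edges_of [simp]: "finite (edges_of S F)"
  using finite_E by (simp add: edges_of_def)

lemma finite_verts_of [simp]: "finite (verts_of S F)"
  by (rule finite_subset[OF _ finite_verts]) (auto simp: verts_of_def)

lemma img_drawn_disjoint:
  assumes "e \<in> E" "F \<subseteq> E" "e \<notin> F" "e \<inter> \<Union>F \<subseteq> W"
  shows "(img e - pos ` W) \<inter> drawn F = {}"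
proof -
  have "drawn {e} \<inter> drawn F = pos ` (\<Union>{e} \<inter> \<Union>F)" by (rule drawn_Int) (use assms in auto)
  then show ?thesis using assms(4) unfolding drawn_def by auto
qed

lemma edge_side:
  assumes C: "gcycle E cs" and e: "e \<in> E - cycle_edges cs" and W:
    "e \<inter> \<Union>(cycle_edges cs) \<subseteq> W" "W \<subseteq> e"
  shows "img e - pos ` W \<subseteq> inside (drawn (cycle_edges cs)) \<or> img e - pos ` W \<subseteq> outside
    (drawn (cycle_edges cs))"
proof -
  let ?A = "inside (drawn (cycle_edges cs))" and ?B = "outside (drawn (cycle_edges cs))" and ?X = "img e - pos ` W"
  have CE: "cycle_edges cs \<subseteq> E" using C by (simp add: gcycle_def)
  have "?X \<inter> drawn (cycle_edges cs) = {}" using img_drawn_disjoint[of e "cycle_edges cs" W] e W CE by blast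
  then have "?X \<subseteq> ?A \<union> ?B" using gcycle_Jordan(7)[OF C] by blast
  moreover have "connected ?X" using connected_img_minus e W by auto
  moreover have "?A \<inter> ?B \<inter> ?X = {}" using gcycle_Jordan(6)[OF C] by blast
  ultimately have "?A \<inter> ?X = {} \<or> ?B \<inter> ?X = {}"
    using gcycle_Jordan(1,2)[OF C] connectedD[of ?X ?A ?B] by blast
  then show ?thesis using \<open>?X \<subseteq> ?A \<union> ?B\<close> by blast
qed

lemma pos_notin: "e \<in> E \<Longrightarrow> v \<in> e \<Longrightarrow> v \<notin> W \<Longrightarrow> W
  \<subseteq> e \<Longrightarrow> pos v \<in> img e - pos ` W"
proof -
  assume v: "e \<in> E" "v \<in> e" "v \<notin> W" "W \<subseteq> e"
  have "pos v \<notin> pos ` W"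
  proof
    assume "pos v \<in> pos ` W"
    then obtain w where w: "w \<in> W" "pos v = pos w" by blast
    then have "v = w" using v by (intro inj_onD[OF inj_pos]) auto
    then show False using w v by simp
  qed
  then show ?thesis using pos_in_img[OF v(1,2)] by blast
qed

text \<open>Without its ends on the cycle the edge is connected and still contains
  \<open>pos v\<close>, so it lies on the side of \<open>v\<close>.\<close>

lemma edge_at_side:
  assumes C: "gcycle E cs" and S: "S = inside \<or> S = outside"
    and v: "v \<in> verts_of S (cycle_edges cs)" "v \<in> e" "e \<in> E"
  shows "e \<in> edges_of S (cycle_edges cs)"
proof -
  let ?F = "cycle_edges cs"
  have CE: "cycle_edges cs \<subseteq> E" using C by (simp add: gcycle_def)
  have vS: "pos v \<in> S (drawn ?F)" "v \<in> \<Union>E" using v by (auto simp: verts_of_def)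
  then have "pos v \<notin> drawn ?F" using gcycle_Jordan(7)[OF C] S by blast
  then have vF: "v \<notin> \<Union>?F" using pos_in_drawn[OF CE vS(2)] by blast
  then have e: "e \<in> E - ?F" using v by blast
  define W where "W = e \<inter> \<Union>?F"
  have "pos v \<in> img e - pos ` W" using vF v pos_notin[of e v W] by (auto simp: W_def)
  moreover have "img e - pos ` W \<subseteq> inside (drawn ?F) \<or> img e - pos ` W \<subseteq> outside (drawn ?F)"
    using edge_side[OF C e, of W] by (auto simp: W_def)
  ultimately have "img e - pos ` W \<subseteq> S (drawn ?F)" using S vS gcycle_Jordan(6)[OF C] by blast
  then show ?thesis using e by (auto simp: edges_of_def W_def)
qed

lemma vertex_of_side:
  assumes C: "gcycle E cs" and S: "S = inside \<or> S = outside"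
    and e: "e \<in> edges_of S (cycle_edges cs)" "v \<in> e"
  shows "v \<in> verts_of S (cycle_edges cs) \<or> v \<in> \<Union>(cycle_edges cs)"
proof (rule disjCI)
  let ?F = "cycle_edges cs"
  assume vF: "v \<notin> \<Union>?F"
  have eE: "e \<in> E - ?F" "img e - pos ` e \<subseteq> S (drawn ?F)" using e by (auto simp: edges_of_def)
  define W where "W = e \<inter> \<Union>?F"
  have "pos v \<in> img e - pos ` W" using vF e eE pos_notin[of e v W] by (auto simp: W_def)
  moreover have "img e - pos ` W \<subseteq> inside (drawn ?F) \<or> img e - pos ` W \<subseteq> outside (drawn ?F)"
    using edge_side[OF C eE(1), of W] by (auto simp: W_def)
  moreover have "img e - pos ` e \<subseteq> img e - pos ` W" by (auto simp: W_def)
  moreover have "img e - pos ` e \<noteq> {}" using connected_img_minus(2)[of e] eE by blast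
  ultimately have "pos v \<in> S (drawn ?F)" using S eE(2) gcycle_Jordan(6)[OF C] by blast
  then show "v \<in> verts_of S ?F" using e eE by (auto simp: verts_of_def)
qed

lemma edges_cover:
  assumes C: "gcycle E cs"
  shows "E = cycle_edges cs \<union> edges_of inside (cycle_edges cs) \<union> edges_of outside (cycle_edges cs)"
    "edges_of inside (cycle_edges cs) \<inter> edges_of outside (cycle_edges cs) = {}"
    "\<Union>E = set cs \<union> verts_of inside (cycle_edges cs) \<union> verts_of outside (cycle_edges cs)"
    "verts_of inside (cycle_edges cs) \<inter> verts_of outside (cycle_edges cs) = {}"
    "set cs \<inter> verts_of inside (cycle_edges cs) = {}" "set cs \<inter> verts_of outside (cycle_edges cs) = {}"
proof -
  have CE: "cycle_edges cs \<subseteq> E" using C by (simp add: gcycle_def)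
  have side: "img e - pos ` e \<subseteq> inside (drawn (cycle_edges cs)) \<or> img e - pos ` e \<subseteq>
    outside (drawn (cycle_edges cs))"
    if "e \<in> E - cycle_edges cs" for e using edge_side[OF C that, of e] by blast
  then show "E = cycle_edges cs \<union> edges_of inside (cycle_edges cs) \<union> edges_of outside (cycle_edges cs)"
    using CE unfolding edges_of_def by blast
  show "edges_of inside (cycle_edges cs) \<inter> edges_of outside (cycle_edges cs) = {}"
    using connected_img_minus(2) gcycle_Jordan(6)[OF C] unfolding edges_of_def by blast
  have U: "\<Union>(cycle_edges cs) = set cs" using gcycle_Union[OF C] .
  have p: "pos v \<in> drawn (cycle_edges cs) \<longleftrightarrow> v \<in> set cs" if "v \<in> \<Union>E" for v
    using pos_in_drawn[OF CE that] U by simp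
  have sub: "set cs \<subseteq> \<Union>E" using U CE by blast
  show "\<Union>E = set cs \<union> verts_of inside (cycle_edges cs) \<union> verts_of outside (cycle_edges cs)"
    using p sub gcycle_Jordan(7)[OF C] unfolding verts_of_def by blast
  show "verts_of inside (cycle_edges cs) \<inter> verts_of outside (cycle_edges cs) = {}"
    using gcycle_Jordan(6)[OF C] unfolding verts_of_def by blast
  show "set cs \<inter> verts_of inside (cycle_edges cs) = {}"
    "set cs \<inter> verts_of outside (cycle_edges cs) = {}"
    using p gcycle_Jordan(7)[OF C] unfolding verts_of_def by blast+
qed

text \<open>No part of \<open>F\<close> hangs on the rest of the whole graph by fewer than two
  vertices. Since \<open>K\<close> runs over all subsets of \<open>F\<close>, the property passes to
  subsets of \<open>F\<close>, in particular to the edges inside the two smaller cycles of the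
  induction.\<close>

definition attached :: "'a set set \<Rightarrow> bool" where
  "attached F \<longleftrightarrow> (\<forall>K. K \<noteq> {} \<longrightarrow> K \<subseteq> F
    \<longrightarrow> 2 \<le> card (\<Union>K \<inter> \<Union>(E - K)))"

lemma edge_doubleton: "e \<in> E \<Longrightarrow> \<exists>u v. e = {u, v} \<and> u \<noteq> v"
  by (drule edge) blast

text \<open>Consider the class of inner edges that are linked to one of them through inner vertices.
  A vertex that this class shares with other edges cannot be an inner one, so it lies on the cycle;
  \<open>attached\<close> provides two such vertices, and a chain within the class joins
  them.\<close>

lemma ear:
  assumes C: "gcycle E cs" and ne: "edges_of inside (cycle_edges cs) \<noteq> {}"
    and at: "attached (edges_of inside (cycle_edges cs))"
  obtains a b p where "a \<noteq> b" "a \<in> set cs" "b \<in> set cs"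
    "gpath (edges_of inside (cycle_edges cs)) a p b"
    "set p \<inter> set cs = {a, b}" "set p - {a, b} \<subseteq> verts_of inside (cycle_edges cs)"
proof -
  let ?F = "edges_of inside (cycle_edges cs)" and ?W = "verts_of inside (cycle_edges cs)"
  let ?R = "{(e, f). e \<in> ?F \<and> f \<in> ?F \<and> e \<inter> f \<inter> ?W \<noteq> {}}"
  obtain e0 where e0: "e0 \<in> ?F" using ne by blast
  define K where "K = {e \<in> ?F. (e0, e) \<in> ?R\<^sup>*}"
  have "K \<noteq> {}" "K \<subseteq> ?F" using e0 by (auto simp: K_def)
  then have "2 \<le> card (\<Union>K \<inter> \<Union>(E - K))" using at unfolding attached_def by blast
  then obtain a b where ab: "a \<noteq> b" "a \<in> \<Union>K \<inter> \<Union>(E - K)"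
    "b \<in> \<Union>K \<inter> \<Union>(E - K)"
    using two_elements by metis
  have FE: "?F \<subseteq> E" by (auto simp: edges_of_def)
  have onC: "x \<in> set cs" if x: "x \<in> \<Union>K \<inter> \<Union>(E - K)" for x
  proof -
    obtain e f where ef: "x \<in> e" "e \<in> K" "x \<in> f" "f \<in> E - K" using x by blast
    have "x \<notin> ?W"
    proof
      assume xW: "x \<in> ?W"
      have "f \<in> ?F" using edge_at_side[OF C _ xW ef(3)] ef(4) by blast
      then have "(e, f) \<in> ?R" using ef xW by (auto simp: K_def)
      then have "f \<in> K" using ef(2) \<open>f \<in> ?F\<close> unfolding K_def by (auto intro:
        rtrancl_into_rtrancl)
      then show False using ef by blast
    qed
    then show ?thesis using vertex_of_side[OF C _ _ ef(1)] ef(2) gcycle_Union[OF C] by (auto simp: K_def)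
  qed
  obtain e1 e2 where e12: "a \<in> e1" "e1 \<in> K" "b \<in> e2" "e2 \<in> K" using ab by blast
  have "sym ?R" by (auto simp: sym_def)
  then have "sym (?R\<^sup>*)" by (rule sym_rtrancl)
  then have "(e1, e2) \<in> ?R\<^sup>*" using e12 unfolding K_def by (auto dest: symD intro: rtrancl_trans)
  moreover have W: "a \<notin> ?W" "b \<notin> ?W" using onC[OF ab(2)] onC[OF ab(3)] edges_cover(5)[OF C] by blast+
  moreover have "e1 \<in> ?F" using e12 by (simp add: K_def)
  moreover have "\<exists>u v. e = {u, v} \<and> u \<noteq> v" if "e \<in> ?F" for e using edge_doubleton that
    FE by blast
  ultimately have "\<exists>p. gpath ?F a p b \<and> set p - {a, b} \<subseteq> ?W"
    using gpath_chain[of e1 e2 ?F ?W a b] e12(1,3) ab(1) by blast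
  then obtain p where p: "gpath ?F a p b" "set p - {a, b} \<subseteq> ?W" by blast
  have "{a, b} \<subseteq> set p" using p(1) unfolding gpath_def
    by (metis hd_in_set last_in_set insert_subset empty_subsetI list.size(3) not_numeral_le_zero)
  then have "set p \<inter> set cs = {a, b}"
    using p(2) onC[OF ab(2)] onC[OF ab(3)] edges_cover(5)[OF C] by blast
  then show thesis using that[OF ab(1) onC[OF ab(2)] onC[OF ab(3)] p(1) _ p(2)] by blast
qed


lemma theta:
  assumes q1: "gpath E a q1 b" and q2: "gpath E a q2 b" and p: "gpath E a p b" and ab: "a \<noteq> b"
    and d: "path_edges q1 \<inter> path_edges q2 = {}" "path_edges q1 \<inter> path_edges p = {}"
      "path_edges q2 \<inter> path_edges p = {}"
    and s: "set q1 \<inter> set q2 = {a, b}" "set q1 \<inter> set p = {a, b}" "set q2 \<inter> set p = {a, b}"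
    and ne: "drawn (path_edges p) \<inter> inside (drawn (path_edges q1 \<union> path_edges q2)) \<noteq> {}"
  shows "inside (drawn (path_edges q1 \<union> path_edges p)) \<inter> inside (drawn (path_edges q2 \<union>
    path_edges p)) = {}"
    "inside (drawn (path_edges q1 \<union> path_edges p)) \<union> inside (drawn (path_edges q2 \<union>
      path_edges p)) \<union> (drawn (path_edges p) - {pos a, pos b})
      = inside (drawn (path_edges q1 \<union> path_edges q2))"
proof -
  obtain g1 where g1: "arc g1" "pathstart g1 = pos a" "pathfinish g1 = pos b" "path_image g1 = drawn (path_edges q1)"
    using gpath_arc[OF q1] .
  obtain g2 where g2: "arc g2" "pathstart g2 = pos a" "pathfinish g2 = pos b" "path_image g2 = drawn (path_edges q2)"
    using gpath_arc[OF q2] .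
  obtain g where g: "arc g" "pathstart g = pos a" "pathfinish g = pos b" "path_image g = drawn (path_edges p)"
    using gpath_arc[OF p] .
  have "pos a \<noteq> pos b" using g(1-3) arc_distinct_ends by metis
  have i: "path_image g1 \<inter> path_image g2 = {pos a, pos b}"
    "path_image g1 \<inter> path_image g = {pos a, pos b}"
    "path_image g2 \<inter> path_image g = {pos a, pos b}"
    using gpath_drawn_Int[OF q1 q2 d(1)] gpath_drawn_Int[OF q1 p d(2)] gpath_drawn_Int[OF q2 p d(3)]
    unfolding g1(4) g2(4) g(4) s by simp_all
  have ne': "path_image g \<inter> inside (path_image g1 \<union> path_image g2) \<noteq> {}"
    using ne unfolding g1(4) g2(4) g(4) drawn_Un .
  show "inside (drawn (path_edges q1 \<union> path_edges p)) \<inter> inside (drawn (path_edges q2 \<union>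
    path_edges p)) = {}"
    "inside (drawn (path_edges q1 \<union> path_edges p)) \<union> inside (drawn (path_edges q2 \<union>
      path_edges p)) \<union> (drawn (path_edges p) - {pos a, pos b})
      = inside (drawn (path_edges q1 \<union> path_edges q2))"
    using split_inside_simple_closed_curve[OF arc_imp_simple_path[OF g1(1)] g1(2,3)
        arc_imp_simple_path[OF g2(1)] g2(2,3) arc_imp_simple_path[OF g(1)] g(2,3) \<open>pos a \<noteq> pos
          b\<close> i ne']
    unfolding g1(4) g2(4) g(4) drawn_Un by metis+
qed

section \<open>Edge estimates inside and outside a cycle\<close>

lemma gpath_mono: "gpath F a p b \<Longrightarrow> F \<subseteq> H \<Longrightarrow> gpath H a p b"
  unfolding gpath_def by blast

lemma gpath_ends: "gpath F a p b \<Longrightarrow> a \<in> set p \<and> b \<in> set p"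
  unfolding gpath_def by (metis hd_in_set last_in_set list.size(3) not_numeral_le_zero)

text \<open>A path with \<open>l\<close> edges contributes \<open>l\<close> edges and
  \<open>l - 1\<close> inner vertices, and the two new cycles have total length
  \<open>|C| + 2 l\<close>. With these values the sum of the two induction hypotheses is exactly the
  claim. The girth enters where a cycle has no edge inside, as \<open>10 <= |C|\<close>.\<close>

lemma disc_bound:
  assumes girth: "\<And>cs. gcycle E cs \<Longrightarrow> 10 \<le> length cs"
    and "gcycle E cs" and "attached (edges_of inside (cycle_edges cs))"
  shows "8 * card (edges_of inside (cycle_edges cs)) + 10 \<le> 10 * card (verts_of inside (cycle_edges cs)) +
    length cs"
  using assms(2,3)
proof (induction "card (edges_of inside (cycle_edges cs))" arbitrary: cs rule: less_induct)
  case less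
  note C = less.prems(1)
  let ?F = "edges_of inside" and ?V = "verts_of inside"
  show ?case
  proof (cases "?F (cycle_edges cs) = {}")
    case True
    then show ?thesis using girth[OF C] by simp
  next
    case False
    obtain a b p where ab: "a \<noteq> b" "a \<in> set cs" "b \<in> set cs" and p: "gpath (?F (cycle_edges cs)) a p b"
      and ps: "set p \<inter> set cs = {a, b}" and pV: "set p - {a, b} \<subseteq> ?V (cycle_edges cs)"
      using ear[OF C False less.prems(2)] .
    obtain q1 q2 where q: "gpath E a q1 b" "gpath E a q2 b"
      "path_edges q1 \<union> path_edges q2 = cycle_edges cs" "path_edges q1 \<inter> path_edges q2 = {}"
      "set q1 \<inter> set q2 = {a, b}" "set q1 \<union> set q2 = set cs" "length q1 + length q2 = length cs + 2"
      using gcycle_split[OF C ab(2,3,1)] .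
    have FE: "?F (cycle_edges cs) \<subseteq> E" "?F (cycle_edges cs) \<inter> cycle_edges cs = {}" by (auto
      simp: edges_of_def)
    have pF: "path_edges p \<subseteq> ?F (cycle_edges cs)" using p by (simp add: gpath_def)
    have pE: "gpath E a p b" using gpath_mono[OF p FE(1)] .
    have d: "path_edges q1 \<inter> path_edges p = {}" "path_edges q2 \<inter> path_edges p = {}" using pF FE(2)
      q(3) by blast+
    have s: "set q1 \<inter> set p = {a, b}" "set q2 \<inter> set p = {a, b}"
      using ps q(6) gpath_ends[OF q(1)] gpath_ends[OF q(2)] gpath_ends[OF p] by blast+
    obtain c1 where c1: "gcycle E c1" "cycle_edges c1 = path_edges q1 \<union> path_edges p"
      "set c1 = set q1 \<union> set p"
      "length c1 + 2 = length q1 + length p"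
      using gcycle_merge[OF q(1) pE ab(1) s(1) d(1)] .
    obtain c2 where c2: "gcycle E c2" "cycle_edges c2 = path_edges q2 \<union> path_edges p"
      "set c2 = set q2 \<union> set p"
      "length c2 + 2 = length q2 + length p"
      using gcycle_merge[OF q(2) pE ab(1) s(2) d(2)] .
    have edne: "path_edges p \<noteq> {}"
    proof
      assume "path_edges p = {}"
      moreover have "\<Union>(path_edges p) = set p" "a \<in> set p" using path_edges_Union_eq p gpath_ends[OF
        p] unfolding gpath_def by blast+
      ultimately show False by simp
    qed
    have "drawn (path_edges p) \<inter> inside (drawn (path_edges q1 \<union> path_edges q2)) \<noteq> {}"
    proof -
      obtain e where e: "e \<in> path_edges p" using edne by blast
      then have "img e - pos ` e \<noteq> {}" "img e - pos ` e \<subseteq> inside (drawn (cycle_edges cs))"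
        using connected_img_minus(2)[of e e] pF by (auto simp: edges_of_def)
      then show ?thesis using e unfolding q(3) drawn_def by blast
    qed
    note th = theta[OF q(1,2) pE ab(1) q(4) d q(5) s this]
    have I: "inside (drawn (cycle_edges c1)) \<inter> inside (drawn (cycle_edges c2)) = {}"
      "inside (drawn (cycle_edges c1)) \<union> inside (drawn (cycle_edges c2)) \<union> (drawn (path_edges p) -
        {pos a, pos b}) = inside (drawn (cycle_edges cs))"
      using th unfolding c1(2) c2(2) q(3) by auto
    have IMp: "drawn (path_edges p) \<subseteq> drawn (cycle_edges c1)"
      "drawn (path_edges p) \<subseteq> drawn (cycle_edges c2)" unfolding c1(2) c2(2) drawn_Un by auto
    have nIM: "inside (drawn (cycle_edges c)) \<inter> drawn (cycle_edges c) = {}" for c by (simp add: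
      inside_no_overlap)
    have ne: "img e - pos ` e \<noteq> {}" if "e \<in> E" for e using connected_img_minus(2)[OF that] by blast
    have sub1: "?F (cycle_edges c1) \<subseteq> ?F (cycle_edges cs) - path_edges p"
    proof
      fix e assume e: "e \<in> ?F (cycle_edges c1)"
      then have e': "e \<in> E" "e \<notin> path_edges p"
        "img e - pos ` e \<subseteq> inside (drawn (cycle_edges cs))"
        using I(2) c1(2) by (auto simp: edges_of_def)
      moreover have "e \<notin> cycle_edges cs"
      proof
        assume "e \<in> cycle_edges cs"
        then have "img e \<subseteq> drawn (cycle_edges cs)" by (auto simp: drawn_def)
        then show False using ne[OF e'(1)] e'(3) nIM[of cs] by blast
      qed
      ultimately show "e \<in> ?F (cycle_edges cs) - path_edges p" by (simp add: edges_of_def)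
    qed
    have sub2: "?F (cycle_edges c2) \<subseteq> ?F (cycle_edges cs) - path_edges p"
    proof
      fix e assume e: "e \<in> ?F (cycle_edges c2)"
      then have e': "e \<in> E" "e \<notin> path_edges p"
        "img e - pos ` e \<subseteq> inside (drawn (cycle_edges cs))"
        using I(2) c2(2) by (auto simp: edges_of_def)
      moreover have "e \<notin> cycle_edges cs"
      proof
        assume "e \<in> cycle_edges cs"
        then have "img e \<subseteq> drawn (cycle_edges cs)" by (auto simp: drawn_def)
        then show False using ne[OF e'(1)] e'(3) nIM[of cs] by blast
      qed
      ultimately show "e \<in> ?F (cycle_edges cs) - path_edges p" by (simp add: edges_of_def)
    qed
    have cov: "?F (cycle_edges cs) \<subseteq> ?F (cycle_edges c1) \<union> ?F (cycle_edges c2) \<union> path_edges p"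
    proof
      fix e assume e: "e \<in> ?F (cycle_edges cs)"
      show "e \<in> ?F (cycle_edges c1) \<union> ?F (cycle_edges c2) \<union> path_edges p"
      proof (cases "e \<in> path_edges p")
        case False
        have eE: "e \<in> E" "e \<notin> cycle_edges cs"
          "img e - pos ` e \<subseteq> inside (drawn (cycle_edges cs))" using e by (auto simp: edges_of_def)
        then have e12: "e \<in> E - cycle_edges c1" "e \<in> E - cycle_edges c2" using False q(3) c1(2) c2(2) by auto
        have "img e - pos ` e \<subseteq> inside (drawn (cycle_edges c1)) \<or> img e - pos ` e \<subseteq>
          outside (drawn (cycle_edges c1))"
          using edge_side[OF c1(1) e12(1), of e] by blast
        then show ?thesis
        proof
          assume "img e - pos ` e \<subseteq> inside (drawn (cycle_edges c1))"
          then show ?thesis using e12 by (auto simp: edges_of_def)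
        next
          assume out: "img e - pos ` e \<subseteq> outside (drawn (cycle_edges c1))"
          \<comment> \<open>One point decides: it is inside \<open>cs\<close>, but neither inside
            \<open>c1\<close> nor on \<open>p\<close>, so it is inside \<open>c2\<close>; the rest
            of the edge follows it.\<close>
          obtain z where z: "z \<in> img e - pos ` e" using ne[OF eE(1)] by blast
          have "z \<notin> inside (drawn (cycle_edges c1))" "z \<notin> drawn (cycle_edges c1)"
            using z out gcycle_Jordan(6,7)[OF c1(1)] by blast+
          then have "z \<in> inside (drawn (cycle_edges c2))" using z eE(3) I(2) IMp(1) by blast
          moreover have "img e - pos ` e \<subseteq> inside (drawn (cycle_edges c2)) \<or> img e - pos ` e
            \<subseteq> outside (drawn (cycle_edges c2))"
            using edge_side[OF c2(1) e12(2), of e] by blast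
          ultimately have "img e - pos ` e \<subseteq> inside (drawn (cycle_edges c2))"
            using z gcycle_Jordan(6)[OF c2(1)] by blast
          then show ?thesis using e12 by (auto simp: edges_of_def)
        qed
      qed simp
    qed
    have Feq: "?F (cycle_edges cs) = ?F (cycle_edges c1) \<union> ?F (cycle_edges c2) \<union> path_edges p"
      using sub1 sub2 cov pF by blast
    have Fd: "?F (cycle_edges c1) \<inter> ?F (cycle_edges c2) = {}"
      using I(1) ne unfolding edges_of_def by blast
    have Fcard: "card (?F (cycle_edges cs)) = card (?F (cycle_edges c1)) + card (?F (cycle_edges c2)) + (length
      p - 1)"
      unfolding Feq using sub1 sub2 Fd card_path_edges[of p] p
      by (subst card_Un_disjoint, simp, simp, blast, subst card_Un_disjoint) (simp_all add: gpath_def)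
    have p2: "2 \<le> length p" using p by (simp add: gpath_def)
    have pverts: "pos v \<in> drawn (path_edges p) \<longleftrightarrow> v \<in> set p" if "v \<in> \<Union>E" for v
      using pos_in_drawn[of "path_edges p" v] that pE path_edges_Union_eq[OF p2] by (simp add: gpath_def)
    have abE: "a \<in> \<Union>E" "b \<in> \<Union>E" using ab(2,3) edges_cover(3)[OF C] by blast+
    have posne: "pos v \<noteq> pos w" if "v \<in> \<Union>E" "w \<in> \<Union>E" "v \<noteq> w" for v w
      using inj_onD[OF inj_pos _ that(1,2)] that(3) by metis
    have Veq: "?V (cycle_edges cs) = ?V (cycle_edges c1) \<union> ?V (cycle_edges c2) \<union> (set p - {a, b})"
    proof (rule set_eqI)
      fix v
      show "v \<in> ?V (cycle_edges cs) \<longleftrightarrow> v \<in> ?V (cycle_edges c1) \<union> ?V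
        (cycle_edges c2) \<union> (set p - {a, b})"
      proof (cases "v \<in> \<Union>E")
        case True
        have "pos v \<in> {pos a, pos b} \<longleftrightarrow> v \<in> {a, b}" using posne[OF True abE(1)]
          posne[OF True abE(2)] by auto
        then have
          "pos v \<in> drawn (path_edges p) - {pos a, pos b} \<longleftrightarrow> v \<in> set p - {a, b}" using
          pverts[OF True] by simp
        then show ?thesis using True I(2) unfolding verts_of_def by blast
      next
        case False
        moreover have "set p \<subseteq> \<Union>E" using pE path_edges_Union_eq[OF p2] unfolding gpath_def by blast
        ultimately show ?thesis unfolding verts_of_def by blast
      qed
    qed
    have Vd: "?V (cycle_edges c1) \<inter> ?V (cycle_edges c2) = {}" using I(1) unfolding verts_of_def by blast
    have Vp: "(?V (cycle_edges c1) \<union> ?V (cycle_edges c2)) \<inter> (set p - {a, b}) = {}"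
      using edges_cover(5)[OF c1(1)] edges_cover(5)[OF c2(1)] c1(3) c2(3) by blast
    have "card (set p - {a, b}) = length p - 2"
      using p gpath_ends[OF p] ab(1) by (subst card_Diff_subset) (auto simp: gpath_def distinct_card)
    then have Vcard: "card (?V (cycle_edges cs)) = card (?V (cycle_edges c1)) + card (?V (cycle_edges c2)) +
      (length p - 2)"
      unfolding Veq using Vp Vd by (simp add: card_Un_disjoint)
    have at: "attached (?F (cycle_edges c1))" "attached (?F (cycle_edges c2))"
      using less.prems(2) Feq unfolding attached_def by blast+
    have "8 * card (?F (cycle_edges c1)) + 10 \<le> 10 * card (?V (cycle_edges c1)) + length c1"
      by (rule less.hyps[OF _ c1(1) at(1)]) (use Fcard p2 in linarith)
    moreover have "8 * card (?F (cycle_edges c2)) + 10 \<le> 10 * card (?V (cycle_edges c2)) + length c2"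
      by (rule less.hyps[OF _ c2(1) at(2)]) (use Fcard p2 in linarith)
    ultimately show ?thesis using Fcard Vcard c1(4) c2(4) q(7) p2 by linarith
  qed
qed

text \<open>The edges inside the cycle are dropped first, since they might pass through the centre
  \<open>z0\<close> of the inversion. On the rest of the drawing the inversion is continuous and
  injective, so the image is again a plane graph, and \<open>disc_bound\<close> applies to
  it.\<close>

lemma disc_bound_outside:
  assumes girth: "\<And>cs. gcycle E cs \<Longrightarrow> 10 \<le> length cs"
    and C: "gcycle E cs" and at: "attached (edges_of outside (cycle_edges cs))"
  shows "8 * card (edges_of outside (cycle_edges cs)) + 10 \<le> 10 * card (verts_of outside (cycle_edges cs)) +
    length cs"
proof -
  let ?C = "cycle_edges cs"
  let ?J = "drawn ?C"
  define F where "F = edges_of outside ?C"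
  define E' where "E' = ?C \<union> F"
  have CE: "?C \<subseteq> E" using C by (simp add: gcycle_def)
  have FE: "F \<subseteq> E" "F \<inter> ?C = {}" by (auto simp: F_def edges_of_def)
  have E'E: "E' \<subseteq> E" using CE FE by (simp add: E'_def)
  note Jordan = gcycle_Jordan[OF C]
  obtain z0 where z0: "z0 \<in> inside ?J" using Jordan(5) by blast
  define h where "h = (\<lambda>z. inverse (z - z0))"
  have inj: "x = y" if "h x = h y" for x y
    using that by (simp add: h_def)
  have h0: "h z = 0 \<longleftrightarrow> z = z0" for z by (simp add: h_def)
  have img_h: "h ` A \<inter> h ` B = h ` (A \<inter> B)" for A B
    using image_Int[of h] inj by (metis injI)
  have subset_h: "h ` A \<subseteq> h ` B \<longleftrightarrow> A \<subseteq> B" for A B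
    by (rule inj_image_subset_iff) (rule injI, rule inj)
  have pos_out: "pos v \<in> outside ?J \<union> ?J" if "v \<in> e" "e \<in> E'" for v e
  proof (cases "e \<in> ?C")
    case True
    then show ?thesis using pos_in_img[of e v] that CE unfolding drawn_def by blast
  next
    case False
    then have "v \<in> verts_of outside ?C \<or> v \<in> \<Union>?C"
      using vertex_of_side[OF C _ _ that(1), of outside] that(2) unfolding E'_def F_def by blast
    moreover have "v \<in> \<Union>E" using that E'E by blast
    ultimately show ?thesis using pos_in_drawn[OF CE] unfolding verts_of_def by blast
  qed
  have img_out: "img e \<subseteq> outside ?J \<union> ?J" if "e \<in> E'" for e
  proof (cases "e \<in> ?C")
    case True
    then show ?thesis unfolding drawn_def by blast
  next
    case False
    then have "img e - pos ` e \<subseteq> outside ?J" using that by (simp add: E'_def F_def edges_of_def)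
    then show ?thesis using pos_out[OF _ that] by blast
  qed
  have z0_out: "z0 \<notin> outside ?J \<union> ?J" using z0 Jordan(6,7) by blast
  interpret P: plane_graph E' "h \<circ> pos" "\<lambda>e. h ` img e"
  proof
    show "finite E'" using E'E finite_E finite_subset by blast
  next
    fix e assume e: "e \<in> E'"
    then have eE: "e \<in> E" using E'E by blast
    obtain u v g where g: "e = {u, v}" "u \<noteq> v" "arc g" "pathstart g = pos u" "pathfinish g = pos v"
      "path_image g = img e" using edge[OF eE] by blast
    have z: "z0 \<notin> path_image g" using img_out[OF e] z0_out g(6) by blast
    have "continuous_on (path_image g) h" unfolding h_def using z by (intro continuous_intros) auto
    then have "path (h \<circ> g)" using g(3) by (intro path_continuous_image arc_imp_path)
    moreover have "inj_on (h \<circ> g) {0..1}"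
      by (rule comp_inj_on) (use g(3) in \<open>simp add: arc_def\<close>, rule inj_onI, erule inj)
    ultimately have "arc (h \<circ> g)" by (simp add: arc_def)
    then show "\<exists>u v g. e = {u, v} \<and> u \<noteq> v \<and> arc g \<and> pathstart g = (h \<circ> pos)
      u \<and> pathfinish g = (h \<circ> pos) v
          \<and> path_image g = h ` img e"
      using g by (intro exI[of _ u] exI[of _ v] exI[of _ "h \<circ> g"])
        (simp add: pathstart_compose pathfinish_compose path_image_compose)
  next
    show "inj_on (h \<circ> pos) (\<Union>E')"
    proof (rule inj_onI)
      fix x y assume xy: "x \<in> \<Union>E'" "y \<in> \<Union>E'" "(h \<circ> pos) x = (h \<circ> pos) y"
      then have "pos x = pos y" using inj by simp
      moreover have "x \<in> \<Union>E" "y \<in> \<Union>E" using xy E'E by blast+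
      ultimately show "x = y" by (rule inj_onD[OF inj_pos])
    qed
  next
    fix e assume e: "e \<in> E'"
    then have "e \<in> E" "e \<subseteq> \<Union>E'" "\<Union>E' \<subseteq> \<Union>E" using E'E by blast+
    then have "img e \<inter> pos ` \<Union>E' = pos ` e"
      by (intro Int_squeeze[OF img_vertex] image_mono)
    then show "h ` img e \<inter> (h \<circ> pos) ` \<Union>E' = (h \<circ> pos) ` e"
      unfolding image_comp[symmetric] img_h by simp
  next
    fix e f assume ef: "e \<in> E'" "f \<in> E'" "e \<noteq> f"
    then have "e \<in> E" "f \<in> E" using E'E by blast+
    then have "img e \<inter> img f = pos ` (e \<inter> f)" using img_edge ef(3) by simp
    then show "h ` img e \<inter> h ` img f = (h \<circ> pos) ` (e \<inter> f)"
      unfolding image_comp[symmetric] img_h by simp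
  qed
  have drawn: "P.drawn K = h ` drawn K" for K unfolding P.drawn_def drawn_def by blast
  have C': "gcycle E' cs" using C by (simp add: gcycle_def E'_def)
  have in': "inside (P.drawn ?C) = insert 0 (h ` outside ?J)"
    unfolding drawn unfolding h_def
    by (rule inside_inversion[OF Jordan(8,3,1,4,9,7) z0 P.gcycle_Jordan(5)[OF C', unfolded drawn, unfolded h_def]])
  \<comment> \<open>The extra point 0 of the new inside is \<open>h z0\<close>, so it does not
    matter for sets that avoid \<open>z0\<close>.\<close>
  have sub0: "h ` A \<subseteq> insert 0 (h ` outside ?J) \<longleftrightarrow> A \<subseteq> outside ?J" if
    "z0 \<notin> A" for A
  proof -
    have "0 \<notin> h ` A" using that h0 by auto
    then show ?thesis using subset_h[of A "outside ?J"] by (simp add: subset_insert)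
  qed
  have F': "P.edges_of inside ?C = F"
  proof -
    have "h ` img e - (h \<circ> pos) ` e \<subseteq> inside (P.drawn ?C) \<longleftrightarrow> img e - pos ` e
      \<subseteq> outside ?J" if "e \<in> E'" for e
    proof -
      have "h ` img e - (h \<circ> pos) ` e = h ` (img e - pos ` e)"
        unfolding image_comp[symmetric] by (rule image_set_diff[symmetric], rule injI, erule inj)
      moreover have "z0 \<notin> img e - pos ` e" using img_out[OF that] z0_out by blast
      ultimately show ?thesis unfolding in' using sub0 by simp
    qed
    moreover have "E' - ?C = F" using FE(2) by (auto simp: E'_def)
    moreover have "img e - pos ` e \<subseteq> outside ?J" if "e \<in> F" for e using that by (simp add: F_def
      edges_of_def)
    ultimately show ?thesis unfolding P.edges_of_def by blast
  qed
  have V': "P.verts_of inside ?C = verts_of outside ?C"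
  proof (rule set_eqI)
    fix v
    have eq: "(h \<circ> pos) v \<in> inside (P.drawn ?C) \<longleftrightarrow> pos v \<in> outside ?J" if
      "v \<in> \<Union>E'"
    proof -
      have "pos v \<noteq> z0" using that pos_out z0_out by blast
      then show ?thesis using sub0[of "{pos v}"] unfolding in' by simp
    qed
    have "v \<in> \<Union>E'" if v: "v \<in> verts_of outside ?C"
    proof -
      obtain e where e: "e \<in> E" "v \<in> e" using v by (auto simp: verts_of_def)
      then have "e \<in> F" using edge_at_side[OF C _ v, of e] unfolding F_def by blast
      then show ?thesis using e unfolding E'_def by blast
    qed
    moreover have "\<Union>E' \<subseteq> \<Union>E" using E'E by blast
    ultimately show "v \<in> P.verts_of inside ?C \<longleftrightarrow> v \<in> verts_of outside ?C"
      using eq unfolding P.verts_of_def verts_of_def mem_Collect_eq by blast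
  qed
  have "P.attached F"
    unfolding P.attached_def
  proof (intro allI impI)
    fix K assume K: "K \<noteq> {}" "K \<subseteq> F"
    \<comment> \<open>Dropping the inner edges does not detach \<open>K\<close>: a shared vertex on
      the cycle is also on a cycle edge, and at a shared vertex outside the cycle all edges are
      outer ones.\<close>
    have "\<Union>K \<inter> \<Union>(E - K) \<subseteq> \<Union>K \<inter> \<Union>(E' - K)"
    proof
      fix v assume "v \<in> \<Union>K \<inter> \<Union>(E - K)"
      then obtain e f where ef: "v \<in> e" "e \<in> K" "v \<in> f" "f \<in> E - K" by blast
      show "v \<in> \<Union>K \<inter> \<Union>(E' - K)"
      proof (cases "v \<in> \<Union>?C")
        case True
        then show ?thesis using ef K FE unfolding E'_def by blast
      next
        case False
        then have "v \<in> verts_of outside ?C"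
          using vertex_of_side[OF C _ _ ef(1), of outside] ef K unfolding F_def by blast
        then have "f \<in> F" using edge_at_side[OF C, of outside v f] ef unfolding F_def by blast
        then show ?thesis using ef unfolding E'_def by blast
      qed
    qed
    moreover have "finite (\<Union>K \<inter> \<Union>(E' - K))"
      by (rule finite_subset[OF _ P.finite_verts]) (use K in \<open>auto simp: E'_def\<close>)
    ultimately have "card (\<Union>K \<inter> \<Union>(E - K)) \<le> card (\<Union>K \<inter> \<Union>(E' - K))"
      by (intro card_mono)
    moreover have "2 \<le> card (\<Union>K \<inter> \<Union>(E - K))" using at K unfolding attached_def F_def by blast
    ultimately show "2 \<le> card (\<Union>K \<inter> \<Union>(E' - K))" by linarith
  qed
  moreover have "10 \<le> length c" if "gcycle E' c" for c
    using that girth[of c] E'E unfolding gcycle_def by blast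
  ultimately show ?thesis using P.disc_bound[OF _ C'] unfolding F' V' by (simp add: F_def)
qed

text \<open>A set of edges off the cycle is a proper subset of \<open>E\<close>, so
  \<open>at\<close> makes both sides attached. Adding the \<open>|C|\<close> edges and
  \<open>|C|\<close> vertices of the cycle to the two disc estimates gives
  \<open>8 |E| + 20 <= 10 |V|\<close>.\<close>

lemma nonseparable_bound:
  assumes girth: "\<And>cs. gcycle E cs \<Longrightarrow> 10 \<le> length cs"
    and at: "\<And>K. K \<noteq> {} \<Longrightarrow> K \<subset> E \<Longrightarrow> 2 \<le> card (\<Union>K
      \<inter> \<Union>(E - K))"
    and C: "gcycle E cs"
  shows "8 * card E + 10 \<le> 10 * card (\<Union>E)"
proof -
  have "cycle_edges cs \<noteq> {}" using gcycle_card[OF C] C by (auto simp: gcycle_def)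
  then have att: "attached (edges_of S (cycle_edges cs))" for S
    unfolding attached_def using at C by (auto simp: edges_of_def gcycle_def)
  note cover = edges_cover[OF C]
  have f: "finite (cycle_edges cs)" by (simp add: cycle_edges_def)
  have "card E = length cs + card (edges_of inside (cycle_edges cs)) + card (edges_of outside (cycle_edges cs))"
  proof -
    have "card (cycle_edges cs \<union> edges_of inside (cycle_edges cs) \<union> edges_of outside (cycle_edges cs))
        = card (cycle_edges cs \<union> edges_of inside (cycle_edges cs)) + card (edges_of outside (cycle_edges cs))"
      by (rule card_Un_disjoint) (use f cover(2) in \<open>simp, simp, auto simp: edges_of_def\<close>)
    also have "card (cycle_edges cs \<union> edges_of inside (cycle_edges cs)) = card (cycle_edges cs) + card
      (edges_of inside (cycle_edges cs))"
      by (rule card_Un_disjoint) (use f in \<open>simp, simp, auto simp: edges_of_def\<close>)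
    finally show ?thesis using cover(1) gcycle_card[OF C] by simp
  qed
  moreover have "card (\<Union>E) = length cs + card (verts_of inside (cycle_edges cs)) + card (verts_of outside
    (cycle_edges cs))"
  proof -
    have "card (set cs \<union> verts_of inside (cycle_edges cs) \<union> verts_of outside (cycle_edges cs))
        = card (set cs \<union> verts_of inside (cycle_edges cs)) + card (verts_of outside (cycle_edges cs))"
      by (rule card_Un_disjoint) (use cover(4,6) in auto)
    also have "card (set cs \<union> verts_of inside (cycle_edges cs)) = card (set cs) + card (verts_of inside
      (cycle_edges cs))"
      by (rule card_Un_disjoint) (use cover(5) in auto)
    also have "card (set cs) = length cs" using C by (simp add: gcycle_def distinct_card)
    finally show ?thesis using cover(3) by simp
  qed
  ultimately show ?thesis
    using disc_bound[OF girth C att] disc_bound_outside[OF girth C att] by simp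
qed

end

section \<open>Cut vertices and the edge bound for all plane graphs\<close>

lemma plane_graph_mono:
  assumes "plane_graph E pos img" "F \<subseteq> E"
  shows "plane_graph F pos img"
proof -
  interpret plane_graph E pos img by fact
  show ?thesis
  proof
    show "finite F" using assms(2) finite_E finite_subset by blast
    show "\<exists>u v g. e = {u, v} \<and> u \<noteq> v \<and> arc g \<and> pathstart g = pos u \<and>
      pathfinish g = pos v
          \<and> path_image g = img e" if "e \<in> F" for e by (rule edge) (use that assms(2) in blast)
    show "inj_on pos (\<Union>F)" by (rule inj_on_subset[OF inj_pos]) (use assms(2) in blast)
    show "img e \<inter> pos ` \<Union>F = pos ` e" if "e \<in> F" for e
    proof -
      have "e \<in> E" "e \<subseteq> \<Union>F" "\<Union>F \<subseteq> \<Union>E" using that assms(2) by blast+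
      then show ?thesis by (intro Int_squeeze[OF img_vertex] image_mono)
    qed
    show "img e \<inter> img f = pos ` (e \<inter> f)" if "e \<in> F" "f \<in> F" "e \<noteq> f" for e f
      by (rule img_edge) (use that assms(2) in auto)
  qed
qed

context plane_graph
begin

text \<open>Delete an edge \<open>uv\<close>. If \<open>v\<close> can still be reached from
  \<open>u\<close>, the path closes up with \<open>uv\<close>. If not, the edges reached from
  \<open>u\<close> meet the rest of the graph only in \<open>u\<close>, or, if there are none,
  \<open>uv\<close> hangs by \<open>v\<close> alone; both contradict \<open>at\<close>.\<close>

lemma nonseparable_cycle:
  assumes at: "\<And>K. K \<noteq> {} \<Longrightarrow> K \<subset> E \<Longrightarrow> 2 \<le> card (\<Union>K
    \<inter> \<Union>(E - K))" and two: "2 \<le> card E"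
  obtains cs where "gcycle E cs"
proof -
  have not1: False if "\<Union>K \<inter> \<Union>(E - K) \<subseteq> {x}" "K \<noteq> {}" "K \<subset> E" for K x
  proof -
    have "card (\<Union>K \<inter> \<Union>(E - K)) \<le> card {x}" by (rule card_mono) (use that in simp_all)
    then show False using at[OF that(2,3)] by simp
  qed
  obtain e0 e1 where e01: "e0 \<in> E" "e1 \<in> E" "e0 \<noteq> e1" using two_elements[OF two] by blast
  obtain u v where uv: "e0 = {u, v}" "u \<noteq> v" using edge_doubleton[OF e01(1)] by blast
  \<comment> \<open>\<open>gpath_chain\<close> requires a start outside \<open>W\<close>, so
    \<open>u\<close> is no transit vertex; instead every edge at \<open>u\<close> may begin a
    chain.\<close>
  let ?F = "E - {e0}" and ?W = "- {u}"
  let ?R = "{(e, f). e \<in> ?F \<and> f \<in> ?F \<and> e \<inter> f \<inter> ?W \<noteq> {}}"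
  define K where "K = {e \<in> ?F. \<exists>e1 \<in> ?F. u \<in> e1 \<and> (e1, e) \<in> ?R\<^sup>*}"
  have KF: "K \<subseteq> ?F" by (auto simp: K_def)
  have closed: "f \<in> K" if xe: "x \<in> e" "e \<in> K" and xf: "x \<in> f" "f \<in> ?F" for x e f
  proof (cases "x = u")
    case True
    then show ?thesis using xf by (auto simp: K_def)
  next
    case False
    then have ef: "(e, f) \<in> ?R" using xe xf by (auto simp: K_def)
    obtain e1 where e1: "e1 \<in> ?F" "u \<in> e1" "(e1, e) \<in> ?R\<^sup>*" using xe(2) unfolding K_def by blast
    have "(e1, f) \<in> ?R\<^sup>*" using rtrancl_into_rtrancl[OF e1(3) ef] .
    then show ?thesis using xf(2) e1(1,2) unfolding K_def by blast
  qed
  have "v \<in> \<Union>K"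
  proof (rule ccontr)
    assume v: "v \<notin> \<Union>K"
    show False
    proof (cases "K = {}")
      case True
      have "u \<notin> \<Union>?F"
      proof
        assume "u \<in> \<Union>?F"
        then have "K \<noteq> {}" by (auto simp: K_def)
        then show False using True by simp
      qed
      then show False using not1[of "{e0}" v] e01 uv by blast
    next
      case False
      have "\<Union>K \<inter> \<Union>(E - K) \<subseteq> {u}"
      proof
        fix x assume "x \<in> \<Union>K \<inter> \<Union>(E - K)"
        then obtain e f where ef: "x \<in> e" "e \<in> K" "x \<in> f" "f \<in> E - K" by blast
        then have "f = e0" using closed[OF ef(1,2,3)] by blast
        then show "x \<in> {u}" using uv v ef by blast
      qed
      then show False using not1[of K u] False KF e01 by blast
    qed
  qed
  then obtain e where e: "v \<in> e" "e \<in> K" by blast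
  then obtain e1 where e1: "e1 \<in> ?F" "u \<in> e1" "(e1, e) \<in> ?R\<^sup>*" by (auto simp: K_def)
  have "\<exists>u v. e = {u, v} \<and> u \<noteq> v" if "e \<in> ?F" for e using edge_doubleton that by blast
  then obtain p where p: "gpath ?F u p v"
    using gpath_chain[OF e1(3) e1(1,2) _ _ e(1)] uv(2) by blast
  have "gpath E u [u, v] v" using uv e01 by (simp add: gpath_def)
  moreover have "gpath E u p v" using gpath_mono[OF p] by blast
  moreover have "set p \<inter> set [u, v] = {u, v}" using gpath_ends[OF p] by auto
  moreover have "path_edges p \<inter> path_edges [u, v] = {}" using p uv by (auto simp: gpath_def)
  ultimately show thesis using gcycle_merge[of E u p v "[u, v]"] uv(2) that by metis
qed

end

text \<open>The constant 10 survives gluing: two parts with at most one common vertex give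
  \<open>8 |E| + 20 <= 10 (|V| + 1)\<close>. A single edge gives \<open>18 <= 20\<close>, and
  otherwise \<open>nonseparable_bound\<close> applies.\<close>

theorem plane_edge_bound:
  assumes "plane_graph E pos img" and "\<And>cs. gcycle E cs \<Longrightarrow> 10 \<le> length cs" and "E \<noteq> {}"
  shows "8 * card E + 10 \<le> 10 * card (\<Union>E)"
  using assms
proof (induction "card E" arbitrary: E rule: less_induct)
  case less
  interpret plane_graph E pos img by fact
  have IH: "8 * card K + 10 \<le> 10 * card (\<Union>K)" if "K \<noteq> {}" "K \<subset> E" for K
  proof (rule less.hyps)
    show "card K < card E" using psubset_card_mono[OF finite_E that(2)] .
    show "plane_graph K pos img" using plane_graph_mono[OF less.prems(1)] that(2) by blast
    show "10 \<le> length cs" if "gcycle K cs" for cs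
      using that \<open>K \<subset> E\<close> less.prems(2)[of cs] by (auto simp: gcycle_def)
    show "K \<noteq> {}" by fact
  qed
  show ?case
  proof (cases "\<exists>K. K \<noteq> {} \<and> K \<subset> E \<and> card (\<Union>K \<inter> \<Union>(E - K)) < 2")
    case True
    then obtain K where K: "K \<noteq> {}" "K \<subset> E" "card (\<Union>K \<inter> \<Union>(E - K)) < 2" by blast
    have K': "E - K \<noteq> {}" "E - K \<subset> E" using K by auto
    have "finite (\<Union>K)" "finite (\<Union>(E - K))"
      by (rule finite_subset[OF _ finite_verts], use K in blast)+
    then have "card (\<Union>K) + card (\<Union>(E - K)) = card (\<Union>K \<union> \<Union>(E - K)) + card
      (\<Union>K \<inter> \<Union>(E - K))"
      by (rule card_Un_Int)
    moreover have "\<Union>K \<union> \<Union>(E - K) = \<Union>E" using K(2) by blast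
    moreover have "card E = card K + card (E - K)"
      using K(2) finite_E by (metis add.commute card_Diff_subset card_mono finite_subset le_add_diff_inverse2
        psubset_imp_subset)
    ultimately show ?thesis using IH[OF K(1,2)] IH[OF K'] K(3) by simp
  next
    case False
    then have at: "2 \<le> card (\<Union>K \<inter> \<Union>(E - K))" if "K \<noteq> {}" "K \<subset> E" for K
      using that not_less by blast
    show ?thesis
    proof (cases "2 \<le> card E")
      case True
      obtain cs where "gcycle E cs" using nonseparable_cycle[OF at True] .
      then show ?thesis using nonseparable_bound[OF less.prems(2) at] by blast
    next
      case False
      obtain e where e: "e \<in> E" using less.prems(3) by blast
      have "card E = 1" using False e finite_E by (metis One_nat_def Suc_leI card_gt_0_iff empty_iff le_antisym
        not_less_eq_eq numeral_2_eq_2)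
      moreover have "2 \<le> card (\<Union>E)"
      proof -
        obtain u v where "e = {u, v}" "u \<noteq> v" using edge_doubleton[OF e] by blast
        then have "card e = 2" by simp
        moreover have "card e \<le> card (\<Union>E)" by (rule card_mono[OF finite_verts]) (use e in blast)
        ultimately show ?thesis by simp
      qed
      ultimately show ?thesis by simp
    qed
  qed
qed

section \<open>Colour choices for the reducible configurations\<close>

text \<open>Forbidden colours come as a list, whose length bounds their number without any case
  distinction on coincidences.\<close>

lemma ex_not_in_list: "length xs < card A \<Longrightarrow> \<exists>x\<in>A. x \<notin> set xs"
proof (rule ccontr)
  assume "length xs < card A" "\<not> (\<exists>x\<in>A. x \<notin> set xs)"
  then have "A \<subseteq> set xs" by blast
  then have "card A \<le> length xs" by (meson List.finite_set card_length card_mono le_trans)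
  then show False using \<open>length xs < card A\<close> by simp
qed

definition colours :: "nat set" where "colours = {1..6}"

lemma card_colours [simp]: "card colours = 6"
  by (simp add: colours_def)

text \<open>
  Below, \<open>w\<close> is the colour of the centre of a configuration and \<open>x1, x2, \<dots>\<close> are the colours of its neighbours.
  For a neighbour that starts a path of two vertices of degree 2, \<open>K\<close> is the list of the second vertex of that
  path and \<open>e\<close> the colour of the vertex after it.
\<close>

lemma choice_thread_last:
  assumes "2 \<le> card K" "w \<notin> K"
  shows "\<exists>x y. x \<in> colours \<and> x \<notin> {w, a, b, c, e} \<and> y \<in> K \<and> y \<noteq> x
    \<and> y \<noteq> w"
proof -
  \<comment> \<open>All other neighbours of the centre are coloured, so \<open>x\<close> has five
    colours to avoid. Because \<open>w\<close> is not in \<open>K\<close>, the choice of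
    \<open>y\<close> then only has to avoid \<open>x\<close>.\<close>
  obtain x where x: "x \<in> colours" "x \<notin> set [w, a, b, c, e]" using ex_not_in_list[of "[w, a, b, c, e]"
    colours] by auto
  obtain y where y: "y \<in> K" "y \<notin> set [x]" using ex_not_in_list[of "[x]" K] assms(1) by auto
  show ?thesis using x y assms(2) by (intro exI[of _ x] exI[of _ y]) auto
qed

text \<open>With one neighbour of the centre still uncoloured there is room to choose
  \<open>y\<close> first and to let \<open>x\<close> avoid it, whatever \<open>K\<close>
  contains.\<close>

lemma choice_thread:
  assumes "2 \<le> card K"
  shows "\<exists>x y. x \<in> colours \<and> x \<notin> {w, a, b, e} \<and> y \<in> K \<and> y \<noteq> x
    \<and> y \<noteq> w"
proof -
  obtain y where y: "y \<in> K" "y \<noteq> w" using ex_not_in_list[of "[w]" K] assms by auto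
  obtain x where x: "x \<in> colours" "x \<notin> set [w, a, b, e, y]" using ex_not_in_list[of "[w, a, b, e, y]"
    colours] by auto
  show ?thesis using x y by (intro exI[of _ x] exI[of _ y]) auto
qed

text \<open>Only the thread coloured last needs \<open>choice_thread_last\<close>. So
  \<open>w\<close> avoids a two-element part of \<open>K1\<close> and the colour \<open>x4\<close>,
  three of at least five colours.\<close>

lemma choice_three_threads:
  assumes "5 \<le> card W" "2 \<le> card L" "2 \<le> card K1" "2 \<le> card K2" "2 \<le> card K3"
  obtains w x1 x2 x3 x4 y1 y2 y3 where "w \<in> W" "x4 \<in> L" "{x1, x2, x3} \<subseteq> colours"
    "distinct [w, x1, x2, x3, x4]" "x1 \<noteq> e1" "x2 \<noteq> e2" "x3 \<noteq> e3" "y1 \<in> K1"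
    "y2 \<in> K2" "y3 \<in> K3" "y1 \<notin> {x1, w}" "y2 \<notin> {x2, w}" "y3 \<notin> {x3, w}"
proof -
  obtain K where K: "K \<subseteq> K1" "card K = 2" using obtain_subset_with_card_n[OF assms(3)] by blast
  obtain p q where pq: "K = {p, q}" using K(2) card_2_iff by metis
  obtain x4 where x4: "x4 \<in> L" using ex_not_in_list[of "[]" L] assms by auto
  obtain w where w: "w \<in> W" "w \<notin> set [x4, p, q]" using ex_not_in_list[of "[x4, p, q]" W] assms by auto
  obtain x2 y2 where 2: "x2 \<in> colours" "x2 \<notin> {w, x4, x4, e2}" "y2 \<in> K2" "y2 \<noteq> x2"
    "y2 \<noteq> w"
    using choice_thread[OF assms(4)] by blast
  obtain x3 y3 where 3: "x3 \<in> colours" "x3 \<notin> {w, x4, x2, e3}" "y3 \<in> K3" "y3 \<noteq> x3"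
    "y3 \<noteq> w"
    using choice_thread[OF assms(5)] by blast
  obtain x1 y1 where 1: "x1 \<in> colours" "x1 \<notin> {w, x4, x2, x3, e1}" "y1 \<in> K" "y1 \<noteq> x1"
    "y1 \<noteq> w"
    using choice_thread_last[of K w x4 x2 x3 e1] K w pq by auto
  show thesis
    by (rule that[of w x4 x1 x2 x3 y1 y2 y3]) (use x4 w 1 2 3 K(1) in auto)
qed

text \<open>The bottleneck is \<open>c1\<close>: its three colours \<open>M\<close> may be used up
  by \<open>v\<close>, \<open>w\<close> and \<open>c2\<close>. It is enough that one of these takes
  a colour outside \<open>M\<close>. Cases 1 to 3 achieve this for \<open>w\<close>,
  \<open>c2\<close> and \<open>v\<close> with \<open>x1 = a\<close>; in case 4 the colour of
  \<open>x1\<close> has to change.\<close>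

lemma choice_two_threads_half:
  assumes W: "5 \<le> card W" and V: "4 \<le> card V" and M1: "3 \<le> card M1" and M2: "2 \<le> card M2" and L:
    "2 \<le> card L"
    and K1: "2 \<le> card K1" and K2: "2 \<le> card K2"
  obtains w x1 x2 x3 v c1 c2 y2 y3 where "w \<in> W" "x1 \<in> L" "{x2, x3} \<subseteq> colours" "v \<in> V"
    "c1 \<in> M1" "c2 \<in> M2" "distinct [w, x1, x2, x3, v]" "distinct [v, w, c1, c2]" "x2 \<noteq> e2"
    "x3 \<noteq> e3" "y2 \<in> K1" "y3 \<in> K2" "y2 \<notin> {x2, w}" "y3 \<notin> {x3, w}"
proof -
  obtain K where K: "K \<subseteq> K1" "card K = 2" using obtain_subset_with_card_n[OF K1] by blast
  obtain p q where pq: "K = {p, q}" using K(2) card_2_iff by metis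
  have "\<exists>w x1 v c1 c2. w \<in> W \<and> x1 \<in> L \<and> v \<in> V \<and> c1 \<in> M1 \<and> c2 \<in>
    M2 \<and> w \<notin> K \<and>
      distinct [w, x1, v] \<and> distinct [v, w, c1, c2]"
  proof -
    obtain M where M: "M \<subseteq> M1" "card M = 3" by (rule obtain_subset_with_card_n[OF M1])
    obtain m1 m2 m3 where M': "M = {m1, m2, m3}" using M(2) unfolding card_3_iff by blast
    obtain a where a: "a \<in> L" using ex_not_in_list[of "[]" L] L by auto
    define W' where "W' = W - {a, p, q}"
    obtain w0 where w0: "w0 \<in> W'" using ex_not_in_list[of "[a, p, q]" W] W by (auto simp: W'_def)
    consider (1) w where "w \<in> W'" "w \<notin> M" | (2) k where "W' \<subseteq> M" "k \<in> M2" "k \<notin> M"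
      | (3) v where "W' \<subseteq> M" "M2 \<subseteq> M" "v \<in> V" "v \<noteq> a" "v \<notin> M"
      | (4) "W' \<subseteq> M" "M2 \<subseteq> M" "V - {a} \<subseteq> M" by blast
    then show ?thesis
    proof cases
      case 1
      obtain k where k: "k \<in> M2" "k \<notin> set [w]" using ex_not_in_list[of "[w]" M2] M2 by auto
      obtain v where v: "v \<in> V" "v \<notin> set [a, w, k]" using ex_not_in_list[of "[a, w, k]" V] V by auto
      obtain c1 where c: "c1 \<in> M" "c1 \<notin> set [v, k]" using ex_not_in_list[of "[v, k]" M] M by auto
      show ?thesis
        by (rule exI[of _ w], rule exI[of _ a], rule exI[of _ v], rule exI[of _ c1], rule exI[of _ k])
          (use a 1 k v c pq M in \<open>auto simp: W'_def\<close>)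
    next
      case 2
      obtain v where v: "v \<in> V" "v \<notin> set [a, w0, k]" using ex_not_in_list[of "[a, w0, k]" V] V by auto
      obtain c1 where c: "c1 \<in> M" "c1 \<notin> set [v, w0]" using ex_not_in_list[of "[v, w0]" M] M by auto
      show ?thesis
        by (rule exI[of _ w0], rule exI[of _ a], rule exI[of _ v], rule exI[of _ c1], rule exI[of _ k])
          (use a 2 w0 v c pq M in \<open>auto simp: W'_def\<close>)
    next
      case 3
      obtain k where k: "k \<in> M2" "k \<notin> set [w0]" using ex_not_in_list[of "[w0]" M2] M2 by auto
      obtain c1 where c: "c1 \<in> M" "c1 \<notin> set [k, w0]" using ex_not_in_list[of "[k, w0]" M] M by auto
      show ?thesis
        by (rule exI[of _ w0], rule exI[of _ a], rule exI[of _ v], rule exI[of _ c1], rule exI[of _ k])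
          (use a 3 w0 k c pq M in \<open>auto simp: W'_def\<close>)
    next
      case 4
      \<comment> \<open>Four colours do not fit into \<open>M\<close>, and the one left over can
        only be \<open>a\<close>. So \<open>v\<close> takes \<open>a\<close>, and \<open>x1\<close>
        takes another colour of \<open>L\<close>.\<close>
      obtain v where "v \<in> V" "v \<notin> set [m1, m2, m3]" using ex_not_in_list[of "[m1, m2, m3]" V] V by auto
      then have av: "a \<in> V" "a \<notin> M" using 4(3) M' by auto
      obtain a' where a': "a' \<in> L" "a' \<notin> set [a]" using ex_not_in_list[of "[a]" L] L by auto
      obtain w where w: "w \<in> W" "w \<notin> set [a, a', p, q]" using ex_not_in_list[of "[a, a', p, q]" W] W
        by auto
      obtain k where k: "k \<in> M2" "k \<notin> set [w]" using ex_not_in_list[of "[w]" M2] M2 by auto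
      obtain c1 where c: "c1 \<in> M" "c1 \<notin> set [w, k]" using ex_not_in_list[of "[w, k]" M] M by auto
      have n: "k \<noteq> a" "c1 \<noteq> a" "c1 \<in> M1" using k(1) 4(2) av(2) c(1) M(1) by blast+
      show ?thesis
        by (rule exI[of _ w], rule exI[of _ a'], rule exI[of _ a], rule exI[of _ c1], rule exI[of _ k])
          (use n av a' w k c pq in auto)
    qed
  qed
  then obtain w x1 v c1 c2 where *: "w \<in> W" "x1 \<in> L" "v \<in> V" "c1 \<in> M1" "c2 \<in> M2" "w \<notin> K"
      "distinct [w, x1, v]" "distinct [v, w, c1, c2]" by blast
  obtain x3 y3 where 3: "x3 \<in> colours" "x3 \<notin> {w, x1, v, e3}" "y3 \<in> K2" "y3 \<noteq> x3" "y3 \<noteq> w"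
    using choice_thread[OF K2] by blast
  obtain x2 y2 where 2: "x2 \<in> colours" "x2 \<notin> {w, x1, v, x3, e2}" "y2 \<in> K" "y2 \<noteq> x2"
    "y2 \<noteq> w"
    using choice_thread_last[of K w x1 v x3 e2] K(2) *(6) by auto
  show thesis
    by (rule that[of w x1 x2 x3 v c1 c2 y2 y3]) (use * 2 3 K(1) in auto)
qed

text \<open>The centre avoids \<open>x2\<close> and the two colours of \<open>K\<close>, which just
  works with four colours; \<open>x1\<close> can wait until then because it has three. The threads
  are coloured at the end.\<close>

lemma choice_two_threads_three:
  assumes W: "4 \<le> card W" and L1: "3 \<le> card L1" and L2: "2 \<le> card L2" and K1: "2 \<le> card K1" and
    K2: "2 \<le> card K2"
  obtains w x1 x2 x3 x4 y3 y4 where "w \<in> W" "x1 \<in> L1" "x2 \<in> L2" "{x3, x4} \<subseteq> colours"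
    "distinct [w, x1, x2, x3, x4]" "x3 \<noteq> e3" "x4 \<noteq> e4" "y3 \<in> K1" "y4 \<in> K2"
    "y3 \<notin> {x3, w}" "y4 \<notin> {x4, w}"
proof -
  obtain K where K: "K \<subseteq> K1" "card K = 2" using obtain_subset_with_card_n[OF K1] by blast
  obtain p q where pq: "K = {p, q}" using K(2) card_2_iff by metis
  obtain x2 where x2: "x2 \<in> L2" using ex_not_in_list[of "[]" L2] L2 by auto
  obtain w where w: "w \<in> W" "w \<notin> set [x2, p, q]" using ex_not_in_list[of "[x2, p, q]" W] W by auto
  obtain x1 where x1: "x1 \<in> L1" "x1 \<notin> set [x2, w]" using ex_not_in_list[of "[x2, w]" L1] L1 by auto
  obtain x4 y4 where 4: "x4 \<in> colours" "x4 \<notin> {w, x1, x2, e4}" "y4 \<in> K2" "y4 \<noteq> x4"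
    "y4 \<noteq> w"
    using choice_thread[OF K2] by blast
  obtain x3 y3 where 3: "x3 \<in> colours" "x3 \<notin> {w, x1, x2, x4, e3}" "y3 \<in> K" "y3 \<noteq> x3"
    "y3 \<noteq> w"
    using choice_thread_last[of K w x1 x2 x4 e3] K(2) w pq by auto
  show thesis
    by (rule that[of w x1 x2 x3 x4 y3 y4]) (use x1 x2 w 3 4 K(1) in auto)
qed

text \<open>
  \<open>w\<close>, \<open>x\<close>, \<open>u\<close> are the colours along a path whose middle vertex has degree 2 and whose last vertex has two further
  neighbours of degree 2, with lists \<open>A\<close> and \<open>B\<close>. All that matters about these lists is one pair \<open>P\<close> of colours
  forbidden for \<open>x\<close> and one pair \<open>Q\<close> that \<open>w\<close> and \<open>x\<close> must not occupy together.
\<close>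

lemma choice_bad:
  assumes U: "4 \<le> card U" and A: "2 \<le> card A" and B: "2 \<le> card B"
  obtains P Q where "card P = 2" "card Q = 2" "P \<inter> Q = {}" "P \<subseteq> A \<union> B" "Q \<subseteq> U"
    "\<And>w x. x \<notin> P \<Longrightarrow> {w, x} \<noteq> Q \<Longrightarrow>
      \<exists>u y y'. u \<in> U \<and> y \<in> A \<and> y' \<in> B \<and> u \<notin> {w, x, y, y'} \<and> y
        \<noteq> y' \<and> y \<noteq> x \<and> y' \<noteq> x"
proof -
  obtain y where y: "y \<in> A" using ex_not_in_list[of "[]" A] A by auto
  obtain y' where y': "y' \<in> B" "y' \<noteq> y" using ex_not_in_list[of "[y]" B] B by auto
  obtain u where u: "u \<in> U" "u \<notin> set [y, y']" using ex_not_in_list[of "[y, y']" U] U by auto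
  obtain u' where u': "u' \<in> U" "u' \<notin> set [y, y', u]" using ex_not_in_list[of "[y, y', u]" U] U by auto
  show thesis
  \<comment> \<open>The colours \<open>y\<close>, \<open>y'\<close> are fixed once and for all,
    which rules them out for \<open>x\<close>. Two colours remain for the vertex between them, and
    both are blocked only if \<open>w\<close> and \<open>x\<close> take exactly these two.\<close>
  proof (rule that[of "{y, y'}" "{u, u'}"])
    fix w x assume wx: "x \<notin> {y, y'}" "{w, x} \<noteq> {u, u'}"
    then have "u \<notin> {w, x} \<or> u' \<notin> {w, x}" using u' by auto
    then show "\<exists>u y y'. u \<in> U \<and> y \<in> A \<and> y' \<in> B \<and> u \<notin> {w, x, y, y'}
      \<and> y \<noteq> y' \<and> y \<noteq> x \<and> y' \<noteq> x"
      using y y' u u' wx by (elim disjE) (rule exI[of _ u] exI[of _ u'], rule exI[of _ y], rule exI[of _ y'], auto)+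
  qed (use y y' u u' in auto)
qed

text \<open>If the centre can avoid both \<open>K'\<close> and \<open>Q\<close>, the condition on
  \<open>{w, x1}\<close> holds by itself and \<open>x1\<close> has five colours to avoid. Otherwise
  the four colours of \<open>W\<close> lie in \<open>K' \<union> Q\<close>, so both colours of
  \<open>Q\<close> are open to the centre, and any \<open>x1\<close> outside
  \<open>P \<union> Q\<close> meets the two conditions.\<close>

lemma choice_four_bad_three:
  assumes W: "4 \<le> card W" and L2: "3 \<le> card L2" and L3: "2 \<le> card L3" and K: "2 \<le> card K"
    and PQ: "card P = 2" "card Q = 2" "P \<inter> Q = {}" "P \<subseteq> colours" "Q \<subseteq> colours"
  obtains w x1 x2 x3 x4 y4 where "w \<in> W" "{x1, x4} \<subseteq> colours" "x2 \<in> L2" "x3 \<in> L3"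
    "distinct [w, x1, x2, x3, x4]" "x1 \<notin> P" "{w, x1} \<noteq> Q" "x4 \<noteq> e4" "y4 \<in> K"
    "y4 \<notin> {x4, w}"
proof -
  obtain K' where K': "K' \<subseteq> K" "card K' = 2" using obtain_subset_with_card_n[OF K] by blast
  obtain k l where kl: "K' = {k, l}" using K'(2) card_2_iff by metis
  obtain p p' where P: "P = {p, p'}" "p \<noteq> p'" using PQ(1) card_2_iff by metis
  obtain q q' where Q: "Q = {q, q'}" "q \<noteq> q'" using PQ(2) card_2_iff by metis
  have "\<exists>w x1 x2 x3. w \<in> W \<and> w \<notin> K' \<and> x1 \<in> colours \<and> x2 \<in> L2 \<and> x3
    \<in> L3 \<and> distinct [w, x1, x2, x3] \<and>
    x1 \<notin> P \<and> {w, x1} \<noteq> Q"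
  proof (cases "\<exists>w \<in> W. w \<notin> {k, l, q, q'}")
    case True
    then obtain w where w: "w \<in> W" "w \<notin> {k, l, q, q'}" by blast
    obtain x3 where x3: "x3 \<in> L3" "x3 \<notin> set [w]" using ex_not_in_list[of "[w]" L3] L3 by auto
    obtain x2 where x2: "x2 \<in> L2" "x2 \<notin> set [w, x3]" using ex_not_in_list[of "[w, x3]" L2] L2 by auto
    obtain x1 where x1: "x1 \<in> colours" "x1 \<notin> set [w, x3, x2, p, p']" using ex_not_in_list[of
      "[w, x3, x2, p, p']" colours] by auto
    show ?thesis
      by (rule exI[of _ w], rule exI[of _ x1], rule exI[of _ x2], rule exI[of _ x3]) (use w x1 x2 x3 kl P Q in auto)
  next
    case False
    then have qW: "q \<in> W" "q' \<in> W" "q \<notin> {k, l}" "q' \<notin> {k, l}"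
    proof -
      have F: "\<forall>w\<in>W. w = k \<or> w = l \<or> w = q \<or> w = q'" using False by auto
      obtain w where "w \<in> W" "w \<notin> set [k, l, q]" using ex_not_in_list[of "[k, l, q]" W] W by auto
      then show "q' \<in> W" "q' \<notin> {k, l}" using F by auto
      obtain w where "w \<in> W" "w \<notin> set [k, l, q']" using ex_not_in_list[of "[k, l, q']" W] W by auto
      then show "q \<in> W" "q \<notin> {k, l}" using F by auto
    qed
    obtain r where r: "r \<in> colours" "r \<notin> set [p, p', q, q']" using ex_not_in_list[of "[p, p', q, q']"
      colours] by auto
    obtain r' where r': "r' \<in> colours" "r' \<notin> set [p, p', q, q', r]" using ex_not_in_list[of
      "[p, p', q, q', r]" colours] by auto
    text \<open>For one of the two choices of the centre the list \<open>L2\<close> is not contained in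
      \<open>{w, r, r'}\<close>.\<close>
    have "\<exists>w \<in> {q, q'}. \<exists>x2 \<in> L2. x2 \<notin> {w, r, r'}"
    proof -
      obtain x2 where "x2 \<in> L2" "x2 \<notin> set [r, r']" using ex_not_in_list[of "[r, r']" L2] L2 by auto
      then show ?thesis using Q(2) by auto
    qed
    then obtain w x2 where w: "w \<in> {q, q'}" "x2 \<in> L2" "x2 \<notin> {w, r, r'}" by blast
    obtain x3 where x3: "x3 \<in> L3" "x3 \<noteq> w" using ex_not_in_list[of "[w]" L3] L3 by auto
    show ?thesis
    \<comment> \<open>\<open>x2\<close> avoids \<open>r\<close> and \<open>r'\<close>, so one of
      these is left for \<open>x1\<close> if it differs from \<open>x3\<close>. If
      \<open>x3 = x2\<close>, that colour is left to \<open>x3\<close>, and \<open>x2\<close> is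
      chosen anew.\<close>
    proof (cases "x3 = x2")
      case False
      obtain x1 where x1: "x1 \<in> {r, r'}" "x1 \<noteq> x3" using r' by auto
      show ?thesis
        by (rule exI[of _ w], rule exI[of _ x1], rule exI[of _ x2], rule exI[of _ x3])
          (use False x1 x3 w qW kl P Q r r' in \<open>auto simp: doubleton_eq_iff\<close>)
    next
      case True
      obtain x2' where x2': "x2' \<in> L2" "x2' \<notin> set [w, x3]" using ex_not_in_list[of "[w, x3]" L2] L2 by auto
      obtain x1 where x1: "x1 \<in> {r, r'}" "x1 \<noteq> x2'" using r' by auto
      show ?thesis
        by (rule exI[of _ w], rule exI[of _ x1], rule exI[of _ x2'], rule exI[of _ x3])
          (use True x1 x2' x3 w qW kl P Q r r' in \<open>auto simp: doubleton_eq_iff\<close>)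
    qed
  qed
  then obtain w x1 x2 x3 where *: "w \<in> W" "w \<notin> K'" "x1 \<in> colours" "x2 \<in> L2" "x3 \<in> L3"
    "distinct [w, x1, x2, x3]"
    "x1 \<notin> P" "{w, x1} \<noteq> Q" by blast
  obtain x4 y4 where 4: "x4 \<in> colours" "x4 \<notin> {w, x1, x2, x3, e4}" "y4 \<in> K'" "y4 \<noteq> x4"
    "y4 \<noteq> w"
    using choice_thread_last[of K' w x1 x2 x3 e4] K'(2) *(2) by auto
  show thesis
    by (rule that[of w x1 x4 x2 x3 y4]) (use * 4 K'(1) in auto)
qed

text \<open>\<open>s\<close> is the colour of a neighbour of the centre that is not recoloured. If
  only the colours of \<open>Q\<close> are open to the centre, \<open>x1\<close> is taken outside
  \<open>P\<close>, \<open>Q\<close> and \<open>s\<close>; then \<open>x2\<close> is fixed before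
  the centre, which can still avoid it by using one of its two colours.\<close>

lemma choice_three_bad_three:
  assumes W: "2 \<le> card W" and L2: "3 \<le> card L2" and s: "s \<notin> W"
    and PQ: "card P = 2" "card Q = 2" "P \<inter> Q = {}" "P \<subseteq> colours" "Q \<subseteq> colours"
  obtains w x1 x2 where "w \<in> W" "x1 \<in> colours" "x2 \<in> L2" "distinct [w, x1, x2, s]" "x1 \<notin> P"
    "{w, x1} \<noteq> Q"
proof -
  obtain p p' where P: "P = {p, p'}" "p \<noteq> p'" using PQ(1) card_2_iff by metis
  obtain q q' where Q: "Q = {q, q'}" "q \<noteq> q'" using PQ(2) card_2_iff by metis
  show thesis
  proof (cases "\<exists>w \<in> W. w \<notin> {q, q'}")
    case True
    then obtain w where w: "w \<in> W" "w \<notin> {q, q'}" by blast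
    obtain x2 where x2: "x2 \<in> L2" "x2 \<notin> set [w, s]" using ex_not_in_list[of "[w, s]" L2] L2 by auto
    obtain x1 where x1: "x1 \<in> colours" "x1 \<notin> set [w, s, x2, p, p']" using ex_not_in_list[of
      "[w, s, x2, p, p']" colours] by auto
    show thesis
      by (rule that[of w x1 x2]) (use w x1 x2 P Q s in auto)
  next
    case False
    then have F: "\<forall>w\<in>W. w = q \<or> w = q'" by auto
    have qW: "q \<in> W" "q' \<in> W" using ex_not_in_list[of "[q]" W] ex_not_in_list[of "[q']" W] W F by auto
    obtain r where r: "r \<in> colours" "r \<notin> set [p, p', q, q', s]" using ex_not_in_list[of
      "[p, p', q, q', s]" colours] by auto
    obtain x2 where x2: "x2 \<in> L2" "x2 \<notin> set [r, s]" using ex_not_in_list[of "[r, s]" L2] L2 by auto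
    obtain w where w: "w \<in> {q, q'}" "w \<noteq> x2" using Q(2) by auto
    show thesis
      by (rule that[of w r x2])
        (use w r x2 qW P Q s in \<open>auto simp: doubleton_eq_iff\<close>)
  qed
qed

section \<open>Minimal counterexamples\<close>

text \<open>In \<open>remove\<close> the vertex \<open>t\<close> also receives a colour, so that the
  map is defined on all of \<open>V\<close>, but this colour is arbitrary and the neighbourhood of
  \<open>t\<close> is unconstrained. As \<open>nb\<close> is symmetric with values in
  \<open>V\<close>, vertices outside \<open>V\<close> have no neighbours.\<close>

locale critical =
  fixes V :: "'a set" and nb :: "'a \<Rightarrow> 'a set"
  assumes finite_V: "finite V"
    and nb_sym: "u \<in> nb v \<Longrightarrow> v \<in> nb u"
    and nb_irrefl: "v \<notin> nb v"
    and nb_V: "nb v \<subseteq> V"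
    and girth: "\<And>cs. distinct cs \<Longrightarrow> 3 \<le> length cs \<Longrightarrow> successively
      (\<lambda>u v. v \<in> nb u) cs \<Longrightarrow> hd cs \<in> nb (last cs)
       \<Longrightarrow> 10 \<le> length cs"
    and degree: "card (nb v) \<le> 4"
    and remove: "t \<in> V \<Longrightarrow> \<exists>c. (\<forall>v\<in>V. c v \<in> colours) \<and>
      (\<forall>v\<in>V - {t}. inj_on c (insert v (nb v - {t})))"
    and not_colourable: "\<not> (\<exists>c. (\<forall>v\<in>V. c v \<in> colours) \<and> (\<forall>v\<in>V.
      inj_on c (insert v (nb v))))"
begin

lemma finite_nb [simp]: "finite (nb v)"
  using nb_V finite_V finite_subset by blast

section \<open>Short walks in a graph of girth 10\<close>

fun nonbacktracking :: "'a list \<Rightarrow> bool" where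
  "nonbacktracking (x # y # z # xs) \<longleftrightarrow> y \<in> nb x \<and> x \<noteq> z \<and>
    nonbacktracking (y # z # xs)"
| "nonbacktracking [x, y] \<longleftrightarrow> y \<in> nb x"
| "nonbacktracking _ \<longleftrightarrow> True"

lemma nonbacktracking_tl: "nonbacktracking (x # xs) \<Longrightarrow> nonbacktracking xs"
  by (cases xs; cases "tl xs") auto

lemma nonbacktracking_successively:
  "nonbacktracking xs \<Longrightarrow> successively (\<lambda>u v. v \<in> nb u) xs"
  by (induction xs rule: nonbacktracking.induct) auto

text \<open>A return to \<open>x\<close> closes a cycle. It has at least three vertices, since loops
  and immediate reversals are excluded, hence at least 10; with the repeated vertex the list has 11
  entries. Unlike distinctness, nonbacktracking is a local condition that can be checked step by
  step.\<close>

lemma nonbacktracking_distinct: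
  "nonbacktracking xs \<Longrightarrow> length xs \<le> 10 \<Longrightarrow> distinct xs"
proof (induction xs)
  case (Cons x ys)
  have dys: "distinct ys" using Cons nonbacktracking_tl by simp
  show ?case
  proof (rule ccontr)
    assume "\<not> distinct (x # ys)"
    then have "x \<in> set ys" using dys by simp
    then obtain us vs where ys: "ys = us @ x # vs" by (meson split_list)
    have us: "us \<noteq> []"
    proof
      assume "us = []"
      then have "x \<in> nb x" using Cons.prems(1) ys by (cases vs) simp_all
      then show False using nb_irrefl by simp
    qed
    moreover have "length us \<noteq> 1"
    proof
      assume "length us = 1"
      then obtain y where "us = [y]" by (cases us) auto
      then show False using Cons.prems(1) by (simp add: ys)
    qed
    ultimately have "2 \<le> length us" by (cases us; cases "tl us") auto
    have "successively (\<lambda>u v. v \<in> nb u) (((x # us) @ [x]) @ vs)"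
      using nonbacktracking_successively[OF Cons.prems(1)] by (simp add: ys)
    then have "successively (\<lambda>u v. v \<in> nb u) ((x # us) @ [x])"
      by (simp only: successively_append_iff)
    then have "successively (\<lambda>u v. v \<in> nb u) (x # us)" "x \<in> nb (last (x # us))"
      by (simp_all only: successively_append_iff) (use us in auto)
    then have "10 \<le> length (x # us)"
      using girth[of "x # us"] dys ys \<open>2 \<le> length us\<close> by auto
    then show False using Cons.prems(2) ys by simp
  qed
qed simp

lemma nonbacktracking_rev_append:
  "nonbacktracking (a # xs) \<Longrightarrow> nonbacktracking (a # y # ys) \<Longrightarrow> (xs \<noteq> []
    \<Longrightarrow> hd xs \<noteq> y) \<Longrightarrow> nonbacktracking (rev xs @ a # y # ys)"
proof (induction xs arbitrary: a y ys)
  case (Cons x xs)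
  have "nonbacktracking (x # xs)" using nonbacktracking_tl Cons.prems(1) .
  moreover have "nonbacktracking (x # a # y # ys)"
    using Cons.prems nb_sym by (cases xs) auto
  moreover have "xs \<noteq> [] \<Longrightarrow> hd xs \<noteq> a" using Cons.prems(1) by (cases xs) auto
  ultimately show ?case using Cons.IH[of x a "y # ys"] by simp
qed simp

text \<open>Equal first steps are cancelled by induction. Walks with different first steps combine,
  one of them reversed, into a nonbacktracking list of at most 4 + 1 + 4 vertices; it is distinct,
  so they cannot have the same end.\<close>

lemma nonbacktracking_unique:
  "\<lbrakk>nonbacktracking (r # xs); nonbacktracking (r # ys); length xs \<le> 4; length ys \<le> 4; last (r #
    xs) = last (r # ys)\<rbrakk> \<Longrightarrow> xs = ys"
proof (induction xs arbitrary: r ys)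
  case Nil
  show ?case
  proof (cases ys)
    case (Cons y ys')
    have "distinct (r # ys)" using nonbacktracking_distinct[OF Nil(2)] Nil(4) by simp
    moreover have "r \<in> set ys" using Nil(5) Cons by auto
    ultimately show ?thesis by simp
  qed simp
next
  case (Cons x xs)
  show ?case
  proof (cases ys)
    case Nil
    have "distinct (r # x # xs)" using nonbacktracking_distinct[OF Cons.prems(1)] Cons.prems(3) by simp
    moreover have "r = last (x # xs)" using Cons.prems(5) Nil by simp
    then have "r \<in> set (x # xs)" using last_in_set[of "x # xs"] by simp
    ultimately show ?thesis by simp
  next
    case (Cons y ys')
    show ?thesis
    proof (cases "x = y")
      case True
      then have "xs = ys'" using Cons.IH[of x ys'] Cons.prems nonbacktracking_tl Cons by auto
      then show ?thesis using True Cons by simp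
    next
      case False
      have "nonbacktracking (rev (x # xs) @ r # y # ys')"
        by (rule nonbacktracking_rev_append) (use Cons.prems Cons False in auto)
      then have "distinct (rev (x # xs) @ r # y # ys')"
        by (rule nonbacktracking_distinct) (use Cons.prems Cons in auto)
      then have "set (x # xs) \<inter> set (y # ys') = {}" by auto
      moreover have "last (x # xs) = last (y # ys')" using Cons.prems(5) Cons by simp
      ultimately show ?thesis using last_in_set[of "x # xs"] last_in_set[of "y # ys'"] by auto
    qed
  qed
qed

text \<open>As a function of the end vertex it separates vertices: to see that the vertices of a
  tree are distinct, it suffices that the explicit walks from the root to them differ as
  lists.\<close>

definition walk_to :: "'a \<Rightarrow> 'a \<Rightarrow> 'a list" where
  "walk_to r v = (THE xs. nonbacktracking (r # xs) \<and> length xs \<le> 4 \<and> last (r # xs) = v)"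

lemma walk_to_eq: "nonbacktracking (r # xs) \<Longrightarrow> length xs \<le> 4 \<Longrightarrow> walk_to r
  (last (r # xs)) = xs"
  unfolding walk_to_def by (rule the_equality) (auto intro: nonbacktracking_unique)

lemma distinct_by_walks: "distinct (map (walk_to r) xs) \<Longrightarrow> distinct xs"
  by (simp add: distinct_map)

section \<open>Colours that the surroundings leave to a recoloured set\<close>

definition avail :: "('a \<Rightarrow> nat) \<Rightarrow> 'a \<Rightarrow> 'a \<Rightarrow> nat set" where
  "avail c p m = colours - c ` insert m (nb m - {p})"

lemma avail_iff: "k \<in> avail c p m \<longleftrightarrow> k \<in> colours \<and> k \<noteq> c m \<and> k
  \<notin> c ` (nb m - {p})"
  by (auto simp: avail_def)

text \<open>The excluded colours are those of \<open>m\<close> and of its neighbours other than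
  \<open>p\<close>, at most \<open>deg m\<close> in all; \<open>p\<close> is exempt because it is
  about to be recoloured.\<close>

lemma avail_card:
  assumes "m \<in> nb p"
  shows "6 - card (nb m) \<le> card (avail c p m)"
proof -
  have pm: "p \<in> nb m" using assms by (rule nb_sym)
  have "card (c ` insert m (nb m - {p})) \<le> card (insert m (nb m - {p}))" by (rule card_image_le) simp
  also have "\<dots> = Suc (card (nb m - {p}))" using nb_irrefl by simp
  also have "\<dots> = card (nb m)" by (rule card.remove[OF finite_nb pm, symmetric])
  finally show ?thesis
    using diff_card_le_card_Diff[of "c ` insert m (nb m - {p})" colours] by (simp add: avail_def)
qed

lemma avail_card2: "m \<in> nb p \<Longrightarrow> 2 \<le> card (avail c p m)"
  using avail_card[of m p c] degree[of m] by linarith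

lemma avail_card3: "m \<in> nb p \<Longrightarrow> card (nb m) \<le> 3 \<Longrightarrow> 3 \<le> card (avail c p m)"
  using avail_card[of m p c] by linarith

definition stuck :: "'a set \<Rightarrow> ('a \<Rightarrow> nat) \<Rightarrow> bool" where
  "stuck S c \<longleftrightarrow> (\<forall>F. (\<forall>x. x \<notin> S \<longrightarrow> F x = c x)
    \<longrightarrow> (\<forall>p\<in>S. F p \<in> colours) \<longrightarrow>
     (\<forall>p\<in>S. \<forall>m\<in>nb p - S. F p \<in> avail c p m) \<longrightarrow> \<not>
       (\<forall>m\<in>S. inj_on F (insert m (nb m))))"

lemma stuckD:
  assumes "stuck S c" "\<And>x. x \<notin> S \<Longrightarrow> F x = c x"
    "\<And>p. p \<in> S \<Longrightarrow> F p \<in> colours"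
    "\<And>p m. p \<in> S \<Longrightarrow> m \<in> nb p - S \<Longrightarrow> F p \<in> avail c p m"
      "\<And>m. m \<in> S \<Longrightarrow> inj_on F (insert m (nb m))"
  shows False
  using assms unfolding stuck_def by blast

text \<open>Any vertex of \<open>S\<close> may serve as the deleted one. Neighbourhoods of vertices
  of \<open>S\<close> are checked anew, and by \<open>outer\<close> a vertex outside
  \<open>S\<close> has at most one neighbour in \<open>S\<close>, so \<open>avail\<close> expresses
  its whole demand. Reducibility proofs then refute \<open>stuck\<close> by exhibiting
  \<open>F\<close>.\<close>

lemma recolour:
  assumes S: "S \<subseteq> V" "S \<noteq> {}"
    and outer: "\<forall>p\<in>S. \<forall>q\<in>S. \<forall>m\<in>nb p - S. m \<in> nb q \<longrightarrow> p = q"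
  shows "\<exists>c. stuck S c"
proof -
  obtain t where t: "t \<in> S" using S by blast
  obtain c where c: "\<forall>v\<in>V. c v \<in> colours" "\<forall>v\<in>V - {t}. inj_on c (insert v (nb v - {t}))"
    using remove[of t, OF subsetD[OF S(1) t]] by blast
  have "stuck S c"
    unfolding stuck_def
  proof (intro allI impI notI)
    fix F assume F: "\<forall>x. x \<notin> S \<longrightarrow> F x = c x" "\<forall>p\<in>S. F p \<in> colours"
        "\<forall>p\<in>S. \<forall>m\<in>nb p - S. F p \<in> avail c p m"
          "\<forall>m\<in>S. inj_on F (insert m (nb m))"
    have "inj_on F (insert v (nb v))" if v: "v \<in> V" for v
    proof (cases "v \<in> S")
      case True
      then show ?thesis using F(4) by blast
    next
      case vS: False
      have vt: "v \<in> V - {t}" using v vS t by auto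
      show ?thesis
      proof (cases "nb v \<inter> S = {}")
        case True
        then have "nb v - {t} = nb v" using t by blast
        then have "inj_on c (insert v (nb v))" using bspec[OF c(2) vt] by simp
        moreover have "inj_on F (insert v (nb v)) \<longleftrightarrow> inj_on c (insert v (nb v))"
          by (rule inj_on_cong) (use True vS F(1) in auto)
        ultimately show ?thesis by simp
      next
        case False
        then obtain p where p: "p \<in> nb v" "p \<in> S" by blast
        then have vp: "v \<in> nb p - S" using vS nb_sym by blast
        have only: "q = p" if "q \<in> nb v" "q \<in> S" for q
          using outer p(2) that(2) vp nb_sym[OF that(1)] by blast
        let ?X = "insert v (nb v - {p})"
        have X: "x \<notin> S" if "x \<in> ?X" for x using that only vS by blast
        \<comment> \<open>\<open>?X\<close> contains no vertex of \<open>S\<close>, in particular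
          not \<open>t\<close>, so \<open>c\<close> is known to be injective on it.\<close>
        have "?X \<subseteq> insert v (nb v - {t})" using X t by blast
        then have "inj_on c ?X" using inj_on_subset[OF bspec[OF c(2) vt]] by blast
        moreover have cX: "F x = c x" if "x \<in> ?X" for x using X[OF that] F(1) by simp
        have "inj_on F ?X \<longleftrightarrow> inj_on c ?X" by (rule inj_on_cong) (rule cX)
        ultimately have "inj_on F ?X" by blast
        moreover have "F ` ?X = c ` ?X" using cX by (rule image_cong[OF refl])
        then have "F p \<notin> F ` ?X" using F(3) p(2) vp by (auto simp: avail_def)
        ultimately have "inj_on F (insert p ?X)" unfolding inj_on_insert[of F p ?X] by blast
        moreover have "insert p ?X = insert v (nb v)" using p(1) by blast
        ultimately show ?thesis by simp
      qed
    qed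
    moreover have "\<forall>v\<in>V. F v \<in> colours" using F(1,2) c(1) by metis
    ultimately show False using not_colourable by blast
  qed
  then show ?thesis by blast
qed


section \<open>Reducible configurations\<close>

lemma card_colours_Diff1: "5 \<le> card (colours - {a})"
  using diff_card_le_card_Diff[of "{a}" colours] by simp

lemma card_colours_Diff2: "4 \<le> card (colours - {a, b})"
proof -
  have "card {a, b} \<le> 2" by (simp add: card_insert_if)
  then show ?thesis using diff_card_le_card_Diff[of "{a, b}" colours] by simp
qed

lemma min_degree_two:
  assumes v: "v \<in> V"
  shows "2 \<le> card (nb v)"
proof (rule ccontr)
  assume "\<not> 2 \<le> card (nb v)"
  then have "\<exists>a. nb v \<subseteq> {a}"
    by (metis One_nat_def card_1_singletonE card_eq_0_iff empty_subsetI finite_nb less_2_cases not_le subset_refl)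
  then obtain a where a: "nb v \<subseteq> {a}" by blast
  have SV: "{v} \<subseteq> V" "{v} \<noteq> {}" using v by auto
  have outer: "\<forall>p\<in>{v}. \<forall>q\<in>{v}. \<forall>m\<in>nb p - {v}. m \<in> nb q \<longrightarrow>
    p = q" by simp
  obtain c where c: "stuck {v} c" using recolour[OF SV outer] ..
  \<comment> \<open>The case \<open>a \<notin> nb v\<close> is that of an isolated vertex, for which
    any colour will do.\<close>
  have "\<exists>k. k \<in> colours \<and> (a \<in> nb v \<longrightarrow> k \<in> avail c v a)"
  proof (cases "a \<in> nb v")
    case True
    then show ?thesis using ex_not_in_list[of "[]" "avail c v a"] avail_card2[OF True, of c] by (auto simp: avail_iff)
  next
    case False
    then show ?thesis by (intro exI[of _ 1]) (simp add: colours_def)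
  qed
  then obtain k where k: "k \<in> colours" "a \<in> nb v \<longrightarrow> k \<in> avail c v a" by blast
  show False
  proof (rule stuckD[OF c, of "c(v := k)"])
    show "(c(v := k)) p \<in> avail c p m" if "p \<in> {v}" "m \<in> nb p - {v}" for p m
      using that a k by auto
    show "inj_on (c(v := k)) (insert m (nb m))" if "m \<in> {v}" for m
    proof -
      have "nb v = {} \<or> nb v = {a}" using a by blast
      then show ?thesis using that k(2) nb_irrefl[of v] by (auto simp: avail_iff)
    qed
  qed (use k(1) in auto)
qed

text \<open>Pattern of the lemmas below: \<open>walk_to\<close> separates the vertices,
  \<open>S\<close> is recoloured, and \<open>F\<close> is the new colouring. Here \<open>y\<close>
  avoids \<open>c a\<close> besides its list conditions; the third colour at \<open>x\<close>, due
  to \<open>deg\<close>, allows \<open>x\<close> to avoid both \<open>c b\<close> and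
  \<open>ky\<close>.\<close>

lemma reducible_two_two_three:
  assumes nb: "nb x = {a, y}" "nb y = {x, b}"
    and d: "a \<noteq> y" "x \<noteq> b"
    and deg: "card (nb a) \<le> 3"
  shows False
proof -
  have dist: "distinct [x, y, a, b]"
  proof (rule distinct_by_walks[of x])
    have "walk_to x x = []" "walk_to x y = [y]" "walk_to x a = [a]" "walk_to x b = [y, b]"
      using walk_to_eq[of x "[]"] walk_to_eq[of x "[y]"] walk_to_eq[of x "[a]"] walk_to_eq[of x "[y, b]"] nb d
        by simp_all
    then show "distinct (map (walk_to x) [x, y, a, b])"
      using d by auto
  qed
  define S where "S = {x, y}"
  have SV: "S \<subseteq> V" "S \<noteq> {}"
    using nb_V[of x] nb_V[of y] nb by (auto simp: S_def)
  have outer: "\<forall>p\<in>S. \<forall>q\<in>S. \<forall>m\<in>nb p - S. m \<in> nb q \<longrightarrow> p = q"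
    using dist unfolding S_def by (auto simp: nb)
  obtain c where c: "stuck S c" using recolour[OF SV outer] by blast
  have L: "3 \<le> card (avail c x a)" "2 \<le> card (avail c y b)"
    using deg by (auto simp: nb intro: avail_card2 avail_card3)
  obtain ky where ky: "ky \<in> avail c y b" "ky \<notin> set [c a]" using ex_not_in_list[of "[c a]"
    "avail c y b"] L by auto
  obtain kx where kx: "kx \<in> avail c x a" "kx \<notin> set [c b, ky]" using ex_not_in_list[of "[c b, ky]"
    "avail c x a"] L by auto
  note k = kx ky
  define F where "F = c(x := kx, y := ky)"
  have F: "F x = kx" "F y = ky" "F a = c a" "F b = c b"
    using dist by (auto simp: F_def)
  have ne: "kx \<noteq> c a" "ky \<noteq> c b"
    using k by (simp_all add: avail_iff)
  have I: "inj_on F (insert x (nb x))" "inj_on F (insert y (nb y))"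
    using k ne dist by (auto simp: nb F insert_Diff_if)
  show False
  proof (rule stuckD[OF c, of F])
    show "F x = c x" if "x \<notin> S" for x using that by (auto simp: F_def S_def)
    show "F p \<in> colours" if "p \<in> S" for p
      using that k unfolding S_def by (auto simp: F avail_iff)
    show "F p \<in> avail c p m" if "p \<in> S" "m \<in> nb p - S" for p m
      using that dist k unfolding S_def by (auto simp: F nb)
    show "inj_on F (insert m (nb m))" if "m \<in> S" for m
      using that I unfolding S_def by blast
  qed
qed

text \<open>The only outer vertex at distance 2 from the centre is \<open>e4\<close>, so the centre
  has five colours. In the same way \<open>x1\<close>, \<open>x2\<close>, \<open>x3\<close> have to
  avoid the colours of \<open>z1\<close>, \<open>z2\<close>, \<open>z3\<close>.\<close>

lemma reducible_three_threads:
  assumes nb: "nb w = {x1, x2, x3, x4}" "nb x1 = {w, y1}" "nb x2 = {w, y2}" "nb x3 = {w, y3}" "nb x4 = {w, e4}"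
    "nb y1 = {x1, z1}" "nb y2 = {x2, z2}" "nb y3 = {x3, z3}"
    and d: "distinct [x1, x2, x3, x4]" "w \<noteq> y1" "w \<noteq> y2" "w \<noteq> y3" "w \<noteq> e4"
      "x1 \<noteq> z1" "x2 \<noteq> z2" "x3 \<noteq> z3"
  shows False
proof -
  have dist: "distinct [w, x1, x2, x3, x4, y1, y2, y3, z1, z2, z3, e4]"
  proof (rule distinct_by_walks[of w])
    have "walk_to w w = []" "walk_to w x1 = [x1]" "walk_to w x2 = [x2]" "walk_to w x3 = [x3]"
      "walk_to w x4 = [x4]" "walk_to w y1 = [x1, y1]" "walk_to w y2 = [x2, y2]" "walk_to w y3 = [x3, y3]"
      "walk_to w z1 = [x1, y1, z1]" "walk_to w z2 = [x2, y2, z2]" "walk_to w z3 = [x3, y3, z3]"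
      "walk_to w e4 = [x4, e4]"
      using walk_to_eq[of w "[]"] walk_to_eq[of w "[x1]"] walk_to_eq[of w "[x2]"] walk_to_eq[of w "[x3]"]
        walk_to_eq[of w "[x4]"] walk_to_eq[of w "[x1, y1]"] walk_to_eq[of w "[x2, y2]"] walk_to_eq[of w
        "[x3, y3]"] walk_to_eq[of w "[x1, y1, z1]"] walk_to_eq[of w "[x2, y2, z2]"] walk_to_eq[of w
        "[x3, y3, z3]"] walk_to_eq[of w "[x4, e4]"] nb d by simp_all
    then show "distinct (map (walk_to w) [w, x1, x2, x3, x4, y1, y2, y3, z1, z2, z3, e4])"
      using d by auto
  qed
  define S where "S = {w, x1, x2, x3, x4, y1, y2, y3}"
  have SV: "S \<subseteq> V" "S \<noteq> {}"
    using nb_V[of w] nb_V[of x1] nb_V[of x2] nb_V[of x3] nb_V[of x4] nb_V[of y1] nb_V[of y2] nb_V[of y3] nb by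
      (auto simp: S_def)
  have outer: "\<forall>p\<in>S. \<forall>q\<in>S. \<forall>m\<in>nb p - S. m \<in> nb q \<longrightarrow> p = q"
    using dist unfolding S_def by (auto simp: nb)
  obtain c where c: "stuck S c" using recolour[OF SV outer] by blast
  have L: "2 \<le> card (avail c x4 e4)" "2 \<le> card (avail c y1 z1)" "2 \<le> card (avail c y2 z2)"
    "2 \<le> card (avail c y3 z3)"
    by (auto simp: nb intro: avail_card2)
  obtain kw k1 k2 k3 k4 l1 l2 l3 where k: "kw \<in> colours - {c e4}" "k4 \<in> avail c x4 e4"
    "{k1, k2, k3} \<subseteq> colours"
    "distinct [kw, k1, k2, k3, k4]" "k1 \<noteq> c z1" "k2 \<noteq> c z2" "k3 \<noteq> c z3"
      "l1 \<in> avail c y1 z1" "l2 \<in> avail c y2 z2"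
    "l3 \<in> avail c y3 z3" "l1 \<notin> {k1, kw}" "l2 \<notin> {k2, kw}" "l3 \<notin> {k3, kw}"
    using choice_three_threads[OF card_colours_Diff1[of "c e4"] L] .
  define F where "F = c(w := kw, x1 := k1, x2 := k2, x3 := k3, x4 := k4, y1 := l1, y2 := l2, y3 := l3)"
  have F: "F w = kw" "F x1 = k1" "F x2 = k2" "F x3 = k3" "F x4 = k4" "F y1 = l1" "F y2 = l2" "F y3 = l3"
    "F z1 = c z1" "F z2 = c z2" "F z3 = c z3" "F e4 = c e4"
    using dist by (auto simp: F_def)
  have ne: "k4 \<noteq> c e4" "l1 \<noteq> c z1" "l2 \<noteq> c z2" "l3 \<noteq> c z3"
    using k by (simp_all add: avail_iff)
  have I: "inj_on F (insert w (nb w))" "inj_on F (insert x1 (nb x1))" "inj_on F (insert x2 (nb x2))"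
    "inj_on F (insert x3 (nb x3))" "inj_on F (insert x4 (nb x4))" "inj_on F (insert y1 (nb y1))"
    "inj_on F (insert y2 (nb y2))" "inj_on F (insert y3 (nb y3))"
    using k ne dist by (auto simp: nb F insert_Diff_if)
  show False
  proof (rule stuckD[OF c, of F])
    show "F x = c x" if "x \<notin> S" for x using that by (auto simp: F_def S_def)
    show "F p \<in> colours" if "p \<in> S" for p
      using that k unfolding S_def by (auto simp: F avail_iff)
    show "F p \<in> avail c p m" if "p \<in> S" "m \<in> nb p - S" for p m
      using that dist k unfolding S_def by (auto simp: F nb)
    show "inj_on F (insert m (nb m))" if "m \<in> S" for m
      using that I unfolding S_def by blast
  qed
qed

text \<open>\<open>S\<close> reaches beyond \<open>v\<close> to \<open>u1\<close> and
  \<open>u2\<close>, so from outside \<open>v\<close> is restricted only by \<open>c f1\<close> and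
  \<open>c f2\<close>. The hypothesis \<open>deg\<close> yields the third colour for
  \<open>u1\<close> that \<open>choice_two_threads_half\<close> asks for.\<close>

lemma reducible_two_threads_half:
  assumes nb: "nb w = {x1, x2, x3, v}" "nb x1 = {w, e1}" "nb x2 = {w, y2}" "nb x3 = {w, y3}" "nb y2 = {x2, z2}"
    "nb y3 = {x3, z3}" "nb v = {w, u1, u2}" "nb u1 = {v, f1}" "nb u2 = {v, f2}"
    and d: "distinct [x1, x2, x3, v]" "w \<noteq> e1" "w \<noteq> y2" "w \<noteq> y3" "x2 \<noteq> z2"
      "x3 \<noteq> z3" "distinct [w, u1, u2]" "v \<noteq> f1" "v \<noteq> f2"
    and deg: "card (nb f1) \<le> 3"
  shows False
proof -
  have dist: "distinct [w, x1, x2, x3, v, u1, u2, y2, y3, z2, z3, e1, f1, f2]"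
  proof (rule distinct_by_walks[of w])
    have "walk_to w w = []" "walk_to w x1 = [x1]" "walk_to w x2 = [x2]" "walk_to w x3 = [x3]"
      "walk_to w v = [v]" "walk_to w u1 = [v, u1]" "walk_to w u2 = [v, u2]" "walk_to w y2 = [x2, y2]"
      "walk_to w y3 = [x3, y3]" "walk_to w z2 = [x2, y2, z2]" "walk_to w z3 = [x3, y3, z3]"
      "walk_to w e1 = [x1, e1]" "walk_to w f1 = [v, u1, f1]" "walk_to w f2 = [v, u2, f2]"
      using walk_to_eq[of w "[]"] walk_to_eq[of w "[x1]"] walk_to_eq[of w "[x2]"] walk_to_eq[of w "[x3]"]
        walk_to_eq[of w "[v]"] walk_to_eq[of w "[v, u1]"] walk_to_eq[of w "[v, u2]"] walk_to_eq[of w "[x2, y2]"]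
        walk_to_eq[of w "[x3, y3]"] walk_to_eq[of w "[x2, y2, z2]"] walk_to_eq[of w "[x3, y3, z3]"]
        walk_to_eq[of w "[x1, e1]"] walk_to_eq[of w "[v, u1, f1]"] walk_to_eq[of w "[v, u2, f2]"] nb d by
        simp_all
    then show "distinct (map (walk_to w) [w, x1, x2, x3, v, u1, u2, y2, y3, z2, z3, e1, f1, f2])"
      using d by auto
  qed
  define S where "S = {w, x1, x2, x3, v, u1, u2, y2, y3}"
  have SV: "S \<subseteq> V" "S \<noteq> {}"
    using nb_V[of w] nb_V[of x1] nb_V[of x2] nb_V[of x3] nb_V[of y2] nb_V[of y3] nb_V[of v] nb_V[of u1] nb_V[of
      u2] nb by (auto simp: S_def)
  have outer: "\<forall>p\<in>S. \<forall>q\<in>S. \<forall>m\<in>nb p - S. m \<in> nb q \<longrightarrow> p = q"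
    using dist unfolding S_def by (auto simp: nb)
  obtain c where c: "stuck S c" using recolour[OF SV outer] by blast
  have L: "2 \<le> card (avail c x1 e1)" "2 \<le> card (avail c y2 z2)" "2 \<le> card (avail c y3 z3)"
    "3 \<le> card (avail c u1 f1)" "2 \<le> card (avail c u2 f2)"
    using deg by (auto simp: nb intro: avail_card2 avail_card3)
  obtain kw k1 k2 k3 kv m1 m2 l2 l3 where k: "kw \<in> colours - {c e1}" "k1 \<in> avail c x1 e1"
    "{k2, k3} \<subseteq> colours"
    "kv \<in> colours - {c f1, c f2}" "m1 \<in> avail c u1 f1" "m2 \<in> avail c u2 f2"
    "distinct [kw, k1, k2, k3, kv]" "distinct [kv, kw, m1, m2]" "k2 \<noteq> c z2" "k3 \<noteq> c z3"
    "l2 \<in> avail c y2 z2" "l3 \<in> avail c y3 z3" "l2 \<notin> {k2, kw}" "l3 \<notin> {k3, kw}"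
    using choice_two_threads_half[OF card_colours_Diff1[of "c e1"] card_colours_Diff2[of "c f1" "c f2"]
      L(4,5,1,2,3)] .
  define F where "F = c(w := kw, x1 := k1, x2 := k2, x3 := k3, v := kv, u1 := m1, u2 := m2, y2 := l2, y3 := l3)"
  have F: "F w = kw" "F x1 = k1" "F x2 = k2" "F x3 = k3" "F v = kv" "F u1 = m1" "F u2 = m2" "F y2 = l2"
    "F y3 = l3" "F z2 = c z2" "F z3 = c z3" "F e1 = c e1" "F f1 = c f1" "F f2 = c f2"
    using dist by (auto simp: F_def)
  have ne: "k1 \<noteq> c e1" "l2 \<noteq> c z2" "l3 \<noteq> c z3" "m1 \<noteq> c f1" "m2 \<noteq> c f2"
    using k by (simp_all add: avail_iff)
  have I: "inj_on F (insert w (nb w))" "inj_on F (insert x1 (nb x1))" "inj_on F (insert x2 (nb x2))"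
    "inj_on F (insert x3 (nb x3))" "inj_on F (insert v (nb v))" "inj_on F (insert u1 (nb u1))"
    "inj_on F (insert u2 (nb u2))" "inj_on F (insert y2 (nb y2))" "inj_on F (insert y3 (nb y3))"
    using k ne dist by (auto simp: nb F insert_Diff_if)
  show False
  proof (rule stuckD[OF c, of F])
    show "F x = c x" if "x \<notin> S" for x using that by (auto simp: F_def S_def)
    show "F p \<in> colours" if "p \<in> S" for p
      using that k unfolding S_def by (auto simp: F avail_iff)
    show "F p \<in> avail c p m" if "p \<in> S" "m \<in> nb p - S" for p m
      using that dist k unfolding S_def by (auto simp: F nb)
    show "inj_on F (insert m (nb m))" if "m \<in> S" for m
      using that I unfolding S_def by blast
  qed
qed

lemma reducible_two_threads_three:
  assumes nb: "nb w = {x1, x2, x3, x4}" "nb x1 = {w, e1}" "nb x2 = {w, e2}" "nb x3 = {w, y3}" "nb x4 = {w, y4}"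
    "nb y3 = {x3, z3}" "nb y4 = {x4, z4}"
    and d: "distinct [x1, x2, x3, x4]" "w \<noteq> e1" "w \<noteq> e2" "w \<noteq> y3" "w \<noteq> y4"
      "x3 \<noteq> z3" "x4 \<noteq> z4"
    and deg: "card (nb e1) \<le> 3"
  shows False
proof -
  have dist: "distinct [w, x1, x2, x3, x4, y3, y4, z3, z4, e1, e2]"
  proof (rule distinct_by_walks[of w])
    have "walk_to w w = []" "walk_to w x1 = [x1]" "walk_to w x2 = [x2]" "walk_to w x3 = [x3]"
      "walk_to w x4 = [x4]" "walk_to w y3 = [x3, y3]" "walk_to w y4 = [x4, y4]" "walk_to w z3 = [x3, y3, z3]"
      "walk_to w z4 = [x4, y4, z4]" "walk_to w e1 = [x1, e1]" "walk_to w e2 = [x2, e2]"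
      using walk_to_eq[of w "[]"] walk_to_eq[of w "[x1]"] walk_to_eq[of w "[x2]"] walk_to_eq[of w "[x3]"]
        walk_to_eq[of w "[x4]"] walk_to_eq[of w "[x3, y3]"] walk_to_eq[of w "[x4, y4]"] walk_to_eq[of w
        "[x3, y3, z3]"] walk_to_eq[of w "[x4, y4, z4]"] walk_to_eq[of w "[x1, e1]"] walk_to_eq[of w "[x2, e2]"]
        nb d by simp_all
    then show "distinct (map (walk_to w) [w, x1, x2, x3, x4, y3, y4, z3, z4, e1, e2])"
      using d by auto
  qed
  define S where "S = {w, x1, x2, x3, x4, y3, y4}"
  have SV: "S \<subseteq> V" "S \<noteq> {}"
    using nb_V[of w] nb_V[of x1] nb_V[of x2] nb_V[of x3] nb_V[of x4] nb_V[of y3] nb_V[of y4] nb by (auto simp: S_def)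
  have outer: "\<forall>p\<in>S. \<forall>q\<in>S. \<forall>m\<in>nb p - S. m \<in> nb q \<longrightarrow> p = q"
    using dist unfolding S_def by (auto simp: nb)
  obtain c where c: "stuck S c" using recolour[OF SV outer] by blast
  have L: "3 \<le> card (avail c x1 e1)" "2 \<le> card (avail c x2 e2)" "2 \<le> card (avail c y3 z3)"
    "2 \<le> card (avail c y4 z4)"
    using deg by (auto simp: nb intro: avail_card2 avail_card3)
  obtain kw k1 k2 k3 k4 l3 l4 where k: "kw \<in> colours - {c e1, c e2}" "k1 \<in> avail c x1 e1"
    "k2 \<in> avail c x2 e2"
    "{k3, k4} \<subseteq> colours" "distinct [kw, k1, k2, k3, k4]" "k3 \<noteq> c z3" "k4 \<noteq> c z4"
    "l3 \<in> avail c y3 z3" "l4 \<in> avail c y4 z4" "l3 \<notin> {k3, kw}" "l4 \<notin> {k4, kw}"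
    using choice_two_threads_three[OF card_colours_Diff2[of "c e1" "c e2"] L] .
  define F where "F = c(w := kw, x1 := k1, x2 := k2, x3 := k3, x4 := k4, y3 := l3, y4 := l4)"
  have F: "F w = kw" "F x1 = k1" "F x2 = k2" "F x3 = k3" "F x4 = k4" "F y3 = l3" "F y4 = l4" "F z3 = c z3"
    "F z4 = c z4" "F e1 = c e1" "F e2 = c e2"
    using dist by (auto simp: F_def)
  have ne: "k1 \<noteq> c e1" "k2 \<noteq> c e2" "l3 \<noteq> c z3" "l4 \<noteq> c z4"
    using k by (simp_all add: avail_iff)
  have I: "inj_on F (insert w (nb w))" "inj_on F (insert x1 (nb x1))" "inj_on F (insert x2 (nb x2))"
    "inj_on F (insert x3 (nb x3))" "inj_on F (insert x4 (nb x4))" "inj_on F (insert y3 (nb y3))"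
    "inj_on F (insert y4 (nb y4))"
    using k ne dist by (auto simp: nb F insert_Diff_if)
  show False
  proof (rule stuckD[OF c, of F])
    show "F x = c x" if "x \<notin> S" for x using that by (auto simp: F_def S_def)
    show "F p \<in> colours" if "p \<in> S" for p
      using that k unfolding S_def by (auto simp: F avail_iff)
    show "F p \<in> avail c p m" if "p \<in> S" "m \<in> nb p - S" for p m
      using that dist k unfolding S_def by (auto simp: F nb)
    show "inj_on F (insert m (nb m))" if "m \<in> S" for m
      using that I unfolding S_def by blast
  qed
qed

text \<open>The vertex \<open>u\<close> and its neighbours \<open>y\<close>, \<open>y'\<close> are
  coloured last. \<open>choice_bad\<close> reduces them to the pairs \<open>P\<close> and
  \<open>Q\<close>, so the colours around the centre are chosen without looking at them.\<close>

lemma reducible_four_bad_three: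
  assumes nb: "nb w = {x1, x2, x3, x4}" "nb x1 = {w, u}" "nb u = {x1, y, y'}" "nb y = {u, z}" "nb y' = {u, z'}"
    "nb x2 = {w, e2}" "nb x3 = {w, e3}" "nb x4 = {w, y4}" "nb y4 = {x4, z4}"
    and d: "distinct [x1, x2, x3, x4]" "w \<noteq> u" "distinct [x1, y, y']" "u \<noteq> z" "u \<noteq> z'"
      "w \<noteq> e2" "w \<noteq> e3" "w \<noteq> y4" "x4 \<noteq> z4"
    and deg: "card (nb e2) \<le> 3"
  shows False
proof -
  have dist: "distinct [w, x1, x2, x3, x4, u, y, y', y4, z, z', e2, e3, z4]"
  proof (rule distinct_by_walks[of w])
    have "walk_to w w = []" "walk_to w x1 = [x1]" "walk_to w x2 = [x2]" "walk_to w x3 = [x3]"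
      "walk_to w x4 = [x4]" "walk_to w u = [x1, u]" "walk_to w y = [x1, u, y]" "walk_to w y' = [x1, u, y']"
      "walk_to w y4 = [x4, y4]" "walk_to w z = [x1, u, y, z]" "walk_to w z' = [x1, u, y', z']"
      "walk_to w e2 = [x2, e2]" "walk_to w e3 = [x3, e3]" "walk_to w z4 = [x4, y4, z4]"
      using walk_to_eq[of w "[]"] walk_to_eq[of w "[x1]"] walk_to_eq[of w "[x2]"] walk_to_eq[of w "[x3]"]
        walk_to_eq[of w "[x4]"] walk_to_eq[of w "[x1, u]"] walk_to_eq[of w "[x1, u, y]"] walk_to_eq[of w
        "[x1, u, y']"] walk_to_eq[of w "[x4, y4]"] walk_to_eq[of w "[x1, u, y, z]"] walk_to_eq[of w
        "[x1, u, y', z']"] walk_to_eq[of w "[x2, e2]"] walk_to_eq[of w "[x3, e3]"] walk_to_eq[of w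
        "[x4, y4, z4]"] nb d by simp_all
    then show "distinct (map (walk_to w) [w, x1, x2, x3, x4, u, y, y', y4, z, z', e2, e3, z4])"
      using d by auto
  qed
  define S where "S = {w, x1, x2, x3, x4, u, y, y', y4}"
  have SV: "S \<subseteq> V" "S \<noteq> {}"
    using nb_V[of w] nb_V[of x1] nb_V[of u] nb_V[of y] nb_V[of y'] nb_V[of x2] nb_V[of x3] nb_V[of x4] nb_V[of
      y4] nb by (auto simp: S_def)
  have outer: "\<forall>p\<in>S. \<forall>q\<in>S. \<forall>m\<in>nb p - S. m \<in> nb q \<longrightarrow> p = q"
    using dist unfolding S_def by (auto simp: nb)
  obtain c where c: "stuck S c" using recolour[OF SV outer] by blast
  have L: "2 \<le> card (avail c y z)" "2 \<le> card (avail c y' z')" "3 \<le> card (avail c x2 e2)"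
    "2 \<le> card (avail c x3 e3)" "2 \<le> card (avail c y4 z4)"
    using deg by (auto simp: nb intro: avail_card2 avail_card3)
  obtain P Q where PQ: "card P = 2" "card Q = 2" "P \<inter> Q = {}" "P \<subseteq> colours" "Q \<subseteq> colours"
    and branch: "\<And>w x. x \<notin> P \<Longrightarrow> {w, x} \<noteq> Q \<Longrightarrow> \<exists>k l l'.
      k \<in> colours - {c z, c z'} \<and> l \<in> avail c y z \<and>
      l' \<in> avail c y' z' \<and> k \<notin> {w, x, l, l'} \<and> l \<noteq> l' \<and> l \<noteq> x \<and> l'
        \<noteq> x"
  proof (rule choice_bad[OF card_colours_Diff2 L(1,2)])
    fix P Q assume h: "card P = 2" "card Q = 2" "P \<inter> Q = {}"
      "P \<subseteq> avail c y z \<union> avail c y' z'" "Q \<subseteq> colours - {c z, c z'}"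
      and *: "\<And>w x. x \<notin> P \<Longrightarrow> {w, x} \<noteq> Q \<Longrightarrow> \<exists>k l l'. k
        \<in> colours - {c z, c z'} \<and> l \<in> avail c y z \<and>
      l' \<in> avail c y' z' \<and> k \<notin> {w, x, l, l'} \<and> l \<noteq> l' \<and> l \<noteq> x \<and> l'
        \<noteq> x"
    have "P \<subseteq> colours" "Q \<subseteq> colours" using h(4,5) unfolding avail_def by blast+
    then show thesis by (rule that[OF h(1,2,3) _ _ *])
  qed
  obtain kw k1 k2 k3 k4 l4 where k0: "kw \<in> colours - {c e2, c e3}" "{k1, k4} \<subseteq> colours"
    "k2 \<in> avail c x2 e2"
    "k3 \<in> avail c x3 e3" "distinct [kw, k1, k2, k3, k4]" "k1 \<notin> P" "{kw, k1} \<noteq> Q"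
      "k4 \<noteq> c z4" "l4 \<in> avail c y4 z4" "l4 \<notin> {k4, kw}"
    using choice_four_bad_three[OF card_colours_Diff2[of "c e2" "c e3"] L(3,4,5) PQ] .
  obtain ku l l' where l: "ku \<in> colours - {c z, c z'}" "l \<in> avail c y z" "l' \<in> avail c y' z'"
    "ku \<notin> {kw, k1, l, l'}" "l \<noteq> l'"
    "l \<noteq> k1" "l' \<noteq> k1" using branch[OF k0(6,7)] by blast
  note k = k0(1-5,8-10) l
  define F where "F = c(w := kw, x1 := k1, x2 := k2, x3 := k3, x4 := k4, u := ku, y := l, y' := l', y4 := l4)"
  have F: "F w = kw" "F x1 = k1" "F x2 = k2" "F x3 = k3" "F x4 = k4" "F u = ku" "F y = l" "F y' = l'"
    "F y4 = l4" "F z = c z" "F z' = c z'" "F e2 = c e2" "F e3 = c e3" "F z4 = c z4"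
    using dist by (auto simp: F_def)
  have ne: "l \<noteq> c z" "l' \<noteq> c z'" "k2 \<noteq> c e2" "k3 \<noteq> c e3" "l4 \<noteq> c z4"
    using k by (simp_all add: avail_iff)
  have I: "inj_on F (insert w (nb w))" "inj_on F (insert x1 (nb x1))" "inj_on F (insert x2 (nb x2))"
    "inj_on F (insert x3 (nb x3))" "inj_on F (insert x4 (nb x4))" "inj_on F (insert u (nb u))"
    "inj_on F (insert y (nb y))" "inj_on F (insert y' (nb y'))" "inj_on F (insert y4 (nb y4))"
    using k ne dist by (auto simp: nb F insert_Diff_if)
  show False
  proof (rule stuckD[OF c, of F])
    show "F x = c x" if "x \<notin> S" for x using that by (auto simp: F_def S_def)
    show "F p \<in> colours" if "p \<in> S" for p
      using that k unfolding S_def by (auto simp: F avail_iff)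
    show "F p \<in> avail c p m" if "p \<in> S" "m \<in> nb p - S" for p m
      using that dist k unfolding S_def by (auto simp: F nb)
    show "inj_on F (insert m (nb m))" if "m \<in> S" for m
      using that I unfolding S_def by blast
  qed
qed

lemma reducible_bad_bad_three:
  assumes nb: "nb w = {x1, x2, x3}" "nb x1 = {w, u}" "nb u = {x1, y, y'}" "nb y = {u, z}" "nb y' = {u, z'}"
    "nb x2 = {w, e2}" "nb x3 = {w, e3}"
    and d: "distinct [x1, x2, x3]" "w \<noteq> u" "distinct [x1, y, y']" "u \<noteq> z" "u \<noteq> z'"
      "w \<noteq> e2" "w \<noteq> e3"
    and deg: "card (nb e2) \<le> 3"
  shows False
proof -
  have dist: "distinct [w, x1, x2, x3, u, y, y', z, z', e2, e3]"
  proof (rule distinct_by_walks[of w])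
    have "walk_to w w = []" "walk_to w x1 = [x1]" "walk_to w x2 = [x2]" "walk_to w x3 = [x3]"
      "walk_to w u = [x1, u]" "walk_to w y = [x1, u, y]" "walk_to w y' = [x1, u, y']"
      "walk_to w z = [x1, u, y, z]" "walk_to w z' = [x1, u, y', z']" "walk_to w e2 = [x2, e2]"
      "walk_to w e3 = [x3, e3]"
      using walk_to_eq[of w "[]"] walk_to_eq[of w "[x1]"] walk_to_eq[of w "[x2]"] walk_to_eq[of w "[x3]"]
        walk_to_eq[of w "[x1, u]"] walk_to_eq[of w "[x1, u, y]"] walk_to_eq[of w "[x1, u, y']"] walk_to_eq[of w
        "[x1, u, y, z]"] walk_to_eq[of w "[x1, u, y', z']"] walk_to_eq[of w "[x2, e2]"] walk_to_eq[of w
        "[x3, e3]"] nb d by simp_all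
    then show "distinct (map (walk_to w) [w, x1, x2, x3, u, y, y', z, z', e2, e3])"
      using d by auto
  qed
  define S where "S = {w, x1, x2, x3, u, y, y'}"
  have SV: "S \<subseteq> V" "S \<noteq> {}"
    using nb_V[of w] nb_V[of x1] nb_V[of u] nb_V[of y] nb_V[of y'] nb_V[of x2] nb_V[of x3] nb by (auto simp: S_def)
  have outer: "\<forall>p\<in>S. \<forall>q\<in>S. \<forall>m\<in>nb p - S. m \<in> nb q \<longrightarrow> p = q"
    using dist unfolding S_def by (auto simp: nb)
  obtain c where c: "stuck S c" using recolour[OF SV outer] by blast
  have L: "2 \<le> card (avail c y z)" "2 \<le> card (avail c y' z')" "3 \<le> card (avail c x2 e2)"
    "2 \<le> card (avail c x3 e3)"
    using deg by (auto simp: nb intro: avail_card2 avail_card3)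
  obtain P Q where PQ: "card P = 2" "card Q = 2" "P \<inter> Q = {}" "P \<subseteq> colours" "Q \<subseteq> colours"
    and branch: "\<And>w x. x \<notin> P \<Longrightarrow> {w, x} \<noteq> Q \<Longrightarrow> \<exists>k l l'.
      k \<in> colours - {c z, c z'} \<and> l \<in> avail c y z \<and>
      l' \<in> avail c y' z' \<and> k \<notin> {w, x, l, l'} \<and> l \<noteq> l' \<and> l \<noteq> x \<and> l'
        \<noteq> x"
  proof (rule choice_bad[OF card_colours_Diff2 L(1,2)])
    fix P Q assume h: "card P = 2" "card Q = 2" "P \<inter> Q = {}"
      "P \<subseteq> avail c y z \<union> avail c y' z'" "Q \<subseteq> colours - {c z, c z'}"
      and *: "\<And>w x. x \<notin> P \<Longrightarrow> {w, x} \<noteq> Q \<Longrightarrow> \<exists>k l l'. k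
        \<in> colours - {c z, c z'} \<and> l \<in> avail c y z \<and>
      l' \<in> avail c y' z' \<and> k \<notin> {w, x, l, l'} \<and> l \<noteq> l' \<and> l \<noteq> x \<and> l'
        \<noteq> x"
    have "P \<subseteq> colours" "Q \<subseteq> colours" using h(4,5) unfolding avail_def by blast+
    then show thesis by (rule that[OF h(1,2,3) _ _ *])
  qed
  \<comment> \<open>A fourth neighbour with a thread is invented so that
    \<open>choice_four_bad_three\<close> applies: its list is all of \<open>colours\<close>, and its
    outer colour 0 lies outside \<open>colours\<close>.\<close>
  have K: "2 \<le> card colours" by simp
  obtain kw k1 k2 k3 k4 l4 where k0: "kw \<in> colours - {c e2, c e3}" "{k1, k4} \<subseteq> colours"
    "k2 \<in> avail c x2 e2"
    "k3 \<in> avail c x3 e3" "distinct [kw, k1, k2, k3, k4]" "k1 \<notin> P" "{kw, k1} \<noteq> Q"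
      "k4 \<noteq> 0" "l4 \<in> colours" "l4 \<notin> {k4, kw}"
    using choice_four_bad_three[OF card_colours_Diff2[of "c e2" "c e3"] L(3,4) K PQ] .
  obtain ku l l' where l: "ku \<in> colours - {c z, c z'}" "l \<in> avail c y z" "l' \<in> avail c y' z'"
    "ku \<notin> {kw, k1, l, l'}" "l \<noteq> l'"
    "l \<noteq> k1" "l' \<noteq> k1" using branch[OF k0(6,7)] by blast
  note k = k0(1-5) l
  define F where "F = c(w := kw, x1 := k1, x2 := k2, x3 := k3, u := ku, y := l, y' := l')"
  have F: "F w = kw" "F x1 = k1" "F x2 = k2" "F x3 = k3" "F u = ku" "F y = l" "F y' = l'" "F z = c z"
    "F z' = c z'" "F e2 = c e2" "F e3 = c e3"
    using dist by (auto simp: F_def)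
  have ne: "l \<noteq> c z" "l' \<noteq> c z'" "k2 \<noteq> c e2" "k3 \<noteq> c e3"
    using k by (simp_all add: avail_iff)
  have I: "inj_on F (insert w (nb w))" "inj_on F (insert x1 (nb x1))" "inj_on F (insert x2 (nb x2))"
    "inj_on F (insert x3 (nb x3))" "inj_on F (insert u (nb u))" "inj_on F (insert y (nb y))"
    "inj_on F (insert y' (nb y'))"
    using k ne dist by (auto simp: nb F insert_Diff_if)
  show False
  proof (rule stuckD[OF c, of F])
    show "F x = c x" if "x \<notin> S" for x using that by (auto simp: F_def S_def)
    show "F p \<in> colours" if "p \<in> S" for p
      using that k unfolding S_def by (auto simp: F avail_iff)
    show "F p \<in> avail c p m" if "p \<in> S" "m \<in> nb p - S" for p m
      using that dist k unfolding S_def by (auto simp: F nb)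
    show "inj_on F (insert m (nb m))" if "m \<in> S" for m
      using that I unfolding S_def by blast
  qed
qed

lemma reducible_three_bad_three:
  assumes nb: "nb w = {x1, x2, q}" "nb x1 = {w, u}" "nb u = {x1, y, y'}" "nb y = {u, z}" "nb y' = {u, z'}"
    "nb x2 = {w, e2}"
    and d: "distinct [x1, x2, q]" "w \<noteq> u" "distinct [x1, y, y']" "u \<noteq> z" "u \<noteq> z'" "w \<noteq> e2"
    and deg: "card (nb e2) \<le> 3" "card (nb q) \<le> 3"
  shows False
proof -
  have dist: "distinct [w, x1, x2, u, y, y', z, z', e2, q]"
  proof (rule distinct_by_walks[of w])
    have "walk_to w w = []" "walk_to w x1 = [x1]" "walk_to w x2 = [x2]" "walk_to w u = [x1, u]"
      "walk_to w y = [x1, u, y]" "walk_to w y' = [x1, u, y']" "walk_to w z = [x1, u, y, z]"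
      "walk_to w z' = [x1, u, y', z']" "walk_to w e2 = [x2, e2]" "walk_to w q = [q]"
      using walk_to_eq[of w "[]"] walk_to_eq[of w "[x1]"] walk_to_eq[of w "[x2]"] walk_to_eq[of w "[x1, u]"]
        walk_to_eq[of w "[x1, u, y]"] walk_to_eq[of w "[x1, u, y']"] walk_to_eq[of w "[x1, u, y, z]"]
        walk_to_eq[of w "[x1, u, y', z']"] walk_to_eq[of w "[x2, e2]"] walk_to_eq[of w "[q]"] nb d by simp_all
    then show "distinct (map (walk_to w) [w, x1, x2, u, y, y', z, z', e2, q])"
      using d by auto
  qed
  define S where "S = {w, x1, x2, u, y, y'}"
  have SV: "S \<subseteq> V" "S \<noteq> {}"
    using nb_V[of w] nb_V[of x1] nb_V[of u] nb_V[of y] nb_V[of y'] nb_V[of x2] nb by (auto simp: S_def)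
  have outer: "\<forall>p\<in>S. \<forall>q\<in>S. \<forall>m\<in>nb p - S. m \<in> nb q \<longrightarrow> p = q"
    using dist unfolding S_def by (auto simp: nb)
  obtain c where c: "stuck S c" using recolour[OF SV outer] by blast
  have L: "3 \<le> card (avail c w q)" "2 \<le> card (avail c y z)" "2 \<le> card (avail c y' z')"
    "3 \<le> card (avail c x2 e2)"
    using deg by (auto simp: nb intro: avail_card2 avail_card3)
  obtain P Q where PQ: "card P = 2" "card Q = 2" "P \<inter> Q = {}" "P \<subseteq> colours" "Q \<subseteq> colours"
    and branch: "\<And>w x. x \<notin> P \<Longrightarrow> {w, x} \<noteq> Q \<Longrightarrow> \<exists>k l l'.
      k \<in> colours - {c z, c z'} \<and> l \<in> avail c y z \<and>
      l' \<in> avail c y' z' \<and> k \<notin> {w, x, l, l'} \<and> l \<noteq> l' \<and> l \<noteq> x \<and> l'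
        \<noteq> x"
  proof (rule choice_bad[OF card_colours_Diff2 L(2,3)])
    fix P Q assume h: "card P = 2" "card Q = 2" "P \<inter> Q = {}"
      "P \<subseteq> avail c y z \<union> avail c y' z'" "Q \<subseteq> colours - {c z, c z'}"
      and *: "\<And>w x. x \<notin> P \<Longrightarrow> {w, x} \<noteq> Q \<Longrightarrow> \<exists>k l l'. k
        \<in> colours - {c z, c z'} \<and> l \<in> avail c y z \<and>
      l' \<in> avail c y' z' \<and> k \<notin> {w, x, l, l'} \<and> l \<noteq> l' \<and> l \<noteq> x \<and> l'
        \<noteq> x"
    have "P \<subseteq> colours" "Q \<subseteq> colours" using h(4,5) unfolding avail_def by blast+
    then show thesis by (rule that[OF h(1,2,3) _ _ *])
  qed
  \<comment> \<open>\<open>q\<close> stays outside \<open>S\<close>. As its degree is at most 3 it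
    leaves three colours to the centre, of which \<open>c e2\<close> may take one;
    \<open>c q\<close> becomes the fixed colour \<open>s\<close>.\<close>
  have "2 \<le> card (avail c w q - {c e2})"
    using L(1) diff_card_le_card_Diff[of "{c e2}" "avail c w q"] by simp
  note W = this
  have "c q \<notin> avail c w q - {c e2}" by (simp add: avail_iff)
  from W L(4) this PQ obtain kw k1 k2 where k0: "kw \<in> avail c w q - {c e2}" "k1 \<in> colours"
    "k2 \<in> avail c x2 e2"
    "distinct [kw, k1, k2, c q]" "k1 \<notin> P" "{kw, k1} \<noteq> Q"
    by (rule choice_three_bad_three)
  obtain ku l l' where l: "ku \<in> colours - {c z, c z'}" "l \<in> avail c y z" "l' \<in> avail c y' z'"
    "ku \<notin> {kw, k1, l, l'}" "l \<noteq> l'"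
    "l \<noteq> k1" "l' \<noteq> k1" using branch[OF k0(5,6)] by blast
  note k = k0(1-4) l
  define F where "F = c(w := kw, x1 := k1, x2 := k2, u := ku, y := l, y' := l')"
  have F: "F w = kw" "F x1 = k1" "F x2 = k2" "F u = ku" "F y = l" "F y' = l'" "F z = c z" "F z' = c z'"
    "F e2 = c e2" "F q = c q"
    using dist by (auto simp: F_def)
  have ne: "kw \<noteq> c q" "l \<noteq> c z" "l' \<noteq> c z'" "k2 \<noteq> c e2"
    using k by (simp_all add: avail_iff)
  have I: "inj_on F (insert w (nb w))" "inj_on F (insert x1 (nb x1))" "inj_on F (insert x2 (nb x2))"
    "inj_on F (insert u (nb u))" "inj_on F (insert y (nb y))" "inj_on F (insert y' (nb y'))"
    using k ne dist by (auto simp: nb F insert_Diff_if)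
  show False
  proof (rule stuckD[OF c, of F])
    show "F x = c x" if "x \<notin> S" for x using that by (auto simp: F_def S_def)
    show "F p \<in> colours" if "p \<in> S" for p
      using that k unfolding S_def by (auto simp: F avail_iff)
    show "F p \<in> avail c p m" if "p \<in> S" "m \<in> nb p - S" for p m
      using that dist k unfolding S_def by (auto simp: F nb)
    show "inj_on F (insert m (nb m))" if "m \<in> S" for m
      using that I unfolding S_def by blast
  qed
qed


end

section \<open>Discharging\<close>

lemma enumerate4_sorted:
  fixes f :: "'b \<Rightarrow> nat"
  assumes "card A = 4"
  obtains a b c d where "A = {a, b, c, d}" "distinct [a, b, c, d]" "f a \<le> f b" "f b \<le> f c" "f c \<le> f d"
proof -
  have "finite A" using assms by (metis card.infinite zero_neq_numeral)
  then obtain xs where xs: "set xs = A" "distinct xs" using finite_distinct_list by blast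
  define ys where "ys = sort_key f xs"
  have "length ys = 4" using xs assms distinct_card[of xs] by (simp add: ys_def)
  then obtain a b c d where ys: "ys = [a, b, c, d]"
    by (auto simp: numeral_eq_Suc length_Suc_conv)
  have "sorted (map f ys)" unfolding ys_def by simp
  moreover have "set ys = A" "distinct ys" using xs by (simp_all add: ys_def)
  ultimately show thesis using that[of a b c d] unfolding ys by auto
qed

context critical
begin

abbreviation deg :: "'a \<Rightarrow> nat" where "deg v \<equiv> card (nb v)"

text \<open>Only meaningful for \<open>deg x = 2\<close> and \<open>v \<in> nb x\<close>.\<close>

definition oth :: "'a \<Rightarrow> 'a \<Rightarrow> 'a" where
  "oth x v = (THE y. nb x = {v, y})"

lemma nb_deg2:
  assumes "deg x = 2" "v \<in> nb x"
  shows "nb x = {v, oth x v}" "v \<noteq> oth x v"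
proof -
  obtain a b where ab: "nb x = {a, b}" "a \<noteq> b" using assms(1) card_2_iff by metis
  then obtain y where y: "nb x = {v, y}" "v \<noteq> y" using assms(2) by auto
  have "oth x v = y" unfolding oth_def by (rule the_equality) (use y in \<open>auto simp: doubleton_eq_iff\<close>)
  then show "nb x = {v, oth x v}" "v \<noteq> oth x v" using y by auto
qed

lemma in_V: "u \<in> nb v \<Longrightarrow> u \<in> V" "u \<in> nb v \<Longrightarrow> v \<in> V"
  using nb_V nb_sym by blast+

lemma deg_cases:
  assumes "v \<in> V"
  obtains "deg v = 2" | "deg v = 3" | "deg v = 4"
  using min_degree_two[OF assms] degree[of v] by linarith

lemma oth_oth:
  assumes "deg x = 2" "v \<in> nb x"
  shows "oth x (oth x v) = v" "oth x v \<in> nb x" "x \<in> nb v" "x \<in> nb (oth x v)" "x \<noteq> oth x v"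
proof -
  note n = nb_deg2[OF assms]
  show o: "oth x v \<in> nb x" using n by blast
  have "nb x = {oth x v, oth x (oth x v)}" "oth x v \<noteq> oth x (oth x v)" using nb_deg2[OF assms(1) o] by auto
  then show "oth x (oth x v) = v" using n by (auto simp: doubleton_eq_iff)
  show "x \<in> nb v" "x \<in> nb (oth x v)" using nb_sym o assms(2) by blast+
  show "x \<noteq> oth x v" using nb_irrefl o by metis
qed

definition bad :: "'a \<Rightarrow> bool" where
  "bad u \<longleftrightarrow> deg u = 3 \<and> (\<forall>x\<in>nb u. deg x = 2)"

definition two :: "'a \<Rightarrow> 'a set" where
  "two v = {x \<in> nb v. deg x = 2}"

text \<open>If the other end of a neighbour has degree 3, it may be bad and unable to give 6, so up
  to 8 may be due from \<open>v\<close>. This predicate marks the vertices that draw 4 from each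
  neighbour of degree 4.\<close>

definition half :: "'a \<Rightarrow> bool" where
  "half v \<longleftrightarrow> deg v = 3 \<and> card (two v) = 2 \<and> (\<exists>x\<in>two v. deg (oth x v) = 3)"

text \<open>So at most two vertices of degree 2 follow each other, and both ends of such a path have
  degree 4; these pay the full 12.\<close>

lemma adjacent_twos:
  assumes "deg x = 2" "y \<in> nb x" "deg y = 2"
  shows "deg (oth x y) = 4"
proof (rule ccontr)
  assume n: "deg (oth x y) \<noteq> 4"
  have x: "nb x = {oth x y, y}" "oth x y \<noteq> y" using nb_deg2[OF assms(1,2)] by auto
  have y: "nb y = {x, oth y x}" "x \<noteq> oth y x" using nb_deg2[OF assms(3) nb_sym[OF assms(2)]] by auto
  have "deg (oth x y) \<le> 3" using n degree[of "oth x y"] by linarith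
  then show False using reducible_two_two_three[OF x(1) y(1) x(2) y(2)] by blast
qed

lemma bad_nb:
  assumes "bad u" "x \<in> nb u"
  obtains y y' where "nb u = {x, y, y'}" "distinct [x, y, y']" "nb y = {u, oth y u}" "u \<noteq> oth y u"
    "nb y' = {u, oth y' u}" "u \<noteq> oth y' u"
proof -
  have "card (nb u - {x}) = 2" using assms by (simp add: bad_def)
  then obtain y y' where y: "nb u - {x} = {y, y'}" "y \<noteq> y'" using card_2_iff by metis
  then have nbu: "nb u = {x, y, y'}" "distinct [x, y, y']" using assms(2) by auto
  have d: "deg y = 2" "deg y' = 2" "u \<in> nb y" "u \<in> nb y'" using assms nbu nb_sym[of _ u] by (auto simp:
    bad_def)
  show thesis using that[OF nbu nb_deg2[OF d(1,3)] nb_deg2[OF d(2,4)]] .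
qed

text \<open>Justifies the shares 6, 3, 3 of a bad vertex that faces another bad one: its two
  remaining neighbours have other ends of degree 4, which add 9.\<close>

lemma bad_partner:
  assumes v: "bad v" and x: "x \<in> nb v" "bad (oth x v)" and x2: "x2 \<in> nb v" "x2 \<noteq> x"
  shows "deg (oth x2 v) = 4"
proof (rule ccontr)
  assume n: "deg (oth x2 v) \<noteq> 4"
  have "card (nb v - {x, x2}) = 1" using v x x2 by (simp add: bad_def card_Diff_subset)
  then obtain x3 where x3: "nb v - {x, x2} = {x3}" using card_1_singletonE by blast
  then have nbv: "nb v = {x, x2, x3}" "distinct [x, x2, x3]" using x x2 by auto
  have d: "deg x = 2" "deg x2 = 2" "deg x3 = 2" "v \<in> nb x" "v \<in> nb x2" "v \<in> nb x3"
    using v nbv nb_sym[of _ v] by (auto simp: bad_def)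
  obtain y y' where y: "nb (oth x v) = {x, y, y'}" "distinct [x, y, y']" "nb y = {oth x v, oth y (oth x v)}"
    "oth x v \<noteq> oth y (oth x v)" "nb y' = {oth x v, oth y' (oth x v)}" "oth x v \<noteq> oth y' (oth x v)"
    using bad_nb[OF x(2) oth_oth(4)[OF d(1,4)]] .
  have "deg (oth x2 v) \<le> 3" using n degree[of "oth x2 v"] by linarith
  then show False
    using reducible_bad_bad_three[OF nbv(1) nb_deg2(1)[OF d(1,4)] y(1,3,5) nb_deg2(1)[OF d(2,5)] nb_deg2(1)[OF d(3,6)]
        nbv(2) nb_deg2(2)[OF d(1,4)] y(2,4,6) nb_deg2(2)[OF d(2,5)] nb_deg2(2)[OF d(3,6)]] by blast
qed

text \<open>Serves a vertex of degree 3 with no neighbour of degree 4 to draw from: if one far end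
  is bad, the other has degree 4, so 4 suffices there and 8 is left for the bad side.\<close>

lemma bad_next_to_three:
  assumes nbv: "nb v = {x, x2, q}" "distinct [x, x2, q]" and d: "deg x = 2" "deg x2 = 2" "deg q \<le> 3"
    and x: "bad (oth x v)"
  shows "deg (oth x2 v) = 4"
proof (rule ccontr)
  assume n: "deg (oth x2 v) \<noteq> 4"
  have d': "v \<in> nb x" "v \<in> nb x2" using nbv nb_sym[of _ v] by auto
  obtain y y' where y: "nb (oth x v) = {x, y, y'}" "distinct [x, y, y']" "nb y = {oth x v, oth y (oth x v)}"
    "oth x v \<noteq> oth y (oth x v)" "nb y' = {oth x v, oth y' (oth x v)}" "oth x v \<noteq> oth y' (oth x v)"
    using bad_nb[OF x oth_oth(4)[OF d(1) d'(1)]] .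
  have "deg (oth x2 v) \<le> 3" using n degree[of "oth x2 v"] by linarith
  then show False
    using reducible_three_bad_three[OF nbv(1) nb_deg2(1)[OF d(1) d'(1)] y(1,3,5) nb_deg2(1)[OF d(2) d'(2)]
        nbv(2) nb_deg2(2)[OF d(1) d'(1)] y(2,4,6) nb_deg2(2)[OF d(2) d'(2)] _ d(3)] by blast
qed

text \<open>
  The charge \<open>24 deg v - 60\<close> is \<open>-12\<close>, \<open>12\<close>, \<open>36\<close> for degrees 2, 3, 4, so the two neighbours of a vertex of degree 2
  must give it 12 together. A vertex of degree 3 can afford 6 for two such neighbours, but not for three; a bad
  vertex gives less, and the deficit is covered by the other end of the path, or, if that is a vertex of degree 3
  as well, is passed on to the next vertex of degree 4.
\<close>

definition give :: "'a \<Rightarrow> 'a \<Rightarrow> nat" where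
  "give v x = (if deg x = 2 then
     if deg v = 4 then
       if deg (oth x v) = 2 then 12 else if deg (oth x v) = 4 then 6 else if bad (oth x v) then 9 else 8
     else if deg v = 3 then
       if bad v then if \<exists>y\<in>nb v. bad (oth y v) then if bad (oth x v) then 6 else 3 else 4
       else if card (two v) = 2 then
         if \<exists>q\<in>nb v. deg q = 4 then if half v then 8 else 6
         else if \<not> half v \<or> (\<forall>y\<in>two v. deg (oth y v) = 3) then 6
         else if deg (oth x v) = 3 then 8 else 4
       else 12
     else 0
   else if deg v = 4 \<and> half x then 4 else 0)"

lemma give_four:
  assumes w: "deg w = 4" "x \<in> nb w"
  shows "give w x \<in> {0, 4, 6, 8, 9, 12}" "give w x \<ge> 6 \<Longrightarrow> deg x = 2"
    "give w x \<ge> 8 \<Longrightarrow> deg (oth x w) \<le> 3"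
    "give w x = 9 \<Longrightarrow> bad (oth x w)" "give w x = 12 \<Longrightarrow> deg (oth x w) = 2"
      "give w x = 4 \<Longrightarrow> half x"
  using degree[of "oth x w"] w(1) unfolding give_def by (auto split: if_splits)

lemma half_nb:
  assumes "half v" "w \<in> nb v" "deg w = 4"
  obtains u1 u2 where "nb v = {w, u1, u2}" "distinct [w, u1, u2]" "deg u1 = 2" "deg u2 = 2" "deg (oth u1 v) = 3"
proof -
  obtain u1 where u1: "u1 \<in> nb v" "deg u1 = 2" "deg (oth u1 v) = 3" using assms(1) by (auto simp: half_def
    two_def)
  have "card (two v - {u1}) = 1" using assms(1) u1 by (simp add: half_def two_def)
  then obtain u2 where "two v - {u1} = {u2}" using card_1_singletonE by blast
  then have u2: "u2 \<in> nb v" "deg u2 = 2" "u2 \<noteq> u1" by (auto simp: two_def)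
  have dist: "distinct [w, u1, u2]" using assms(3) u1 u2 by auto
  have "{w, u1, u2} = nb v"
    by (rule card_subset_eq) (use assms u1 u2 dist in \<open>auto simp: half_def\<close>)
  then show thesis using that[of u1 u2] dist u1 u2 by simp
qed

text \<open>If \<open>w\<close> gives more than its surplus 36, the few possible amounts force so
  many large ones that a reducible configuration appears around \<open>w\<close>.\<close>

lemma four_final:
  assumes w: "deg w = 4"
  shows "(\<Sum>x\<in>nb w. give w x) \<le> 36"
proof (rule ccontr)
  assume large: "\<not> (\<Sum>x\<in>nb w. give w x) \<le> 36"
  obtain a b c d where centre: "nb w = {a, b, c, d}" and dist: "distinct [a, b, c, d]"
    and le: "give w a \<le> give w b" "give w b \<le> give w c" "give w c \<le> give w d"
    using enumerate4_sorted[OF w, of "give w"] .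
  have sum: "give w a + give w b + give w c + give w d > 36"
    using large dist unfolding centre by simp
  have n: "a \<in> nb w" "b \<in> nb w" "c \<in> nb w" "d \<in> nb w" using centre by auto
  then have n': "w \<in> nb a" "w \<in> nb b" "w \<in> nb c" "w \<in> nb d" using nb_sym by blast+
  note va = give_four[OF w n(1)] and vb = give_four[OF w n(2)] and vc = give_four[OF w n(3)] and vd =
    give_four[OF w n(4)]
  have two: "nb x = {w, oth x w} \<and> w \<noteq> oth x w" if "x \<in> nb w" "give w x \<ge> 6" for x
    using nb_deg2[OF give_four(2)[OF w that] nb_sym[OF that(1)]] by blast
  have thread: "nb (oth x w) = {x, oth (oth x w) x} \<and> x \<noteq> oth (oth x w) x" if "x \<in> nb w"
    "give w x = 12" for x
  proof -
    have "deg x = 2" using give_four(2)[OF w that(1)] that(2) by simp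
    then have "x \<in> nb (oth x w)" using oth_oth(4) nb_sym[OF that(1)] by blast
    then show ?thesis using nb_deg2[of "oth x w" x] give_four(5)[OF w that] by blast
  qed
  \<comment> \<open>Four amounts of at most 9 do not exceed 36.\<close>
  have d12: "give w d = 12"
    using sum le va(1) vb(1) vc(1) vd(1) by auto
  have d: "nb d = {w, oth d w} \<and> w \<noteq> oth d w"
    "nb (oth d w) = {d, oth (oth d w) d} \<and> d \<noteq> oth (oth d w) d"
    using two[OF n(4)] thread[OF n(4) d12] d12 by simp_all
  show False
  proof (cases "give w c = 12")
    case False
    \<comment> \<open>The other three amounts are at most 9 and exceed 24 together. As only 0, 4, 6,
      8, 9 occur, the largest is 9 and the other two are at least 8.\<close>
    have c9: "give w c = 9" and b8: "give w b \<ge> 8" and a8: "give w a \<ge> 8"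
      using sum le va(1) vb(1) vc(1) False d12 by auto
    have c: "nb c = {w, oth c w} \<and> w \<noteq> oth c w" and b: "nb b = {w, oth b w} \<and> w \<noteq> oth b w"
      and a: "nb a = {w, oth a w} \<and> w \<noteq> oth a w" using two[OF n(3)] two[OF n(2)] two[OF n(1)] c9 b8
        a8 by simp_all
    have "bad (oth c w)" using vc(4) c9 by simp
    moreover have "c \<in> nb (oth c w)" using vc(2) c9 n'(3) oth_oth(4) by simp
    ultimately obtain y y' where y: "nb (oth c w) = {c, y, y'}" "distinct [c, y, y']"
      "nb y = {oth c w, oth y (oth c w)}"
      "oth c w \<noteq> oth y (oth c w)" "nb y' = {oth c w, oth y' (oth c w)}" "oth c w \<noteq> oth y' (oth c w)"
      using bad_nb by metis
    have centre': "nb w = {c, b, a, d}" "distinct [c, b, a, d]" using centre dist by auto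
    show False
      using reducible_four_bad_three[OF centre'(1) conjunct1[OF c] y(1,3,5) conjunct1[OF b] conjunct1[OF a]
        conjunct1[OF d(1)] conjunct1[OF d(2)]
          centre'(2) conjunct2[OF c] y(2,4,6) conjunct2[OF b] conjunct2[OF a] conjunct2[OF d(1)] conjunct2[OF d(2)]
          vb(3)[OF b8]] .
  next
    case c12: True
    then have c: "nb c = {w, oth c w} \<and> w \<noteq> oth c w"
      "nb (oth c w) = {c, oth (oth c w) c} \<and> c \<noteq> oth (oth c w) c"
      using two[OF n(3)] thread[OF n(3)] by simp_all
    \<comment> \<open>Now \<open>a\<close> and \<open>b\<close> receive more than 12 together: the
      larger amount exceeds 6, and the smaller one is positive because no amount exceeds 12.\<close>
    have b8: "give w b \<ge> 8"
      using sum le va(1) vb(1) c12 d12 by auto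
    then have b: "nb b = {w, oth b w} \<and> w \<noteq> oth b w" using two[OF n(2)] by simp
    have "give w a > 0" using sum vb(1) c12 d12 by auto
    then have "give w a \<ge> 6 \<or> give w a = 4" using va(1) by auto
    then consider "give w a \<ge> 6" "give w b = 12" | "give w a \<ge> 6" "give w b \<noteq> 12" |
      "give w a = 4" by blast
    then show False
    proof cases
      case 1
      then have b': "nb (oth b w) = {b, oth (oth b w) b} \<and> b \<noteq> oth (oth b w) b" using thread[OF
        n(2)] by simp
      have a: "nb a = {w, oth a w} \<and> w \<noteq> oth a w" using two[OF n(1)] 1 by simp
      have centre': "nb w = {b, c, d, a}" "distinct [b, c, d, a]" using centre dist by auto
      show False
        using reducible_three_threads[OF centre'(1) conjunct1[OF b] conjunct1[OF c(1)] conjunct1[OF d(1)]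
          conjunct1[OF a] conjunct1[OF b']
            conjunct1[OF c(2)] conjunct1[OF d(2)] centre'(2) conjunct2[OF b] conjunct2[OF c(1)] conjunct2[OF d(1)]
            conjunct2[OF a] conjunct2[OF b'] conjunct2[OF c(2)] conjunct2[OF d(2)]] .
    next
      case 2
      have a: "nb a = {w, oth a w} \<and> w \<noteq> oth a w" using two[OF n(1)] 2 by simp
      have centre': "nb w = {b, a, c, d}" "distinct [b, a, c, d]" using centre dist by auto
      show False
        using reducible_two_threads_three[OF centre'(1) conjunct1[OF b] conjunct1[OF a] conjunct1[OF c(1)]
          conjunct1[OF d(1)]
            conjunct1[OF c(2)] conjunct1[OF d(2)] centre'(2) conjunct2[OF b] conjunct2[OF a] conjunct2[OF c(1)]
            conjunct2[OF d(1)] conjunct2[OF c(2)] conjunct2[OF d(2)] vb(3)[OF b8]] .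
    next
      case 3
      obtain u1 u2 where u: "nb a = {w, u1, u2}" "distinct [w, u1, u2]" "deg u1 = 2" "deg u2 = 2" "deg (oth u1 a) = 3"
        using half_nb[OF va(6)[OF 3] n'(1) w] .
      have ua: "a \<in> nb u1" "a \<in> nb u2" using u(1) nb_sym[of _ a] by auto
      have centre': "nb w = {b, c, d, a}" "distinct [b, c, d, a]" using centre dist by auto
      show False
        using reducible_two_threads_half[OF centre'(1) conjunct1[OF b] conjunct1[OF c(1)] conjunct1[OF d(1)]
          conjunct1[OF c(2)] conjunct1[OF d(2)]
            u(1) nb_deg2(1)[OF u(3) ua(1)] nb_deg2(1)[OF u(4) ua(2)] centre'(2) conjunct2[OF b] conjunct2[OF c(1)]
            conjunct2[OF d(1)] conjunct2[OF c(2)] conjunct2[OF d(2)] u(2) nb_deg2(2)[OF u(3) ua(1)]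
            nb_deg2(2)[OF u(4) ua(2)]] u(5) by simp
    qed
  qed
qed

text \<open>The table keeps to the surplus 12 in each case: 4 + 4 + 4 or 6 + 3 + 3 for a bad vertex;
  6 + 6 or 8 + 4 for two neighbours of degree 2, or 8 + 8 against 4 received; at most 12 for a
  single one.\<close>

lemma three_final:
  assumes v: "deg v = 3"
  shows "(\<Sum>x\<in>nb v. give v x) \<le> 12 + (\<Sum>x\<in>nb v. give x v)"
proof -
  have zero: "give v x = 0" if "deg x \<noteq> 2" for x using that v by (simp add: give_def)
  have "(\<Sum>x\<in>nb v. give v x) = (\<Sum>x\<in>two v. give v x)"
    by (rule sum.mono_neutral_right) (auto simp: two_def zero)
  moreover have "(\<Sum>x\<in>two v. give v x) \<le> 12 + (\<Sum>x\<in>nb v. give x v)"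
  proof (cases "bad v")
    case True
    then have tv: "two v = nb v" by (auto simp: two_def bad_def)
    show ?thesis
    proof (cases "\<exists>x\<in>nb v. bad (oth x v)")
      case False
      then have "give v x = 4" if "x \<in> nb v" for x using True v that by (auto simp: give_def bad_def)
      then show ?thesis using v tv by simp
    next
      case ex: True
      then obtain x where x: "x \<in> nb v" "bad (oth x v)" by blast
      have "give v y = 3" if "y \<in> nb v - {x}" for y
      proof -
        have "deg (oth y v) = 4" using bad_partner[OF True x] that by blast
        then have "\<not> bad (oth y v)" by (simp add: bad_def)
        then show ?thesis using True ex that by (simp add: give_def bad_def)
      qed
      then have "(\<Sum>y\<in>nb v - {x}. give v y) = (\<Sum>y\<in>nb v - {x}. 3)" by (rule sum.cong[OF refl])
      also have "\<dots> = 6" using v x by simp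
      finally have "(\<Sum>y\<in>nb v - {x}. give v y) = 6" .
      moreover have "give v x = 6" using True ex x by (simp add: give_def bad_def)
      ultimately show ?thesis using x tv by (simp add: sum.remove[OF finite_nb x(1)])
    qed
  next
    case nbad: False
    show ?thesis
    proof (cases "card (two v) = 2")
      case True
      then obtain x1 x2 where x: "two v = {x1, x2}" "x1 \<noteq> x2" using card_2_iff by metis
      have dx: "deg x1 = 2" "deg x2 = 2" using x(1) by (auto simp: two_def)
      show ?thesis
      proof (cases "\<exists>q\<in>nb v. deg q = 4")
        case ex: True
        then obtain q where q: "q \<in> nb v" "deg q = 4" by blast
        have "give q v \<le> (\<Sum>x\<in>nb v. give x v)" by (rule member_le_sum) (use q in auto)
        moreover have "give q v = (if half v then 4 else 0)" using q v by (simp add: give_def)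
        moreover have "give v x1 = (if half v then 8 else 6)" "give v x2 = (if half v then 8 else 6)"
          using v nbad True ex dx by (simp_all add: give_def)
        ultimately show ?thesis using x by auto
      next
        case False
        then have "give v x1 + give v x2 = 12"
          using v nbad True dx x by (auto simp: give_def half_def)
        then show ?thesis using x by simp
      qed
    next
      case False
      have "card (two v) \<le> 3" using card_mono[OF finite_nb, of "two v" v] v by (auto simp: two_def)
      moreover have "card (two v) \<noteq> 3"
      proof
        assume "card (two v) = 3"
        then have "two v = nb v" using v by (intro card_subset_eq) (auto simp: two_def)
        then show False using nbad v by (auto simp: bad_def two_def)
      qed
      ultimately have c: "card (two v) \<le> 1" using False by linarith
      have "(\<Sum>x\<in>two v. give v x) \<le> (\<Sum>x\<in>two v. 12)"
        by (rule sum_mono) (use v nbad False in \<open>auto simp: give_def two_def\<close>)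
      also have "\<dots> \<le> 12" using c by simp
      finally show ?thesis by simp
    qed
  qed
  ultimately show ?thesis by simp
qed

lemma give_three:
  assumes u: "deg u = 3" "\<not> bad u" and x: "x \<in> nb u" "deg x = 2"
  shows "4 \<le> give u x" "deg (oth x u) = 3 \<Longrightarrow> 6 \<le> give u x"
  using assms by (auto simp: give_def half_def two_def)

text \<open>Two bad ends give 6 each, and so do, at least, two ends that are not bad. In the mixed
  case the bad end gives 4, and the other end has to give 8.\<close>

lemma two_final_three:
  assumes x: "deg x = 2" "z \<in> nb x" and d: "deg z = 3" "deg (oth x z) = 3"
  shows "12 \<le> give z x + give (oth x z) x"
proof -
  have main: "12 \<le> give z x + give u x" if z: "deg z = 3" "bad z" "z \<in> nb x" and u: "deg u = 3"
    "\<not> bad u" "u = oth x z" for z u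
  proof -
    note o = oth_oth[OF x(1) z(3)]
    have xz: "x \<in> nb z" and xu: "x \<in> nb u" and ou: "oth x u = z" using o u by auto
    \<comment> \<open>A bad vertex facing \<open>z\<close> across another neighbour would force
      degree 4 at \<open>u\<close> by \<open>bad_partner\<close>.\<close>
    have "\<not> (\<exists>y\<in>nb z. bad (oth y z))"
    proof
      assume "\<exists>y\<in>nb z. bad (oth y z)"
      then obtain y where y: "y \<in> nb z" "bad (oth y z)" by blast
      then have "y \<noteq> x" using u by auto
      then have "deg (oth x z) = 4" using bad_partner[OF z(2) y xz] by simp
      then show False using u by simp
    qed
    then have "give z x = 4" using z x by (simp add: give_def)
    moreover have "8 \<le> give u x"
    \<comment> \<open>In this case \<open>u\<close> has two neighbours to serve and nothing to draw
      from. Its other far end has degree 4 by \<open>bad_next_to_three\<close>, and the table gives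
      8 to \<open>x\<close> and 4 to the other neighbour.\<close>
    proof (cases "card (two u) = 2 \<and> \<not> (\<exists>q\<in>nb u. deg q = 4)")
      case True
      have "card (two u - {x}) = 1" using True xu x by (simp add: two_def)
      then obtain x2 where x2: "two u - {x} = {x2}" using card_1_singletonE by blast
      then have x2': "x2 \<in> nb u" "deg x2 = 2" "x2 \<noteq> x" by (auto simp: two_def)
      have "card (nb u - {x, x2}) = 1" using u xu x2' by (simp add: card_Diff_subset)
      then obtain q where q: "nb u - {x, x2} = {q}" using card_1_singletonE by blast
      then have nbu: "nb u = {x, x2, q}" "distinct [x, x2, q]" using xu x2' by auto
      have "deg q \<le> 3" using True nbu degree[of q] by (metis insertCI le_antisym not_less_eq_eq
        numeral_3_eq_3 numeral_eq_Suc pred_numeral_simps(2) semiring_norm(26) semiring_norm(27))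
      then have "deg (oth x2 u) = 4" using bad_next_to_three[OF nbu x(1) x2'(2)] ou z by simp
      moreover have "x \<in> two u" "x2 \<in> two u" using xu x x2' by (auto simp: two_def)
      moreover from calculation have "\<exists>y\<in>two u. deg (oth y u) \<noteq> 3" by (intro bexI[of _ x2])
        simp_all
      ultimately have "half u" "\<not> (\<forall>y\<in>two u. deg (oth y u) = 3)"
        using True u(1) z(1) ou by (auto simp: half_def)
      then show ?thesis using True u(1,2) z(1) ou x(1) by (simp add: give_def)
    next
      case False
      moreover have "half u" if "card (two u) = 2"
        using that u xu x ou z by (auto simp: half_def two_def)
      ultimately show ?thesis using u x by (auto simp: give_def)
    qed
    ultimately show ?thesis by simp
  qed
  note o = oth_oth[OF x]
  consider "bad z" "bad (oth x z)" | "bad z" "\<not> bad (oth x z)" | "\<not> bad z" "bad (oth x z)" |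
    "\<not> bad z" "\<not> bad (oth x z)" by blast
  then show ?thesis
  proof cases
    case 1
    have "\<exists>y\<in>nb z. bad (oth y z)" "\<exists>y\<in>nb (oth x z). bad (oth y (oth x z))"
      using 1 o by (auto intro!: bexI[of _ x])
    then have "give z x = 6" "give (oth x z) x = 6" using 1 o(1) x(1) d by (simp_all add: give_def)
    then show ?thesis by simp
  next
    case 2
    then show ?thesis using main[of z "oth x z"] x d by simp
  next
    case 3
    then show ?thesis using main[of "oth x z" z] o d by simp
  next
    case 4
    then show ?thesis using give_three(2)[OF d(1) _ o(3) x(1)] give_three(2)[OF d(2) _ o(4) x(1)] o d by simp
  qed
qed

text \<open>By symmetry \<open>z\<close> may be the end of smaller degree. Unless both ends have
  degree 3, the other end has degree 4, and the two ends give at least 0 + 12, 3 + 9, 4 + 8 or 6 +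
  6.\<close>

lemma two_final:
  assumes x: "deg x = 2"
  shows "12 \<le> (\<Sum>z\<in>nb x. give z x)"
proof -
  have main: "12 \<le> give z x + give (oth x z) x" if z: "z \<in> nb x" "deg z \<le> deg (oth x z)" for z
  proof -
    note o = oth_oth[OF x z(1)]
    have zV: "z \<in> V" "oth x z \<in> V" using z o in_V by blast+
    from zV(1) show ?thesis
    proof (cases rule: deg_cases)
      case 1
      then have "deg (oth x z) = 4" using adjacent_twos[OF x z(1)] by simp
      then have "give (oth x z) x = 12" using x o 1 by (simp add: give_def)
      then show ?thesis by simp
    next
      case 2
      from zV(2) show ?thesis
      proof (cases rule: deg_cases)
        case 1
        then show ?thesis using z 2 by simp
      next
        case 2
        then show ?thesis using two_final_three[OF x z(1)] \<open>deg z = 3\<close> by simp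
      next
        case 3
        show ?thesis
        proof (cases "bad z")
          case True
          have "give (oth x z) x = 9" using x o 2 3 True by (simp add: give_def)
          moreover have "3 \<le> give z x" using x 2 True by (simp add: give_def)
          ultimately show ?thesis by simp
        next
          case False
          have "give (oth x z) x = 8" using x o 2 3 False by (simp add: give_def)
          then show ?thesis using give_three(1)[OF 2 False o(3) x] by simp
        qed
      qed
    next
      case 3
      then have "deg (oth x z) = 4" using z degree[of "oth x z"] by simp
      then show ?thesis using 3 x o by (simp add: give_def)
    qed
  qed
  obtain z where z: "z \<in> nb x" using x by fastforce
  note o = oth_oth[OF x z]
  have "(\<Sum>z\<in>nb x. give z x) = give z x + give (oth x z) x"
    using nb_deg2[OF x z] by simp
  moreover have "12 \<le> give z x + give (oth x z) x"
  proof (cases "deg z \<le> deg (oth x z)")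
    case True
    then show ?thesis using main z by simp
  next
    case False
    then show ?thesis using main[of "oth x z"] o by simp
  qed
  ultimately show ?thesis by simp
qed

text \<open>By the symmetry of \<open>nb\<close>, the total given equals the total received, so
  summing \<open>final\<close> over \<open>V\<close> leaves \<open>60 |V|\<close> against 24 times
  the degree sum.\<close>

theorem discharging: "5 * card V \<le> 2 * (\<Sum>v\<in>V. deg v)"
proof -
  have final: "60 + (\<Sum>x\<in>nb v. give v x) \<le> 24 * deg v + (\<Sum>x\<in>nb v. give x v)" if v:
    "v \<in> V" for v
    using v
  proof (cases rule: deg_cases)
    case 1
    then have "(\<Sum>x\<in>nb v. give v x) = 0" by (simp add: give_def half_def)
    then show ?thesis using two_final[OF 1] 1 by simp
  next
    case 2
    then show ?thesis using three_final[OF 2] by simp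
  next
    case 3
    then show ?thesis using four_final[OF 3] by simp
  qed
  have "(\<Sum>v\<in>V. \<Sum>x\<in>nb v. give v x) = (\<Sum>v\<in>V. \<Sum>x\<in>V. if x \<in> nb v then give v
    x else 0)"
    by (rule sum.cong[OF refl], subst sum.inter_restrict[OF finite_V, symmetric]) (use nb_V in \<open>auto
      intro: sum.cong\<close>)
  also have "\<dots> = (\<Sum>x\<in>V. \<Sum>v\<in>V. if x \<in> nb v then give v x else 0)" by (rule sum.swap)
  also have "\<dots> = (\<Sum>x\<in>V. \<Sum>v\<in>V. if v \<in> nb x then give v x else 0)"
    by (intro sum.cong refl if_cong) (use nb_sym in auto)
  also have "\<dots> = (\<Sum>x\<in>V. \<Sum>v\<in>nb x. give v x)"
    by (rule sum.cong[OF refl], subst sum.inter_restrict[OF finite_V, symmetric]) (use nb_V in \<open>auto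
      intro: sum.cong\<close>)
  finally have swap: "(\<Sum>v\<in>V. \<Sum>x\<in>nb v. give v x) = (\<Sum>v\<in>V. \<Sum>x\<in>nb v. give x v)" .
  have "(\<Sum>v\<in>V. 60 + (\<Sum>x\<in>nb v. give v x)) \<le> (\<Sum>v\<in>V. 24 * deg v + (\<Sum>x\<in>nb v.
    give x v))"
    by (rule sum_mono) (rule final)
  then have "60 * card V \<le> 24 * (\<Sum>v\<in>V. deg v)"
    using swap by (simp add: sum.distrib sum_distrib_left)
  then show ?thesis by simp
qed

end

section \<open>The colouring\<close>

lemma path_edges_successively:
  "path_edges xs \<subseteq> E \<longleftrightarrow> successively (\<lambda>u v. {u, v} \<in> E) xs"
  by (induction xs rule: path_edges.induct) auto

text \<open>The induction runs over vertex subsets of one fixed graph, so all hypotheses are stated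
  for \<open>nb\<close> and are inherited. For a critical subset, \<open>5 |V| <= 4 |F|\<close> from
  the discharging contradicts \<open>8 |F| + 10 <= 10 |V|\<close> from \<open>bound\<close>.\<close>

lemma colouring_exists:
  fixes nb :: "'a \<Rightarrow> 'a set"
  assumes fin: "finite V" and sym: "\<And>u v. u \<in> nb v \<Longrightarrow> v \<in> nb u" and irrefl:
    "\<And>v. v \<notin> nb v"
    and girth: "\<And>cs. distinct cs \<Longrightarrow> 3 \<le> length cs \<Longrightarrow> successively
      (\<lambda>u v. v \<in> nb u) cs \<Longrightarrow> hd cs \<in> nb (last cs)
       \<Longrightarrow> 10 \<le> length cs"
    and degree: "\<And>v. card (nb v) \<le> 4" "\<And>v. finite (nb v)"
    and bound: "\<And>F. F \<subseteq> {{u, v} |u v. v \<in> nb u} \<Longrightarrow> finite F \<Longrightarrow>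
      F \<noteq> {} \<Longrightarrow> 8 * card F + 10 \<le> 10 * card (\<Union>F)"
  shows "\<exists>c. (\<forall>v\<in>V. c v \<in> colours) \<and> (\<forall>v\<in>V. inj_on c (insert v (nb v
    \<inter> V)))"
  using fin
proof (induction "card V" arbitrary: V rule: less_induct)
  case less
  define nbV where "nbV = (\<lambda>v. if v \<in> V then nb v \<inter> V else {})"
  show ?case
  proof (rule ccontr)
    assume not_colourable: "\<not> ?case"
    interpret critical V nbV
    proof
      show "finite V" by fact
      show "v \<in> nbV u" if "u \<in> nbV v" for u v using that sym by (auto simp: nbV_def split: if_splits)
      show "v \<notin> nbV v" for v using irrefl by (simp add: nbV_def)
      show "nbV v \<subseteq> V" for v by (simp add: nbV_def)
      show "card (nbV v) \<le> 4" for v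
        using card_mono[OF degree(2), of "nb v \<inter> V" v] degree(1)[of v] by (auto simp: nbV_def)
      have sub: "u \<in> nb v" if "u \<in> nbV v" for u v using that by (auto simp: nbV_def split: if_splits)
      show "10 \<le> length cs" if "distinct cs" "3 \<le> length cs"
        "successively (\<lambda>u v. v \<in> nbV u) cs" "hd cs \<in> nbV (last cs)" for cs
        using girth[OF that(1,2) successively_mono[OF that(3) sub] sub[OF that(4)]] .
      show "\<exists>c. (\<forall>v\<in>V. c v \<in> colours) \<and> (\<forall>v\<in>V - {t}. inj_on c (insert v
        (nbV v - {t})))" if t: "t \<in> V" for t
      proof -
        have "card (V - {t}) < card V" using t less.prems by (meson card_Diff1_less)
        then obtain c where c: "\<forall>v\<in>V - {t}. c v \<in> colours"
            "\<forall>v\<in>V - {t}. inj_on c (insert v (nb v \<inter> (V - {t})))"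
          using less.hyps[of "V - {t}"] less.prems by blast
        \<comment> \<open>The colour 1 of \<open>t\<close> is a filler: the sets concerned do not
          contain \<open>t\<close>.\<close>
        have "inj_on (c(t := 1)) (insert v (nbV v - {t}))" if v: "v \<in> V - {t}" for v
        proof -
          have eq: "insert v (nbV v - {t}) = insert v (nb v \<inter> (V - {t}))" using v by (auto simp: nbV_def)
          have "inj_on (c(t := 1)) (insert v (nb v \<inter> (V - {t}))) \<longleftrightarrow> inj_on c (insert v
            (nb v \<inter> (V - {t})))"
            by (rule inj_on_cong) (use v in auto)
          then show ?thesis using c(2) v eq by simp
        qed
        moreover have "\<forall>v\<in>V. (c(t := 1)) v \<in> colours" using c(1) by (auto simp: colours_def)
        ultimately show ?thesis by blast
      qed
      have "inj_on c (insert v (nbV v)) \<longleftrightarrow> inj_on c (insert v (nb v \<inter> V))" if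
        "v \<in> V" for c :: "'a \<Rightarrow> nat" and v
        using that by (simp add: nbV_def)
      then show "\<not> (\<exists>c. (\<forall>v\<in>V. c v \<in> colours) \<and> (\<forall>v\<in>V. inj_on c
        (insert v (nbV v))))"
        using not_colourable by simp
    qed
    define A where "A = Sigma V nbV"
    define F where "F = (\<lambda>(u, v). {u, v}) ` A"
    have finA: "finite A" unfolding A_def using less.prems by (intro finite_SigmaI) (auto simp: nbV_def)
    then have finF: "finite F" by (simp add: F_def)
    have "card A = (\<Sum>v\<in>V. card (nbV v))"
      unfolding A_def using less.prems by (intro card_SigmaI) (auto simp: nbV_def)
    moreover have "card A \<le> 2 * card F"
    proof -
      have "A \<subseteq> (\<Union>e\<in>F. {p \<in> A. {fst p, snd p} = e})" by (auto simp: F_def)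
      then have "card A \<le> card (\<Union>e\<in>F. {p \<in> A. {fst p, snd p} = e})"
        by (rule card_mono[rotated]) (use finF finA in auto)
      also have "\<dots> \<le> (\<Sum>e\<in>F. card {p \<in> A. {fst p, snd p} = e})" by (rule card_UN_le[OF finF])
      also have "\<dots> \<le> (\<Sum>e\<in>F. 2)"
      proof (rule sum_mono)
        fix e assume "e \<in> F"
        then obtain u v where e: "e = {u, v}" by (auto simp: F_def)
        have "card {p \<in> A. {fst p, snd p} = e} \<le> card {(u, v), (v, u)}"
          by (rule card_mono) (auto simp: e doubleton_eq_iff)
        also have "\<dots> \<le> 2" by (cases "u = v") simp_all
        finally show "card {p \<in> A. {fst p, snd p} = e} \<le> 2" .
      qed
      finally show ?thesis by simp
    qed
    ultimately have le: "5 * card V \<le> 4 * card F" using discharging by simp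
    have "V \<noteq> {}" using not_colourable by auto
    then have "card V > 0" using less.prems by (simp add: card_gt_0_iff)
    then have "F \<noteq> {}" using le by auto
    moreover have "F \<subseteq> {{u, v} |u v. v \<in> nb u}" by (auto simp: F_def A_def nbV_def split:
      if_splits) blast
    ultimately have "8 * card F + 10 \<le> 10 * card (\<Union>F)" using bound finF by blast
    moreover have "card (\<Union>F) \<le> card V"
      by (rule card_mono[OF less.prems]) (auto simp: F_def A_def nbV_def split: if_splits)
    ultimately show False using le by linarith
  qed
qed

section \<open>From the digraph notions of the statement to vertex lists and edge sets\<close>

fun arcs_of :: "'a list \<Rightarrow> ('a \<times> 'a) list" where
  "arcs_of (x # y # xs) = (x, y) # arcs_of (y # xs)"
| "arcs_of _ = []"

lemma pcas_arcs_of: "xs \<noteq> [] \<Longrightarrow> pcas (hd xs) (arcs_of xs) (last xs)"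
  by (induction xs rule: arcs_of.induct) simp_all

lemma pawalk_verts_arcs_of: "xs \<noteq> [] \<Longrightarrow> pawalk_verts (hd xs) (arcs_of xs) = xs"
  by (induction xs rule: arcs_of.induct) simp_all

lemma length_arcs_of: "length (arcs_of xs) = length xs - 1"
  by (induction xs rule: arcs_of.induct) simp_all

lemma set_arcs_of:
  "set (arcs_of xs) \<subseteq> R \<longleftrightarrow> successively (\<lambda>u v. (u, v) \<in> R) xs"
  by (induction xs rule: arcs_of.induct) simp_all

lemma plane_drawing_imp_plane_graph:
  assumes draw: "plane_drawing G pos \<gamma>" and fin: "finite (parcs G)"
    and wf: "\<And>u v. (u, v) \<in> parcs G \<Longrightarrow> u \<in> pverts G \<and> v \<in> pverts G \<and> u
      \<noteq> v"
  shows "\<exists>img. plane_graph {{u, v} |u v. (u, v) \<in> parcs G} pos img"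
proof -
  define E where "E = {{u, v} |u v. (u, v) \<in> parcs G}"
  \<comment> \<open>Either of the two opposite arcs may be chosen: their curves are reverses of each
    other and have the same image.\<close>
  define img where "img e = path_image (\<gamma> (SOME p. p \<in> parcs G \<and> {fst p, snd p} = e))" for e
  have D: "inj_on pos (pverts G)"
    "\<forall>(u, v)\<in>parcs G. arc (\<gamma> (u, v)) \<and> pathstart (\<gamma> (u, v)) = pos u \<and>
      pathfinish (\<gamma> (u, v)) = pos v \<and>
      \<gamma> (v, u) = reversepath (\<gamma> (u, v)) \<and> path_image (\<gamma> (u, v)) \<inter> pos ` pverts
        G = {pos u, pos v}"
    "\<forall>(u, v)\<in>parcs G. \<forall>(x, y)\<in>parcs G. {u, v} \<noteq> {x, y} \<longrightarrow>
      path_image (\<gamma> (u, v)) \<inter> path_image (\<gamma> (x, y)) = pos ` ({u, v} \<inter> {x, y})"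
    using draw unfolding plane_drawing_def by simp_all
  have arcD: "arc (\<gamma> (u, v))" "pathstart (\<gamma> (u, v)) = pos u" "pathfinish (\<gamma> (u, v)) = pos v"
      "\<gamma> (v, u) = reversepath (\<gamma> (u, v))"
        "path_image (\<gamma> (u, v)) \<inter> pos ` pverts G = {pos u, pos v}"
    if "(u, v) \<in> parcs G" for u v
    using bspec[OF D(2) that] by simp_all
  have crossD: "path_image (\<gamma> (u, v)) \<inter> path_image (\<gamma> (x, y)) = pos ` ({u, v} \<inter> {x, y})"
    if "(u, v) \<in> parcs G" "(x, y) \<in> parcs G" "{u, v} \<noteq> {x, y}" for u v x y
    using D(3) that by fast
  have img: "img {u, v} = path_image (\<gamma> (u, v))" if uv: "(u, v) \<in> parcs G" for u v
  proof -
    define p where "p = (SOME p. p \<in> parcs G \<and> {fst p, snd p} = {u, v})"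
    have "p \<in> parcs G \<and> {fst p, snd p} = {u, v}"
      unfolding p_def by (rule someI[of _ "(u, v)"]) (use uv in simp)
    then have "p = (u, v) \<or> p = (v, u)" by (cases p) (auto simp: doubleton_eq_iff)
    moreover have "img {u, v} = path_image (\<gamma> p)" by (simp add: img_def p_def)
    moreover have "path_image (\<gamma> (v, u)) = path_image (\<gamma> (u, v))" using arcD(4)[OF uv] by simp
    ultimately show ?thesis by metis
  qed
  have UE: "\<Union>E \<subseteq> pverts G" using wf unfolding E_def by blast
  have "plane_graph E pos img"
  proof
    have "E = (\<lambda>(u, v). {u, v}) ` parcs G" unfolding E_def by auto
    then show "finite E" using fin by simp
    show "inj_on pos (\<Union>E)" by (rule inj_on_subset[OF D(1) UE])
  next
    fix e assume eE: "e \<in> E"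
    then obtain u v where e: "e = {u, v}" "(u, v) \<in> parcs G" unfolding E_def by blast
    show "\<exists>u v g. e = {u, v} \<and> u \<noteq> v \<and> arc g \<and> pathstart g = pos u \<and>
      pathfinish g = pos v \<and> path_image g = img e"
      by (rule exI[of _ u], rule exI[of _ v], rule exI[of _ "\<gamma> (u, v)"])
        (use e wf[OF e(2)] arcD(1-3)[OF e(2)] img[OF e(2)] in simp)
    have eU: "e \<subseteq> \<Union>E" using eE by blast
    have "path_image (\<gamma> (u, v)) \<inter> pos ` pverts G = pos ` e" using arcD(5)[OF e(2)] e(1) by simp
    then show "img e \<inter> pos ` \<Union>E = pos ` e"
      unfolding e(1) img[OF e(2)] by (rule Int_squeeze) (use eU UE e(1) in \<open>auto intro: image_mono\<close>)
  next
    fix e f assume ef: "e \<in> E" "f \<in> E" "e \<noteq> f"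
    then obtain u v x y where e: "e = {u, v}" "(u, v) \<in> parcs G" and f: "f = {x, y}" "(x, y) \<in> parcs G"
      unfolding E_def by blast
    show "img e \<inter> img f = pos ` (e \<inter> f)"
      using crossD[OF e(2) f(2)] ef(3) unfolding e(1) f(1) img[OF e(2)] img[OF f(2)] by blast
  qed
  then show ?thesis unfolding E_def by blast
qed

theorem theorem6:
  fixes G :: "'a pair_pre_digraph"
  assumes "pair_graph G"
    and "planar G"
    and "girth G \<ge> 10"
    and "max_degree G = 4"
  shows "two_distance_chromatic_number G \<le> 6"
proof -
  interpret pair_graph G by fact
  define nb where "nb v = {u. (v, u) \<in> parcs G}" for v
  have nbV: "nb v \<subseteq> pverts G" for v by (auto simp: nb_def dest: wellformed')
  have nb_sym: "v \<in> nb u" if "u \<in> nb v" for u v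
    using that pair_sym_arcs by (auto simp: nb_def symmetric_def dest: symD)
  have irrefl: "v \<notin> nb v" for v using pair_no_loops[of "(v, v)"] by (auto simp: nb_def)
  have fin: "finite (nb v)" for v using finite_subset[OF nbV pair_finite_verts] .
  have outdeg: "out_degree G v = card (nb v)" for v
  proof -
    have "out_arcs G v = Pair v ` nb v" by (auto simp: out_arcs_def nb_def)
    then show ?thesis by (simp add: out_degree_def card_image inj_on_def)
  qed
  have degree: "card (nb v) \<le> 4" for v
  proof (cases "v \<in> pverts G")
    case True
    have "bdd_above (out_degree G ` pverts G)" using pair_finite_verts by simp
    then have "out_degree G v \<le> max_degree G" unfolding max_degree_def by (rule cSUP_upper[OF True])
    then show ?thesis using assms(4) outdeg by simp
  next
    case False
    then have "nb v = {}" by (auto simp: nb_def dest: wellformed')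
    then show ?thesis by simp
  qed
  have girth: "10 \<le> length cs" if cs: "distinct cs" "3 \<le> length cs"
    "successively (\<lambda>u v. v \<in> nb u) cs" "hd cs \<in> nb (last cs)" for cs
  proof -
    \<comment> \<open>Repeating the head closes the walk, so the number of arcs equals the number of
      vertices of \<open>cs\<close>.\<close>
    define xs where "xs = cs @ [hd cs]"
    define p where "p = arcs_of xs"
    have ne: "xs \<noteq> []" "cs \<noteq> []" using cs by (auto simp: xs_def)
    have suc: "successively (\<lambda>u v. (u, v) \<in> parcs G) xs"
      using cs ne unfolding xs_def nb_def by (simp add: successively_append_iff)
    have hl: "hd xs = hd cs" "last xs = hd cs" using ne by (simp_all add: xs_def)
    have len: "length p = length cs" by (simp add: p_def xs_def length_arcs_of)
    have "hd cs \<in> pverts G" using cs(4) nbV by blast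
    then have "awalk (hd cs) p (hd cs)"
      using pcas_arcs_of[OF ne(1)] set_arcs_of[of xs "parcs G"] suc hl unfolding awalk_def p_def by simp
    moreover have "distinct (tl (pawalk_verts (hd cs) p))"
      using pawalk_verts_arcs_of[OF ne(1)] hl cs(1) ne unfolding p_def xs_def by (cases cs) auto
    moreover have "p \<noteq> []" using len ne by auto
    ultimately have "cycle p" unfolding cycle_def by blast
    then have "girth G \<le> enat (length p)"
      unfolding girth_def using len cs(2) by (intro INF_lower) simp
    then have "10 \<le> enat (length p)" using assms(3) order_trans by blast
    then show ?thesis using len by (simp add: numeral_eq_enat)
  qed
  define E where "E = {{u, v} |u v. v \<in> nb u}"
  have inE: "{u, v} \<in> E \<longleftrightarrow> v \<in> nb u" for u v using nb_sym by (auto simp: E_def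
    doubleton_eq_iff)
  have "\<exists>pos img. plane_graph E pos img"
  proof -
    obtain pos \<gamma> where "plane_drawing G pos \<gamma>" using assms(2) by (auto simp: planar_def)
    moreover have "u \<in> pverts G \<and> v \<in> pverts G \<and> u \<noteq> v" if "(u, v) \<in> parcs G" for u v
      using wellformed'[OF that] pair_no_loops[OF that] by simp
    moreover have "E = {{u, v} |u v. (u, v) \<in> parcs G}" by (simp add: E_def nb_def)
    ultimately show ?thesis using plane_drawing_imp_plane_graph[OF _ pair_finite_arcs] by metis
  qed
  then obtain pos img where plane: "plane_graph E pos img" by blast
  have gcycle_girth: "10 \<le> length cs" if "gcycle F cs" "F \<subseteq> E" for F cs
  proof -
    have c: "distinct cs" "3 \<le> length cs" "path_edges (cs @ [hd cs]) \<subseteq> E" using that by (auto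
      simp: gcycle_def cycle_edges_def)
    then have "successively (\<lambda>u v. v \<in> nb u) (cs @ [hd cs])" unfolding path_edges_successively inE by simp
    moreover have "cs \<noteq> []" using c by auto
    ultimately show ?thesis using girth[OF c(1,2)] by (simp add: successively_append_iff)
  qed
  have bound: "8 * card F + 10 \<le> 10 * card (\<Union>F)" if F: "F \<subseteq> {{u, v} |u v. v \<in> nb u}"
    "F \<noteq> {}" for F
  proof (rule plane_edge_bound[OF _ _ F(2)])
    have "F \<subseteq> E" using F(1) by (simp add: E_def)
    then show "plane_graph F pos img" by (rule plane_graph_mono[OF plane])
    show "10 \<le> length cs" if "gcycle F cs" for cs using gcycle_girth[OF that \<open>F \<subseteq> E\<close>] .
  qed
  obtain c where c: "\<forall>v\<in>pverts G. c v \<in> colours"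
    "\<forall>v\<in>pverts G. inj_on c (insert v (nb v \<inter> pverts G))"
    using colouring_exists[OF pair_finite_verts nb_sym irrefl girth degree fin bound] by blast
  have inj: "inj_on c (insert v (nb v))" if "v \<in> pverts G" for v
    using bspec[OF c(2) that] unfolding Int_absorb2[OF nbV[of v]] .
  have "two_distance_coloring G 6 c"
    unfolding two_distance_coloring_def
  proof (intro conjI ballI impI)
    show "c \<in> pverts G \<rightarrow> {1..6}" using c(1) by (auto simp: colours_def)
    fix u v assume uv: "u \<in> pverts G" "v \<in> pverts G" "u \<noteq> v \<and> graph_dist G u v \<le> 2"
    have cost: "awalk_cost (\<lambda>_. 1) p = real (length p)" for p by (induction p) auto
    \<comment> \<open>Walk lengths are integers: if none is at most 2, the infimum defining the
      distance is at least 3.\<close>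
    have "\<exists>p. awalk u p v \<and> length p \<le> 2"
    proof (rule ccontr)
      assume "\<nexists>p. awalk u p v \<and> length p \<le> 2"
      then have "3 \<le> graph_dist G u v"
        unfolding graph_dist_def \<mu>_def by (intro INF_greatest) (auto simp: cost not_le)
      then have "(3 :: ereal) \<le> 2" using uv(3) order_trans by blast
      then show False by simp
    qed
    then obtain p where p: "awalk u p v" "length p \<le> 2" by blast
    then consider "p = []" | e where "p = [e]" | e f where "p = [e, f]"
      by (cases p; cases "tl p") auto
    then show "c u \<noteq> c v"
    proof cases
      case 1
      then show ?thesis using p uv(3) by (simp add: awalk_def)
    next
      case 2
      then have "v \<in> nb u" using p by (auto simp: awalk_def nb_def)
      then show ?thesis using inj_onD[OF inj[OF uv(1)], of u v] uv(3) by auto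
    next
      case 3
      then obtain w where w: "(u, w) \<in> parcs G" "(w, v) \<in> parcs G" using p by (cases e; cases f) (auto
        simp: awalk_def)
      then have "u \<in> nb w" "v \<in> nb w" "w \<in> pverts G" using nb_sym[of w u] nbV[of u] by (auto simp: nb_def)
      then show ?thesis using inj_onD[OF inj, of w u v] uv(3) by auto
    qed
  qed
  then show ?thesis unfolding two_distance_chromatic_number_def by (intro Least_le) blast
qed

end
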